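(* The metric space $(\mathcal{O}_{L_0}, d_{\mathcal{A}})$ is complete, where $d_{\mathcal{A}}$ is the geodesic distance of the ambient metric $\mathcal{A}$ on $\mathcal{O}_{L_0}$.
   Context: Let $\mathcal{H}$ be an infinite-dimensional real Hilbert space, $\mathcal{B}(\mathcal{H})$ its bounded operators, $\mathcal{B}_2(\mathcal{H})$ the Hilbert–Schmidt operators with $\|a\|_2=\mathrm{Tr}(a^*a)^{1/2}$. For a closed subspace $W$, $\mathcal{B}(W)_s$ (resp. $\mathcal{B}_2(W)_s$) denotes the symmetric bounded (resp. symmetric Hilbert–Schmidt) operators on $W$, and $P_W$ the orthogonal projection onto $W$. Fix $J\in\mathcal{B}(\mathcal{H})$, a linear isometry with $J^2=-1$, $J^*=-J$. Let $\mathrm{Sp}(\mathcal{H})=\{g \text{ invertible in }\mathcal{B}(\mathcal{H}): g^*Jg=J\}$ and $\mathrm{Sp}_2(\mathcal{H})=\{g\in \mathrm{Sp}(\mathcal{H}): g-1\in\mathcal{B}_2(\mathcal{H})\}$. The Lagrangian Grassmannian $\Lambda(\mathcal{H})$ is the set of closed subspaces $L\subset\mathcal{H}$ with $J(L)=L^\perp$. Fix $L_0\in\Lambda(\mathcal{H})$ and put $\mathcal{O}_{L_0}=\{g(L_0): g\in \mathrm{Sp}_2(\mathcal{H})\}$. Manifold structure: for $L\in\Lambda(\mathcal{H})$ let $\Omega(L^\perp)=\{W\in\Lambda(\mathcal{H}): \mathcal{H}=W\oplus L^\perp\}$. Each $W\in\Omega(L^\perp)$ is the graph $\{v+Tv: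 v\in L\}$ of a unique bounded $T:L\to L^\perp$, and $\phi_L(W):=J|_{L^\perp}T\in\mathcal{B}(L)_s$. For $L\in\mathcal{O}_{L_0}$, $\phi_L$ restricts to a bijection $\Omega(L^\perp)\cap\mathcal{O}_{L_0}\to\mathcal{B}_2(L)_s$; these restrictions are the charts giving $\mathcal{O}_{L_0}$ its topology and smooth Hilbert manifold structure. The tangent space $T_W\mathcal{O}_{L_0}$ is identified with $\mathcal{B}_2(W)_s$ through the differential at $W$ of the chart $\phi_W$. Ambient metric: for $v\in T_W\mathcal{O}_{L_0}=\mathcal{B}_2(W)_s$, $\mathcal{A}(W,v)=\mathrm{tr}_W(v^*v)^{1/2}=\|vP_W\|_2$. The length of a smooth curve $\gamma:[0,1]\to\mathcal{O}_{L_0}$ is $L_{\mathcal{A}}(\gamma)=\int_0^1\mathcal{A}(\gamma(t),\dot\gamma(t))\,dt$, and $d_{\mathcal{A}}(S,T)=\inf\{L_{\mathcal{A}}(\gamma): \gamma \text{ joins } S \text{ and } T \text{ in } \mathcal{O}_{L_0}\}$. *)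

theory Defs
  imports "HOL-Analysis.Analysis"
begin

section \<open>Bounded operators on a real Hilbert space\<close>

text \<open>
  A real Hilbert space is a type of sort \<open>{real_inner, complete_space}\<close>; no separability is
  assumed.
\<close>

type_synonym 'a bop = "'a \<Rightarrow>\<^sub>L 'a"

definition adj :: "'a::{real_inner, complete_space} bop \<Rightarrow> 'a bop" where
  "adj a = Blinfun (adjoint (blinfun_apply a))"

definition bop_invertible :: "'a::{real_inner, complete_space} bop \<Rightarrow> bool" where
  "bop_invertible g \<longleftrightarrow> (\<exists>h. g o\<^sub>L h = id_blinfun \<and> h o\<^sub>L g = id_blinfun)"

text \<open>The orthogonal projection; intended for closed subspaces.\<close>

definition proj :: "'a::{real_inner, complete_space} set \<Rightarrow> 'a bop" where
  "proj W = (THE P :: 'a bop. \<forall>x. P x \<in> W \<and> x - P x \<in> W\<^sup>\<bottom>)"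


section \<open>Hilbert-Schmidt operators\<close>

definition orthonormal_basis :: "'a::{real_inner, complete_space} set \<Rightarrow> bool" where
  "orthonormal_basis B \<longleftrightarrow>
     pairwise orthogonal B \<and> (\<forall>e\<in>B. norm e = 1) \<and> closure (span B) = UNIV"

text \<open>
  The trace of a positive operator does not depend on the orthonormal basis, so one is chosen
  once and for all.
\<close>

definition some_onb :: "'a::{real_inner, complete_space} set" where
  "some_onb = (SOME B. orthonormal_basis B)"

definition op_trace :: "'a::{real_inner, complete_space} bop \<Rightarrow> real" where
  "op_trace a = (\<Sum>\<^sub>\<infinity>e\<in>some_onb. a e \<bullet> e)"

text \<open>
  Since \<open>infsum\<close> is \<open>0\<close> for a divergent family, \<open>hs_norm\<close> is meaningful only together with
  \<open>hilbert_schmidt\<close>, i.e. convergence of the trace of \<open>a\<^sup>* a\<close>.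
\<close>

definition hilbert_schmidt :: "'a::{real_inner, complete_space} bop \<Rightarrow> bool" where
  "hilbert_schmidt a \<longleftrightarrow> (\<lambda>e. (adj a o\<^sub>L a) e \<bullet> e) summable_on some_onb"

definition hs_norm :: "'a::{real_inner, complete_space} bop \<Rightarrow> real" where
  "hs_norm a = sqrt (op_trace (adj a o\<^sub>L a))"

text \<open>
  A bounded operator \<open>v\<close> on a closed subspace \<open>W\<close> is represented by the operator \<open>v P\<^sub>W\<close> on the
  whole space, which extends \<open>v\<close> by \<open>0\<close> on the orthogonal complement. Symmetry and the
  Hilbert-Schmidt norm are the same for \<open>v\<close> and its extension.
\<close>

definition sym_hs :: "'a::{real_inner, complete_space} set \<Rightarrow> 'a bop set" where
  "sym_hs W = {v. proj W o\<^sub>L v o\<^sub>L proj W = v \<and> adj v = v \<and> hilbert_schmidt v}"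

text \<open>Calculus of curves of Hilbert-Schmidt operators, with respect to the Hilbert-Schmidt norm.\<close>

definition has_hs_derivative ::
  "(real \<Rightarrow> 'a::{real_inner, complete_space} bop) \<Rightarrow> 'a bop \<Rightarrow> real \<Rightarrow> real set \<Rightarrow> bool" where
  "has_hs_derivative f v t S \<longleftrightarrow>
     hilbert_schmidt v \<and> (\<forall>s\<in>S. hilbert_schmidt (f s)) \<and>
     ((\<lambda>s. hs_norm ((f s - f t) /\<^sub>R (s - t) - v)) \<longlongrightarrow> 0) (at t within S)"

definition hs_smooth_on ::
  "real set \<Rightarrow> (real \<Rightarrow> 'a::{real_inner, complete_space} bop) \<Rightarrow> bool" where
  "hs_smooth_on S f \<longleftrightarrow>
     (\<exists>F. F 0 = f \<and> (\<forall>n. \<forall>t\<in>S. has_hs_derivative (F n) (F (Suc n) t) t S))"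


section \<open>The restricted symplectic group and the Lagrangian Grassmannian\<close>

definition Sp :: "'a::{real_inner, complete_space} bop \<Rightarrow> 'a bop set" where
  "Sp J = {g. bop_invertible g \<and> adj g o\<^sub>L J o\<^sub>L g = J}"

definition Sp2 :: "'a::{real_inner, complete_space} bop \<Rightarrow> 'a bop set" where
  "Sp2 J = {g \<in> Sp J. hilbert_schmidt (g - id_blinfun)}"

definition Lagrangians :: "'a::{real_inner, complete_space} bop \<Rightarrow> 'a set set" where
  "Lagrangians J = {L. subspace L \<and> closed L \<and> J ` L = L\<^sup>\<bottom>}"

definition Lorbit :: "'a::{real_inner, complete_space} bop \<Rightarrow> 'a set \<Rightarrow> 'a set set" where
  "Lorbit J L0 = {blinfun_apply g ` L0 | g. g \<in> Sp2 J}"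


section \<open>Charts, tangent vectors and the geodesic distance\<close>

text \<open>\<open>chart_dom J L\<close> is the set of Lagrangians complementary to the orthogonal complement of \<open>L\<close>.\<close>

definition chart_dom :: "'a::{real_inner, complete_space} bop \<Rightarrow> 'a set \<Rightarrow> 'a set set" where
  "chart_dom J L = {W \<in> Lagrangians J.
     W \<inter> L\<^sup>\<bottom> = {0} \<and> (\<forall>x. \<exists>w\<in>W. \<exists>u\<in>L\<^sup>\<bottom>. x = w + u)}"

text \<open>The operator from \<open>L\<close> to its complement with graph \<open>W\<close>, again extended by \<open>0\<close>.\<close>

definition graph_op ::
  "'a::{real_inner, complete_space} set \<Rightarrow> 'a set \<Rightarrow> 'a bop" where
  "graph_op L W = (THE T :: 'a bop. (\<forall>x\<in>L\<^sup>\<bottom>. T x = 0) \<and> (\<forall>x\<in>L. T x \<in> L\<^sup>\<bottom>) \<and>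
     W = {v + T v | v. v \<in> L})"

definition chart ::
  "'a::{real_inner, complete_space} bop \<Rightarrow> 'a set \<Rightarrow> 'a set \<Rightarrow> 'a bop" where
  "chart J L W = J o\<^sub>L graph_op L W"

text \<open>
  Smooth curves \<open>[0,1] \<rightarrow> Lorbit J L0\<close>, read in the charts centred at all points of the orbit
  (one-sided derivatives at the end points). Openness of the preimages of the chart domains
  together with continuity in the charts is continuity for the manifold topology.
\<close>

definition smooth_curve ::
  "'a::{real_inner, complete_space} bop \<Rightarrow> 'a set \<Rightarrow> (real \<Rightarrow> 'a set) \<Rightarrow> bool" where
  "smooth_curve J L0 \<gamma> \<longleftrightarrow>
     (\<forall>t\<in>{0..1}. \<gamma> t \<in> Lorbit J L0) \<and>
     (\<forall>L\<in>Lorbit J L0.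
        openin (top_of_set {0..1}) {t\<in>{0..1}. \<gamma> t \<in> chart_dom J L} \<and>
        hs_smooth_on {t\<in>{0..1}. \<gamma> t \<in> chart_dom J L} (\<lambda>t. chart J L (\<gamma> t)))"

text \<open>
  The tangent space at \<open>W\<close> is \<open>sym_hs W\<close>, through the differential at \<open>W\<close> of the chart centred
  at \<open>W\<close>; hence the velocity at time \<open>t\<close> is the derivative at \<open>t\<close> in the chart centred at \<open>\<gamma> t\<close>.
\<close>

definition velocity ::
  "'a::{real_inner, complete_space} bop \<Rightarrow> (real \<Rightarrow> 'a set) \<Rightarrow> real \<Rightarrow> 'a bop" where
  "velocity J \<gamma> t = (THE v. v \<in> sym_hs (\<gamma> t) \<and>
     has_hs_derivative (\<lambda>s. chart J (\<gamma> t) (\<gamma> s)) v t {s\<in>{0..1}. \<gamma> s \<in> chart_dom J (\<gamma> t)})"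

definition ambient_metric ::
  "'a::{real_inner, complete_space} set \<Rightarrow> 'a bop \<Rightarrow> real" where
  "ambient_metric W v = hs_norm (v o\<^sub>L proj W)"

definition ambient_length ::
  "'a::{real_inner, complete_space} bop \<Rightarrow> (real \<Rightarrow> 'a set) \<Rightarrow> real" where
  "ambient_length J \<gamma> = integral {0..1} (\<lambda>t. ambient_metric (\<gamma> t) (velocity J \<gamma> t))"

text \<open>
  The value \<open>0\<close> off the orbit is a convention: \<open>Metric_space\<close> requires a total distance function
  that is nonnegative and symmetric also outside of the carrier.
\<close>

definition ambient_dist ::
  "'a::{real_inner, complete_space} bop \<Rightarrow> 'a set \<Rightarrow> 'a set \<Rightarrow> 'a set \<Rightarrow> real" where
  "ambient_dist J L0 S T =
     (if S \<in> Lorbit J L0 \<and> T \<in> Lorbit J L0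
      then Inf {ambient_length J \<gamma> | \<gamma>. smooth_curve J L0 \<gamma> \<and> \<gamma> 0 = S \<and> \<gamma> 1 = T}
      else 0)"

end

theory Submission
  imports Defs
begin

text \<open>
  The map sending a Lagrangian to its orthogonal projection identifies the orbit with a closed
  subset of an affine space over the Hilbert-Schmidt operators, and up to the factor \<open>sqrt 2\<close> it
  carries the ambient metric to the Hilbert-Schmidt norm: if \<open>Y\<close> is the derivative of the projections
  along a curve and \<open>E\<close> the projection at that moment, then \<open>Y = Y E + E Y\<close> is an orthogonal sum of
  two mutually adjoint operators, and the velocity in the chart centred there is \<open>J Y E\<close>
  (\<open>ambient_speed\<close>). Curves are smooth for the charts if and only if their projections are smooth
  (\<open>smooth_curve_iff\<close>), because chart coordinate and projection determine each other through sums,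
  products and inverses: for \<open>E = proj L\<close>, the operator \<open>G = proj W + E - 1\<close> is invertible exactly
  when \<open>W\<close> lies in the chart centred at \<open>L\<close>, and its inverse is \<open>2 E - 1 + T + T\<^sup>*\<close>, where \<open>W\<close> is the
  graph of \<open>T\<close>. So all questions about the ambient distance concern lengths of curves of projections.

  A chord is at most as long as the curve. Hence the Hilbert-Schmidt distance of the projections is
  at most \<open>sqrt 2\<close> times the ambient distance
  (\<open>projection_distance_le_ambient_dist\<close>). This separates points, and it turns a Cauchy sequence for
  the ambient distance into one for the Hilbert-Schmidt norm. The limit of the projections is again
  a symmetric idempotent \<open>P\<close> with \<open>P J = J (1 - P)\<close>, that is, the projection onto a Lagrangian.

  Conversely, Lagrangians \<open>L\<close> and \<open>W\<close> whose projections are close are joined by a short curve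
  (\<open>nearby_joined\<close>): \<open>W\<close> is the graph of a small Hilbert-Schmidt operator \<open>T\<close>, the operators \<open>1 + t T\<close>
  belong to the restricted symplectic group, and they shear \<open>L\<close> along the graphs of \<open>t T\<close>. This shows
  that the limit above belongs to the orbit and that the sequence converges to it.

  The distance is an infimum over curves, so it is meaningful only because the orbit is connected
  (\<open>orbit_connected\<close>). Given \<open>L\<close> and \<open>W\<close> in the orbit, as long as \<open>W\<close> contains a unit vector almost
  orthogonal to \<open>L\<close>, a shear turns this vector towards \<open>L\<close> and lowers the squared Hilbert-Schmidt
  distance of the projections by \<open>1/2\<close> at least. After finitely many steps no such vector is left,
  and then \<open>W\<close> is a graph over \<open>L\<close>. The triangle inequality is obtained from smooth curves by
  reparametrizing them with a step that is flat at both ends before they are pasted.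
\<close>

section \<open>Orthogonal projections and adjoints\<close>

lemma orthogonal_compD: "x \<in> W\<^sup>\<bottom> \<Longrightarrow> y \<in> W \<Longrightarrow> x \<bullet> y = 0"
  by (auto simp: orthogonal_comp_def orthogonal_def inner_commute)

lemma orthogonal_compI: "(\<And>y. y \<in> W \<Longrightarrow> x \<bullet> y = 0) \<Longrightarrow> x \<in> W\<^sup>\<bottom>"
  by (auto simp: orthogonal_comp_def orthogonal_def inner_commute)

lemma nearest_point_orthogonal:
  fixes x p :: "'a::real_inner"
  assumes W: "subspace W" and p: "p \<in> W" and min: "\<And>w. w \<in> W \<Longrightarrow> norm (x - p) \<le> norm (x - w)"
  shows "x - p \<in> W\<^sup>\<bottom>"
proof (rule orthogonal_compI)
  fix w assume w: "w \<in> W"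
  show "(x - p) \<bullet> w = 0"
  proof (cases "w = 0")
    case False
    define c where "c = ((x - p) \<bullet> w) / (w \<bullet> w)"
    have ww: "w \<bullet> w > 0" using False by simp
    have "p + c *\<^sub>R w \<in> W" by (simp add: W p w subspace_add subspace_scale)
    from min[OF this] have "(x - p) \<bullet> (x - p) \<le> (x - p - c *\<^sub>R w) \<bullet> (x - p - c *\<^sub>R w)"
      by (simp add: norm_le diff_diff_eq)
    also have "\<dots> = (x - p) \<bullet> (x - p) - 2 * c * ((x - p) \<bullet> w) + c * c * (w \<bullet> w)"
      by (simp add: inner_diff_left inner_diff_right inner_commute algebra_simps)
    also have "c * c * (w \<bullet> w) = c * ((x - p) \<bullet> w)" using ww by (simp add: c_def)
    finally have "c * ((x - p) \<bullet> w) \<le> 0" by simp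
    moreover have "c * ((x - p) \<bullet> w) = ((x - p) \<bullet> w)\<^sup>2 / (w \<bullet> w)" by (simp add: c_def power2_eq_square)
    ultimately have "((x - p) \<bullet> w)\<^sup>2 / (w \<bullet> w) \<le> 0" by simp
    then show ?thesis using ww
      by (metis divide_pos_pos linorder_not_less zero_less_power2)
  qed simp
qed

text \<open>
  A minimising sequence for the distance from \<open>x\<close> to \<open>W\<close> is Cauchy by the parallelogram law;
  completeness provides the nearest point, and nearest points are feet of perpendiculars.
\<close>

lemma closed_subspace_orthogonal_decomposition:
  fixes x :: "'a::{real_inner, complete_space}"
  assumes W: "subspace W" "closed W"
  obtains p where "p \<in> W" "x - p \<in> W\<^sup>\<bottom>"
proof -
  define d where "d = infdist x W"
  have ne: "W \<noteq> {}" using W subspace_0 by blast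
  have d0: "d \<ge> 0" by (simp add: d_def infdist_nonneg)
  have dle: "d \<le> norm (x - w)" if "w \<in> W" for w
    using infdist_le[OF that, of x] by (simp add: d_def dist_norm)
  have "\<exists>w\<in>W. (norm (x - w))\<^sup>2 < d\<^sup>2 + 1 / real (Suc n)" for n
  proof -
    have "sqrt (d\<^sup>2 + 1 / real (Suc n)) > d"
      using d0 by (metis less_add_same_cancel1 of_nat_0_less_iff real_less_rsqrt zero_less_Suc zero_less_divide_1_iff)
    then have "\<exists>w\<in>W. dist x w < sqrt (d\<^sup>2 + 1 / real (Suc n))"
      using ne by (metis (no_types, lifting) cINF_greatest d_def infdist_def linorder_not_less)
    then obtain w where w: "w \<in> W" "norm (x - w) < sqrt (d\<^sup>2 + 1 / real (Suc n))"
      by (auto simp: dist_norm)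
    then have "(norm (x - w))\<^sup>2 < (sqrt (d\<^sup>2 + 1 / real (Suc n)))\<^sup>2"
      by (intro power_strict_mono) auto
    also have "\<dots> = d\<^sup>2 + 1 / real (Suc n)" using d0 by (intro real_sqrt_pow2) auto
    finally show ?thesis using w by blast
  qed
  then obtain w where w: "\<And>n. w n \<in> W" "\<And>n. (norm (x - w n))\<^sup>2 < d\<^sup>2 + 1 / real (Suc n)"
    by metis
  have par: "(norm (w m - w n))\<^sup>2 \<le> 2 / real (Suc m) + 2 / real (Suc n)" for m n
  proof -
    have "(1/2) *\<^sub>R (w m + w n) \<in> W" by (simp add: W subspace_add subspace_scale w)
    then have "d\<^sup>2 \<le> (norm (x - (1/2) *\<^sub>R (w m + w n)))\<^sup>2"
      using d0 dle by (simp add: power_mono)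
    moreover have "(norm (w m - w n))\<^sup>2 + 4 * (norm (x - (1/2) *\<^sub>R (w m + w n)))\<^sup>2
        = 2 * (norm (x - w m))\<^sup>2 + 2 * (norm (x - w n))\<^sup>2"
      by (simp add: power2_norm_eq_inner inner_diff_left inner_diff_right inner_add_left
          inner_add_right inner_commute algebra_simps)
    ultimately show ?thesis using w(2)[of m] w(2)[of n] by linarith
  qed
  have "Cauchy w"
  proof (rule metric_CauchyI)
    fix e :: real assume e: "e > 0"
    obtain M :: nat where M: "real M > 4 / e\<^sup>2" using reals_Archimedean2 by blast
    have "dist (w m) (w n) < e" if "m \<ge> M" "n \<ge> M" for m n
    proof -
      have "4 / real (Suc M) < e\<^sup>2"
        using M e by (simp add: field_simps) (smt (verit) zero_less_power)
      moreover have "2 / real (Suc m) \<le> 2 / real (Suc M)" "2 / real (Suc n) \<le> 2 / real (Suc M)"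
        using that by (auto intro!: divide_left_mono)
      ultimately have "(norm (w m - w n))\<^sup>2 < e\<^sup>2" using par[of m n] by linarith
      then show ?thesis using e by (simp add: dist_norm power_less_imp_less_base)
    qed
    then show "\<exists>M. \<forall>m\<ge>M. \<forall>n\<ge>M. dist (w m) (w n) < e" by blast
  qed
  then obtain p where p: "w \<longlonglongrightarrow> p" using Cauchy_convergent convergent_def by blast
  have "p \<in> W" using closed_sequentially[OF W(2)] w(1) p by blast
  moreover have "norm (x - p) \<le> d"
  proof -
    have "(\<lambda>n. (norm (x - w n))\<^sup>2) \<longlonglongrightarrow> (norm (x - p))\<^sup>2" by (intro tendsto_intros p)
    moreover have "(\<lambda>n. d\<^sup>2 + 1 / real (Suc n)) \<longlonglongrightarrow> d\<^sup>2 + 0"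
      by (intro tendsto_intros LIMSEQ_Suc lim_1_over_n)
    ultimately have "(norm (x - p))\<^sup>2 \<le> d\<^sup>2 + 0"
      by (rule LIMSEQ_le) (use w(2) less_imp_le in blast)
    then show ?thesis using d0 by (auto intro: power2_le_imp_le[of "norm (x - p)" d])
  qed
  ultimately show ?thesis
    using that nearest_point_orthogonal[OF W(1), of p x] dle order_trans by blast
qed

lemma subspace_Int_orthogonal_comp: "x \<in> W \<Longrightarrow> x \<in> W\<^sup>\<bottom> \<Longrightarrow> x = 0"
  using orthogonal_compD inner_eq_zero_iff by blast

text \<open>
  Uniqueness of the decomposition makes the projection linear, so the definite description that
  defines \<open>proj\<close> has a value.
\<close>

lemma proj_characterization:
  fixes W :: "'a::{real_inner, complete_space} set"
  assumes W: "subspace W" "closed W"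
  shows "proj W x \<in> W" "x - proj W x \<in> W\<^sup>\<bottom>"
proof -
  define p where "p x = (SOME p. p \<in> W \<and> x - p \<in> W\<^sup>\<bottom>)" for x :: 'a
  have p: "p x \<in> W" "x - p x \<in> W\<^sup>\<bottom>" for x
    using someI_ex[of "\<lambda>p. p \<in> W \<and> x - p \<in> W\<^sup>\<bottom>"] closed_subspace_orthogonal_decomposition[OF W]
    unfolding p_def by metis+
  have S: "subspace (W\<^sup>\<bottom>)" by (rule subspace_orthogonal_comp)
  have uniq: "q = p x" if "q \<in> W" "x - q \<in> W\<^sup>\<bottom>" for q x
  proof -
    have "q - p x \<in> W" by (simp add: W p subspace_diff that)
    moreover have "(x - p x) - (x - q) \<in> W\<^sup>\<bottom>" using S p that subspace_diff by blast
    ultimately show ?thesis using subspace_Int_orthogonal_comp[of "q - p x" W] by simp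
  qed
  have "p (x + y) = p x + p y" for x y
  proof (rule uniq[symmetric])
    show "p x + p y \<in> W" by (simp add: W p subspace_add)
    have "(x - p x) + (y - p y) \<in> W\<^sup>\<bottom>" using S p subspace_add by blast
    then show "x + y - (p x + p y) \<in> W\<^sup>\<bottom>" by (simp add: algebra_simps)
  qed
  moreover have "p (r *\<^sub>R x) = r *\<^sub>R p x" for r x
  proof (rule uniq[symmetric])
    show "r *\<^sub>R p x \<in> W" by (simp add: W p subspace_scale)
    have "r *\<^sub>R (x - p x) \<in> W\<^sup>\<bottom>" using S p subspace_scale by blast
    then show "r *\<^sub>R x - r *\<^sub>R p x \<in> W\<^sup>\<bottom>" by (simp add: algebra_simps)
  qed
  moreover have "norm (p x) \<le> norm x * 1" for x
  proof -
    have "(x - p x) \<bullet> p x = 0" using orthogonal_compD p by blast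
    then have "p x \<bullet> p x = x \<bullet> p x" by (simp add: inner_diff_left)
    then have "norm (p x) * norm (p x) \<le> norm x * norm (p x)"
      by (metis norm_cauchy_schwarz norm_eq_square power2_eq_square power2_norm_eq_inner)
    then show ?thesis by (cases "p x = 0") auto
  qed
  ultimately have bl: "bounded_linear p" by (intro bounded_linear_intro)
  have "\<forall>x. Blinfun p x \<in> W \<and> x - Blinfun p x \<in> W\<^sup>\<bottom>"
    using p by (simp add: bounded_linear_Blinfun_apply[OF bl])
  moreover have "P = Blinfun p" if "\<forall>x. blinfun_apply P x \<in> W \<and> x - P x \<in> W\<^sup>\<bottom>" for P
    by (rule blinfun_eqI) (use that uniq bounded_linear_Blinfun_apply[OF bl] in auto)
  ultimately have "\<forall>x. proj W x \<in> W \<and> x - proj W x \<in> W\<^sup>\<bottom>"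
    unfolding proj_def by (rule theI2) auto
  then show "proj W x \<in> W" "x - proj W x \<in> W\<^sup>\<bottom>" by auto
qed

lemma proj_unique:
  fixes W :: "'a::{real_inner, complete_space} set"
  assumes W: "subspace W" "closed W" and "q \<in> W" "x - q \<in> W\<^sup>\<bottom>"
  shows "proj W x = q"
proof -
  have "proj W x - q \<in> W" by (simp add: W assms proj_characterization subspace_diff)
  moreover have "(x - q) - (x - proj W x) \<in> W\<^sup>\<bottom>"
    using subspace_orthogonal_comp subspace_diff proj_characterization[OF W] assms by blast
  ultimately show ?thesis using subspace_Int_orthogonal_comp[of "proj W x - q" W] by simp
qed

text \<open>A normal to the kernel, suitably scaled, represents the functional.\<close>

lemma riesz_representation:
  fixes f :: "'a::{real_inner, complete_space} \<Rightarrow>\<^sub>L real"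
  obtains z where "\<And>x. f x = x \<bullet> z" "norm z \<le> norm f"
proof -
  define K where "K = {x. blinfun_apply f x = 0}"
  have K: "subspace K" "closed K"
    by (auto simp: K_def subspace_def blinfun.add_right blinfun.scaleR_right
        intro!: closed_Collect_eq continuous_intros)
  obtain z where z: "\<And>x. f x = x \<bullet> z"
  proof (cases "\<forall>x. f x = 0")
    case True then show ?thesis using that[of 0] by simp
  next
    case False
    then obtain y where y: "f y \<noteq> 0" by blast
    define n where "n = y - proj K y"
    have n: "n \<in> K\<^sup>\<bottom>" "f n = f y"
      using proj_characterization[OF K, of y] by (auto simp: n_def K_def blinfun.diff_right)
    have nn: "n \<bullet> n > 0" using y n by auto
    have "f x = x \<bullet> ((f n / (n \<bullet> n)) *\<^sub>R n)" for x
    proof -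
      have "x - (f x / f n) *\<^sub>R n \<in> K" using y n by (simp add: K_def blinfun.diff_right blinfun.scaleR_right)
      then have "n \<bullet> (x - (f x / f n) *\<^sub>R n) = 0" using n orthogonal_compD by blast
      then have "(n \<bullet> x) * f n = f x * (n \<bullet> n)" using y n by (simp add: inner_diff_right field_simps)
      then show ?thesis using nn by (simp add: inner_commute field_simps)
    qed
    then show ?thesis using that by blast
  qed
  have "norm z * norm z \<le> norm f * norm z"
    using norm_blinfun[of f z] by (simp add: z flip: power2_norm_eq_inner power2_eq_square)
  then have "norm z \<le> norm f" by (cases "z = 0") auto
  then show ?thesis using that z by blast
qed

text \<open>
  The adjoint of a bounded operator exists by Riesz representation and is unique, hence the choice
  made by \<open>adjoint\<close> is this operator and is bounded.
\<close>

lemma adj_inner: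
  fixes a :: "'a::{real_inner, complete_space} bop"
  shows "x \<bullet> adj a y = a x \<bullet> y" "adj a y \<bullet> x = y \<bullet> a x"
proof -
  have "\<exists>z. (\<forall>x. a x \<bullet> y = x \<bullet> z) \<and> norm z \<le> norm a * norm y" for y
  proof -
    define f where "f = Blinfun (\<lambda>x. a x \<bullet> y)"
    have f: "f x = a x \<bullet> y" for x
      unfolding f_def by (subst bounded_linear_Blinfun_apply) (auto intro!: bounded_linear_intros)
    obtain z where "\<And>x. f x = x \<bullet> z" "norm z \<le> norm f" using riesz_representation by blast
    moreover have "norm f \<le> norm a * norm y"
    proof (rule norm_blinfun_bound)
      fix x
      have "\<bar>a x \<bullet> y\<bar> \<le> norm (a x) * norm y" by (rule Cauchy_Schwarz_ineq2)
      also have "\<dots> \<le> (norm a * norm x) * norm y" by (intro mult_right_mono norm_blinfun) auto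
      finally show "norm (f x) \<le> norm a * norm y * norm x" by (simp add: f mult_ac)
    qed auto
    ultimately show ?thesis using f by (metis order_trans)
  qed
  then obtain b where b: "\<And>x y. a x \<bullet> y = x \<bullet> b y" "\<And>y. norm (b y) \<le> norm a * norm y"
    by metis
  have "bounded_linear b"
  proof (rule bounded_linear_intro)
    show "b (y + z) = b y + b z" for y z
      by (rule vector_eq_rdot[THEN iffD1]) (metis b(1) inner_add_right inner_commute)
    show "b (r *\<^sub>R y) = r *\<^sub>R b y" for r y
      by (rule vector_eq_rdot[THEN iffD1]) (metis b(1) inner_commute inner_scaleR_right)
    show "norm (b y) \<le> norm y * norm a" for y using b(2)[of y] by (simp add: mult.commute)
  qed
  moreover have "adjoint (blinfun_apply a) = b" by (rule adjoint_unique) (simp add: b)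
  ultimately have "blinfun_apply (adj a) = b" by (simp add: adj_def bounded_linear_Blinfun_apply)
  then show "x \<bullet> adj a y = a x \<bullet> y" "adj a y \<bullet> x = y \<bullet> a x" using b(1) by (simp_all add: inner_commute)
qed

lemma adj_eqI:
  fixes a b :: "'a::{real_inner, complete_space} bop"
  assumes "\<And>x y. a x \<bullet> y = x \<bullet> b y"
  shows "adj a = b"
proof (rule blinfun_eqI)
  fix y show "adj a y = b y"
    by (rule vector_eq_rdot[THEN iffD1]) (metis adj_inner(1) assms inner_commute)
qed

lemma adj_adj [simp]: "adj (adj a) = a"
  by (rule adj_eqI) (simp add: adj_inner)

lemma adj_add: "adj (a + b) = adj a + adj b"
  by (rule adj_eqI) (simp add: blinfun.bilinear_simps adj_inner inner_add_left inner_add_right)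

lemma adj_diff: "adj (a - b) = adj a - adj b"
  by (rule adj_eqI) (simp add: blinfun.bilinear_simps adj_inner inner_diff_left inner_diff_right)

lemma adj_scaleR: "adj (r *\<^sub>R a) = r *\<^sub>R adj a"
  by (rule adj_eqI) (simp add: blinfun.bilinear_simps adj_inner)

lemma adj_compose: "adj (a o\<^sub>L b) = adj b o\<^sub>L adj a"
  by (rule adj_eqI) (simp add: adj_inner)

lemma adj_id [simp]: "adj id_blinfun = id_blinfun"
  by (rule adj_eqI) simp

lemma norm_adj: "norm (adj a) = norm a"
proof -
  have "norm (adj a) \<le> norm a" for a :: "'a::{real_inner, complete_space} bop"
  proof (rule norm_blinfun_bound)
    fix y
    have "norm (adj a y) * norm (adj a y) = y \<bullet> a (adj a y)"
      by (simp add: adj_inner(2)[symmetric] flip: power2_norm_eq_inner power2_eq_square)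
    also have "\<dots> \<le> norm y * norm (a (adj a y))" by (rule norm_cauchy_schwarz)
    also have "\<dots> \<le> norm y * (norm a * norm (adj a y))"
      by (intro mult_left_mono norm_blinfun) auto
    finally have "norm (adj a y) * norm (adj a y) \<le> (norm a * norm y) * norm (adj a y)" by (simp add: mult_ac)
    then show "norm (adj a y) \<le> norm a * norm y" by (cases "adj a y = 0") auto
  qed auto
  from this[of a] this[of "adj a"] show ?thesis by simp
qed

lemma proj_mem_iff:
  assumes W: "subspace W" "closed W"
  shows "proj W x = x \<longleftrightarrow> x \<in> W"
  using proj_characterization[OF W] proj_unique[OF W, of x x] subspace_0[OF subspace_orthogonal_comp]
  by (metis diff_self)

lemma proj_zero_iff:
  assumes W: "subspace W" "closed W"
  shows "proj W x = 0 \<longleftrightarrow> x \<in> W\<^sup>\<bottom>"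
  using proj_characterization[OF W] proj_unique[OF W, of 0 x] subspace_0[OF W(1)]
  by (metis diff_zero)

lemma proj_idem:
  assumes W: "subspace W" "closed W"
  shows "proj W (proj W x) = proj W x"
  using proj_mem_iff[OF W] proj_characterization[OF W] by blast

lemma proj_sym:
  assumes W: "subspace W" "closed W"
  shows "proj W x \<bullet> y = x \<bullet> proj W y"
proof -
  have "proj W x \<bullet> (y - proj W y) = 0" "(x - proj W x) \<bullet> proj W y = 0"
    using proj_characterization[OF W] orthogonal_compD inner_commute by metis+
  then show ?thesis by (simp add: inner_diff_left inner_diff_right)
qed

lemma adj_proj:
  assumes W: "subspace W" "closed W"
  shows "adj (proj W) = proj W"
  by (rule adj_eqI) (rule proj_sym[OF W])

lemma norm_proj_le:
  assumes W: "subspace W" "closed W"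
  shows "norm (proj W x) \<le> norm x" "norm (proj W) \<le> 1"
proof -
  show *: "norm (proj W x) \<le> norm x" for x
  proof -
    have "norm (proj W x) * norm (proj W x) = x \<bullet> proj W x"
      by (metis proj_idem[OF W] proj_sym[OF W] power2_norm_eq_inner power2_eq_square)
    also have "\<dots> \<le> norm x * norm (proj W x)" by (rule norm_cauchy_schwarz)
    finally show ?thesis by (cases "proj W x = 0") auto
  qed
  show "norm (proj W) \<le> 1" by (rule norm_blinfun_bound) (auto simp: *)
qed

lemma proj_inject:
  assumes "subspace W" "closed W" "subspace V" "closed V" "proj W = proj V"
  shows "W = V"
  using assms proj_mem_iff by (metis subsetI subset_antisym)

lemma range_symmetric_idempotent:
  fixes P :: "'a::{real_inner, complete_space} bop"
  assumes idem: "P o\<^sub>L P = P" and sym: "adj P = P"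
  shows "subspace (range P)" "closed (range P)" "proj (range P) = P"
proof -
  have PP: "P (P x) = P x" for x by (metis idem blinfun_apply_blinfun_compose)
  have eq: "range P = {x. P x = x}" using PP by auto (metis rangeI)
  show S: "subspace (range P)" unfolding eq
    by (auto simp: subspace_def blinfun.add_right blinfun.scaleR_right)
  show C: "closed (range P)" unfolding eq by (intro closed_Collect_eq continuous_intros)
  show "proj (range P) = P"
  proof (rule blinfun_eqI, rule proj_unique[OF S C])
    fix x show "x - P x \<in> (range P)\<^sup>\<bottom>"
    proof (rule orthogonal_compI)
      fix y assume "y \<in> range P"
      then have y: "y = P y" using eq by auto
      have "(x - P x) \<bullet> y = P (x - P x) \<bullet> y" by (metis adj_inner(1) sym y)
      then show "(x - P x) \<bullet> y = 0" by (simp add: blinfun.diff_right PP)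
    qed
  qed auto
qed

section \<open>Orthonormal bases\<close>

lemma subspace_closure:
  fixes S :: "'a::real_normed_vector set"
  assumes "subspace S" shows "subspace (closure S)"
proof (unfold subspace_def, intro conjI ballI allI)
  show "0 \<in> closure S" using assms closure_subset subspace_0 by blast
  fix x y :: 'a and c :: real assume "x \<in> closure S"
  then obtain u where u: "\<forall>n. u n \<in> S" "u \<longlonglongrightarrow> x" by (auto simp: closure_sequential)
  have "(\<lambda>n. c *\<^sub>R u n) \<longlonglongrightarrow> c *\<^sub>R x" by (intro tendsto_intros u)
  moreover have "\<forall>n. c *\<^sub>R u n \<in> S" using u(1) assms subspace_scale by blast
  ultimately show "c *\<^sub>R x \<in> closure S" by (auto simp: closure_sequential)
  assume "y \<in> closure S"
  then obtain v where v: "\<forall>n. v n \<in> S" "v \<longlonglongrightarrow> y" by (auto simp: closure_sequential)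
  have "(\<lambda>n. u n + v n) \<longlonglongrightarrow> x + y" by (intro tendsto_intros u v)
  moreover have "\<forall>n. u n + v n \<in> S" using u(1) v(1) assms subspace_add by blast
  ultimately show "x + y \<in> closure S" by (auto simp: closure_sequential)
qed

text \<open>
  A maximal orthonormal set spans a dense subspace, since otherwise a normalised perpendicular to the
  closure of the span could be added.
\<close>

lemma orthonormal_basis_exists: "\<exists>B :: 'a::{real_inner, complete_space} set. orthonormal_basis B"
proof -
  define \<A> where "\<A> = {B :: 'a set. pairwise orthogonal B \<and> (\<forall>e\<in>B. norm e = 1)}"
  have "\<exists>M\<in>\<A>. \<forall>X\<in>\<A>. M \<subseteq> X \<longrightarrow> X = M"
  proof (rule subset_Zorn_nonempty)
    show "\<A> \<noteq> {}" by (auto simp: \<A>_def intro!: exI[of _ "{}"])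
    fix \<C> assume ne: "\<C> \<noteq> {}" and ch: "subset.chain \<A> \<C>"
    have sub: "\<C> \<subseteq> \<A>" using ch by (simp add: subset_chain_def)
    have "orthogonal x y" if "x \<in> \<Union>\<C>" "y \<in> \<Union>\<C>" "x \<noteq> y" for x y
    proof -
      obtain X Y where XY: "X \<in> \<C>" "Y \<in> \<C>" "x \<in> X" "y \<in> Y" using \<open>x \<in> \<Union>\<C>\<close> \<open>y \<in> \<Union>\<C>\<close> by blast
      have "X \<subseteq> Y \<or> Y \<subseteq> X" using ch XY by (auto simp: subset_chain_def)
      then show ?thesis using XY sub that by (auto simp: \<A>_def pairwise_def subset_iff)
    qed
    then show "\<Union>\<C> \<in> \<A>" using sub by (auto simp: \<A>_def pairwise_def)
  qed
  then obtain B where B: "B \<in> \<A>" and max: "\<And>X. X \<in> \<A> \<Longrightarrow> B \<subseteq> X \<Longrightarrow> X = B" by blast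
  let ?W = "closure (span B)"
  have W: "subspace ?W" "closed ?W" by (auto simp: subspace_closure)
  have "x \<in> ?W" for x
  proof (rule ccontr)
    assume x: "x \<notin> ?W"
    define n where "n = x - proj ?W x"
    have n: "n \<in> ?W\<^sup>\<bottom>" "n \<noteq> 0" using proj_characterization[OF W] x by (auto simp: n_def) (metis W proj_mem_iff)
    define e where "e = n /\<^sub>R norm n"
    have e: "norm e = 1" using n by (simp add: e_def)
    have orth: "e \<bullet> b = 0" "b \<bullet> e = 0" if "b \<in> B" for b
      using orthogonal_compD[OF n(1), of b] closure_subset[of "span B"] span_base[OF that]
      by (auto simp: e_def inner_commute)
    have "insert e B \<in> \<A>" using B orth e by (auto simp: \<A>_def pairwise_insert orthogonal_def)
    then have "e \<in> B" using max by blast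
    then show False using orth e by fastforce
  qed
  then show ?thesis using B by (auto simp: orthonormal_basis_def \<A>_def)
qed

lemma orthonormal_basis_some_onb: "orthonormal_basis some_onb"
  unfolding some_onb_def by (rule someI_ex) (rule orthonormal_basis_exists)

lemma onb_inner:
  assumes "orthonormal_basis B" "e \<in> B" "f \<in> B"
  shows "e \<bullet> f = (if e = f then 1 else 0)"
  using assms by (auto simp: orthonormal_basis_def pairwise_def orthogonal_def norm_eq_1)

text \<open>
  The right-hand side is minimal for the Fourier coefficients. The choice of these coefficients gives
  Bessel's inequality, and comparison with an arbitrary approximation from the span gives Parseval's
  equation.
\<close>

lemma norm_diff_partial_expansion:
  assumes B: "orthonormal_basis B" and F: "finite F" "F \<subseteq> B"
  shows "(norm (x - (\<Sum>e\<in>F. c e *\<^sub>R e)))\<^sup>2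
    = (norm x)\<^sup>2 - (\<Sum>e\<in>F. (x \<bullet> e)\<^sup>2) + (\<Sum>e\<in>F. (x \<bullet> e - c e)\<^sup>2)"
proof -
  have 1: "(\<Sum>e\<in>F. c e *\<^sub>R e) \<bullet> (\<Sum>e\<in>F. c e *\<^sub>R e) = (\<Sum>e\<in>F. (c e)\<^sup>2)"
  proof -
    have "(\<Sum>e\<in>F. c e *\<^sub>R e) \<bullet> (\<Sum>e\<in>F. c e *\<^sub>R e) = (\<Sum>e\<in>F. \<Sum>f\<in>F. c e * (c f * (e \<bullet> f)))"
      by (simp add: inner_sum_left inner_sum_right sum_distrib_left inner_commute mult_ac)
    also have "\<dots> = (\<Sum>e\<in>F. \<Sum>f\<in>F. if f = e then c e * c e else 0)"
      by (intro sum.cong refl) (use F in \<open>auto simp: onb_inner[OF B] subset_iff\<close>)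
    also have "\<dots> = (\<Sum>e\<in>F. (c e)\<^sup>2)" using F by (simp add: power2_eq_square)
    finally show ?thesis .
  qed
  have 2: "(\<Sum>e\<in>F. (x \<bullet> e - c e)\<^sup>2) = (\<Sum>e\<in>F. (x \<bullet> e)\<^sup>2) - 2 * (\<Sum>e\<in>F. c e * (x \<bullet> e)) + (\<Sum>e\<in>F. (c e)\<^sup>2)"
    by (simp add: sum.distrib sum_subtractf sum_distrib_left power2_diff mult_ac)
  show ?thesis unfolding 2
    by (simp add: power2_norm_eq_inner inner_diff_left inner_diff_right 1 inner_commute)
       (simp add: inner_sum_left inner_sum_right inner_commute)
qed

lemma bessel:
  assumes B: "orthonormal_basis B" and F: "finite F" "F \<subseteq> B"
  shows "(\<Sum>e\<in>F. (x \<bullet> e)\<^sup>2) \<le> (norm x)\<^sup>2"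
  using norm_diff_partial_expansion[OF assms, of x "\<lambda>e. x \<bullet> e"]
  by simp (metis diff_ge_0_iff_ge zero_le_power2)

lemma parseval:
  assumes B: "orthonormal_basis B"
  shows "((\<lambda>e. (x \<bullet> e)\<^sup>2) has_sum (norm x)\<^sup>2) B"
proof -
  have summ: "(\<lambda>e. (x \<bullet> e)\<^sup>2) summable_on B"
    by (rule nonneg_bdd_above_summable_on) (auto intro!: bdd_aboveI2[where M = "(norm x)\<^sup>2"] bessel[OF B])
  have le: "(\<Sum>\<^sub>\<infinity>e\<in>B. (x \<bullet> e)\<^sup>2) \<le> (norm x)\<^sup>2"
    by (rule infsum_le_finite_sums[OF summ]) (rule bessel[OF B])
  have "(norm x)\<^sup>2 \<le> (\<Sum>\<^sub>\<infinity>e\<in>B. (x \<bullet> e)\<^sup>2) + \<epsilon>" if "\<epsilon> > 0" for \<epsilon>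
  proof -
    have "x \<in> closure (span B)" using B by (simp add: orthonormal_basis_def)
    then obtain y where y: "y \<in> span B" "dist y x < sqrt \<epsilon>"
      using \<open>\<epsilon> > 0\<close> by (metis closure_approachable real_sqrt_gt_0_iff)
    then obtain F r where F: "finite F" "F \<subseteq> B" "y = (\<Sum>e\<in>F. r e *\<^sub>R e)"
      by (auto simp: span_explicit)
    have "(norm x)\<^sup>2 - (\<Sum>e\<in>F. (x \<bullet> e)\<^sup>2) \<le> (norm (x - y))\<^sup>2"
      unfolding F(3) norm_diff_partial_expansion[OF B F(1,2)] by (simp add: sum_nonneg)
    also have "\<dots> \<le> \<epsilon>"
      using y(2) that by (metis dist_norm dist_commute less_imp_le norm_ge_zero power_mono real_sqrt_pow2)
    finally have "(norm x)\<^sup>2 \<le> (\<Sum>e\<in>F. (x \<bullet> e)\<^sup>2) + \<epsilon>" by simp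
    moreover have "(\<Sum>e\<in>F. (x \<bullet> e)\<^sup>2) \<le> (\<Sum>\<^sub>\<infinity>e\<in>B. (x \<bullet> e)\<^sup>2)"
      by (rule finite_sum_le_infsum[OF summ]) (use F in auto)
    ultimately show ?thesis by simp
  qed
  then have "(norm x)\<^sup>2 \<le> (\<Sum>\<^sub>\<infinity>e\<in>B. (x \<bullet> e)\<^sup>2)" by (rule field_le_epsilon)
  then show ?thesis using le summ by (simp add: has_sum_iff)
qed

lemma parseval_inner:
  assumes B: "orthonormal_basis B"
  shows "((\<lambda>e. (x \<bullet> e) * (y \<bullet> e)) has_sum (x \<bullet> y)) B"
proof -
  have "((\<lambda>e. (1/4) * (((x + y) \<bullet> e)\<^sup>2 + - ((x - y) \<bullet> e)\<^sup>2)) has_sum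
      (1/4) * ((norm (x + y))\<^sup>2 + - (norm (x - y))\<^sup>2)) B"
    by (intro has_sum_cmult_right has_sum_add) (auto simp: has_sum_uminus intro!: parseval[OF B])
  also have "(\<lambda>e. (1/4) * (((x + y) \<bullet> e)\<^sup>2 + - ((x - y) \<bullet> e)\<^sup>2)) = (\<lambda>e. (x \<bullet> e) * (y \<bullet> e))"
    by (auto simp: inner_add_left inner_diff_left power2_eq_square algebra_simps)
  also have "(1/4) * ((norm (x + y))\<^sup>2 + - (norm (x - y))\<^sup>2) = x \<bullet> y"
    by (simp add: power2_norm_eq_inner inner_add_left inner_diff_left inner_add_right inner_diff_right inner_commute)
  finally show ?thesis .
qed

section \<open>The Hilbert space of Hilbert-Schmidt operators\<close>

lemma hilbert_schmidt_iff: "hilbert_schmidt a \<longleftrightarrow> (\<lambda>e. a e \<bullet> a e) summable_on some_onb"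
  by (simp add: hilbert_schmidt_def adj_inner)

lemma hs_norm_eq: "hs_norm a = sqrt (\<Sum>\<^sub>\<infinity>e\<in>some_onb. a e \<bullet> a e)"
  by (simp add: hs_norm_def op_trace_def adj_inner)

lemma has_sum_finite_sum:
  assumes "finite F" "\<And>f. f \<in> F \<Longrightarrow> (g f has_sum s f) B"
  shows "((\<lambda>e. \<Sum>f\<in>F. g f e :: real) has_sum (\<Sum>f\<in>F. s f)) B"
  using assms by (induction F rule: finite_induct) (auto intro: has_sum_add)

text \<open>
  By Parseval, each finite partial sum for the adjoint is dominated by the full sum for the
  operator itself; no interchange of infinite sums is involved.
\<close>

lemma adj_partial_sum_le:
  assumes a: "hilbert_schmidt a" and F: "finite F" "F \<subseteq> some_onb"
  shows "(\<Sum>f\<in>F. adj a f \<bullet> adj a f) \<le> (\<Sum>\<^sub>\<infinity>e\<in>some_onb. a e \<bullet> a e)"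
proof -
  note B = orthonormal_basis_some_onb
  have 1: "((\<lambda>e. \<Sum>f\<in>F. (a e \<bullet> f)\<^sup>2) has_sum (\<Sum>f\<in>F. adj a f \<bullet> adj a f)) some_onb"
  proof (rule has_sum_finite_sum[OF F(1)])
    fix f
    have "((\<lambda>e. (adj a f \<bullet> e)\<^sup>2) has_sum (norm (adj a f))\<^sup>2) some_onb" by (rule parseval[OF B])
    then show "((\<lambda>e. (a e \<bullet> f)\<^sup>2) has_sum (adj a f \<bullet> adj a f)) some_onb"
      by (simp add: adj_inner inner_commute power2_norm_eq_inner)
  qed
  have "(\<Sum>f\<in>F. (a e \<bullet> f)\<^sup>2) \<le> a e \<bullet> a e" for e
    using bessel[OF B F, of "a e"] by (simp add: power2_norm_eq_inner)
  then show ?thesis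
    using has_sum_mono[OF 1 has_sum_infsum] a by (auto simp: hilbert_schmidt_iff)
qed

lemma hilbert_schmidt_adj: "hilbert_schmidt a \<Longrightarrow> hilbert_schmidt (adj a)"
  unfolding hilbert_schmidt_iff[of "adj a"]
  by (rule nonneg_bdd_above_summable_on) (auto intro!: bdd_aboveI2 adj_partial_sum_le)

lemma hs_norm_adj:
  assumes "hilbert_schmidt a"
  shows "hs_norm (adj a) = hs_norm a"
proof -
  have "hs_norm (adj a) \<le> hs_norm a" if a: "hilbert_schmidt a" for a :: "'a bop"
    unfolding hs_norm_eq
    by (intro real_sqrt_le_mono infsum_le_finite_sums adj_partial_sum_le a)
       (use hilbert_schmidt_adj[OF a] in \<open>auto simp: hilbert_schmidt_iff\<close>)
  from this[OF assms] this[OF hilbert_schmidt_adj[OF assms]] show ?thesis by simp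
qed

lemma hilbert_schmidt_compose_left:
  assumes "hilbert_schmidt a"
  shows "hilbert_schmidt (b o\<^sub>L a)" "hs_norm (b o\<^sub>L a) \<le> norm b * hs_norm a"
proof -
  have summ: "(\<lambda>e. (norm b)\<^sup>2 * (a e \<bullet> a e)) summable_on some_onb"
    using assms by (intro summable_on_cmult_right) (simp add: hilbert_schmidt_iff)
  have le: "b (a e) \<bullet> b (a e) \<le> (norm b)\<^sup>2 * (a e \<bullet> a e)" for e
    using power_mono[OF norm_blinfun[of b "a e"], of 2]
    by (simp add: power2_norm_eq_inner power_mult_distrib)
  have summ2: "(\<lambda>e. b (a e) \<bullet> b (a e)) summable_on some_onb"
    by (rule summable_on_comparison_test[OF summ]) (auto intro: le)
  then show "hilbert_schmidt (b o\<^sub>L a)" by (simp add: hilbert_schmidt_iff)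
  have "(\<Sum>\<^sub>\<infinity>e\<in>some_onb. b (a e) \<bullet> b (a e)) \<le> (\<Sum>\<^sub>\<infinity>e\<in>some_onb. (norm b)\<^sup>2 * (a e \<bullet> a e))"
    by (rule infsum_mono[OF summ2 summ le])
  also have "\<dots> = (norm b)\<^sup>2 * (\<Sum>\<^sub>\<infinity>e\<in>some_onb. a e \<bullet> a e)" by (rule infsum_cmult_right')
  finally show "hs_norm (b o\<^sub>L a) \<le> norm b * hs_norm a"
    by (auto simp: hs_norm_eq real_sqrt_mult dest: real_sqrt_le_mono)
qed

lemma hilbert_schmidt_compose_right:
  assumes "hilbert_schmidt a"
  shows "hilbert_schmidt (a o\<^sub>L b)" "hs_norm (a o\<^sub>L b) \<le> hs_norm a * norm b"
proof -
  have eq: "a o\<^sub>L b = adj (adj b o\<^sub>L adj a)" by (simp add: adj_compose)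
  have *: "hilbert_schmidt (adj b o\<^sub>L adj a)"
    by (intro hilbert_schmidt_compose_left hilbert_schmidt_adj assms)
  then show "hilbert_schmidt (a o\<^sub>L b)" unfolding eq by (rule hilbert_schmidt_adj)
  have "hs_norm (a o\<^sub>L b) = hs_norm (adj b o\<^sub>L adj a)" unfolding eq by (rule hs_norm_adj[OF *])
  also have "\<dots> \<le> norm (adj b) * hs_norm (adj a)"
    by (intro hilbert_schmidt_compose_left hilbert_schmidt_adj assms)
  finally show "hs_norm (a o\<^sub>L b) \<le> hs_norm a * norm b"
    using assms by (simp add: norm_adj hs_norm_adj mult.commute)
qed

lemma hilbert_schmidt_inner_summable:
  assumes "hilbert_schmidt a" "hilbert_schmidt b"
  shows "(\<lambda>e. a e \<bullet> b e) summable_on some_onb"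
proof -
  have "(\<lambda>e. norm (a e \<bullet> b e)) summable_on some_onb"
  proof (rule summable_on_comparison_test)
    show "(\<lambda>e. a e \<bullet> a e + b e \<bullet> b e) summable_on some_onb"
      using assms by (intro summable_on_add) (auto simp: hilbert_schmidt_iff)
    show "norm (a e \<bullet> b e) \<le> a e \<bullet> a e + b e \<bullet> b e" for e
    proof -
      have "0 \<le> (a e - b e) \<bullet> (a e - b e)" "0 \<le> (a e + b e) \<bullet> (a e + b e)" by auto
      moreover have "0 \<le> a e \<bullet> a e" "0 \<le> b e \<bullet> b e" by auto
      ultimately show ?thesis
        by (simp add: inner_diff_left inner_diff_right inner_add_left inner_add_right inner_commute)
    qed
  qed auto
  then show ?thesis by (rule abs_summable_summable)
qed

lemma hilbert_schmidt_zero: "hilbert_schmidt 0"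
  by (simp add: hilbert_schmidt_iff)

lemma hilbert_schmidt_add:
  assumes "hilbert_schmidt a" "hilbert_schmidt b"
  shows "hilbert_schmidt (a + b)"
proof -
  have "(\<lambda>e. (a e \<bullet> a e + a e \<bullet> b e) + (b e \<bullet> a e + b e \<bullet> b e)) summable_on some_onb"
    by (intro summable_on_add hilbert_schmidt_inner_summable assms)
  then show ?thesis
    by (simp add: hilbert_schmidt_iff blinfun.add_left inner_add_left inner_add_right add_ac)
qed

lemma hilbert_schmidt_scaleR:
  assumes "hilbert_schmidt a" shows "hilbert_schmidt (r *\<^sub>R a)"
proof -
  have "(\<lambda>e. (r * r) * (a e \<bullet> a e)) summable_on some_onb"
    using assms by (intro summable_on_cmult_right) (simp add: hilbert_schmidt_iff)
  then show ?thesis by (simp add: hilbert_schmidt_iff blinfun.scaleR_left mult_ac)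
qed

lemma hilbert_schmidt_minus: "hilbert_schmidt a \<Longrightarrow> hilbert_schmidt (- a)"
  using hilbert_schmidt_scaleR[of a "-1"] by simp

lemma hilbert_schmidt_diff: "hilbert_schmidt a \<Longrightarrow> hilbert_schmidt b \<Longrightarrow> hilbert_schmidt (a - b)"
  using hilbert_schmidt_add[of a "- b"] hilbert_schmidt_minus[of b] by simp

typedef (overloaded) 'a hs = "{a :: 'a::{real_inner, complete_space} bop. hilbert_schmidt a}"
  morphisms of_hs Hs
  using hilbert_schmidt_zero by blast

setup_lifting type_definition_hs

lemma hilbert_schmidt_of_hs [simp]: "hilbert_schmidt (of_hs x)"
  using of_hs by blast

lemma of_hs_Hs: "hilbert_schmidt a \<Longrightarrow> of_hs (Hs a) = a"
  by (simp add: Hs_inverse)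

instantiation hs :: ("{real_inner, complete_space}") real_inner
begin

lift_definition zero_hs :: "'a hs" is 0 by (rule hilbert_schmidt_zero)
lift_definition plus_hs :: "'a hs \<Rightarrow> 'a hs \<Rightarrow> 'a hs" is "(+)" by (rule hilbert_schmidt_add)
lift_definition minus_hs :: "'a hs \<Rightarrow> 'a hs \<Rightarrow> 'a hs" is "(-)" by (rule hilbert_schmidt_diff)
lift_definition uminus_hs :: "'a hs \<Rightarrow> 'a hs" is "uminus" by (rule hilbert_schmidt_minus)
lift_definition scaleR_hs :: "real \<Rightarrow> 'a hs \<Rightarrow> 'a hs" is "scaleR" by (rule hilbert_schmidt_scaleR)
definition inner_hs :: "'a hs \<Rightarrow> 'a hs \<Rightarrow> real"
  where "inner_hs x y = (\<Sum>\<^sub>\<infinity>e\<in>some_onb. of_hs x e \<bullet> of_hs y e)"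
definition norm_hs :: "'a hs \<Rightarrow> real" where "norm_hs x = sqrt (inner x x)"
definition dist_hs :: "'a hs \<Rightarrow> 'a hs \<Rightarrow> real" where "dist_hs x y = norm (x - y)"
definition sgn_hs :: "'a hs \<Rightarrow> 'a hs" where "sgn_hs x = scaleR (inverse (norm x)) x"
definition uniformity_hs :: "('a hs \<times> 'a hs) filter"
  where "uniformity_hs = (INF e\<in>{0 <..}. principal {(x, y). dist x y < e})"
definition open_hs :: "'a hs set \<Rightarrow> bool"
  where "open_hs U = (\<forall>x\<in>U. \<forall>\<^sub>F (x', y) in uniformity. x' = x \<longrightarrow> y \<in> U)"

instance
proof
  fix x y z :: "'a hs" and r s :: real and U :: "'a hs set"
  show "x + y + z = x + (y + z)" "x + y = y + x" "0 + x = x" "- x + x = 0" "x - y = x + - y"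
    "r *\<^sub>R (x + y) = r *\<^sub>R x + r *\<^sub>R y" "(r + s) *\<^sub>R x = r *\<^sub>R x + s *\<^sub>R x" "r *\<^sub>R s *\<^sub>R x = (r * s) *\<^sub>R x"
    "1 *\<^sub>R x = x"
    by (transfer; simp add: algebra_simps)+
  show "dist x y = norm (x - y)" "sgn x = inverse (norm x) *\<^sub>R x"
    "uniformity = (INF e\<in>{0 <..}. principal {(x, y :: 'a hs). dist x y < e})"
    "open U = (\<forall>x\<in>U. \<forall>\<^sub>F (x', y) in uniformity. x' = x \<longrightarrow> y \<in> U)"
    by (simp_all add: dist_hs_def sgn_hs_def uniformity_hs_def open_hs_def)
  show "inner x y = inner y x" by (simp add: inner_hs_def inner_commute)
  show "inner (x + y) z = inner x z + inner y z"
    unfolding inner_hs_def plus_hs.rep_eq blinfun.add_left inner_add_left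
    by (intro infsum_add hilbert_schmidt_inner_summable) auto
  show "inner (r *\<^sub>R x) y = r * inner x y"
    by (simp add: inner_hs_def scaleR_hs.rep_eq blinfun.scaleR_left infsum_cmult_right')
  show "0 \<le> inner x x" by (simp add: inner_hs_def infsum_nonneg)
  show "norm x = sqrt (inner x x)" by (simp add: norm_hs_def)
  show "inner x x = 0 \<longleftrightarrow> x = 0"
  proof
    assume 0: "inner x x = 0"
    have "of_hs x e = 0" if "e \<in> some_onb" for e
    proof -
      have "of_hs x e \<bullet> of_hs x e = 0"
        by (rule nonneg_infsum_le_0D[where A = some_onb and f = "\<lambda>e. of_hs x e \<bullet> of_hs x e"])
           (use 0 that hilbert_schmidt_of_hs[of x] in \<open>auto simp: inner_hs_def hilbert_schmidt_iff\<close>)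
      then show ?thesis by simp
    qed
    moreover have "subspace {v. of_hs x v = 0}"
      by (auto simp: subspace_def blinfun.add_right blinfun.scaleR_right)
    ultimately have "span some_onb \<subseteq> {v. of_hs x v = 0}" by (intro span_minimal) auto
    then have "closure (span some_onb) \<subseteq> {v. of_hs x v = 0}"
      by (rule closure_minimal) (intro closed_Collect_eq continuous_intros)
    then have "of_hs x = 0"
      using orthonormal_basis_some_onb by (intro blinfun_eqI) (auto simp: orthonormal_basis_def)
    then show "x = 0" by (simp flip: of_hs_inject add: zero_hs.rep_eq)
  qed (simp add: inner_hs_def zero_hs.rep_eq)
qed

end

lemma norm_hs_eq: "norm x = hs_norm (of_hs x)"
  by (simp add: norm_hs_def hs_norm_eq inner_hs_def)

lemma hs_norm_eq_norm_Hs: "hilbert_schmidt a \<Longrightarrow> hs_norm a = norm (Hs a)"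
  by (simp add: norm_hs_eq of_hs_Hs)

text \<open>
  The Fourier coefficients of \<open>a\<^sup>* y\<close> are the pairings \<open>y \<bullet> a e\<close>, bounded by \<open>norm y * norm (a e)\<close>; Parseval
  sums their squares.
\<close>

lemma norm_of_hs_le: "norm (of_hs x) \<le> norm x"
proof -
  define a where "a = adj (of_hs x)"
  have a: "hilbert_schmidt a" by (simp add: a_def hilbert_schmidt_adj)
  note B = orthonormal_basis_some_onb
  have "norm (a y) \<le> norm x * norm y" for y
  proof -
    have 1: "((\<lambda>e. (a y \<bullet> e)\<^sup>2) has_sum (norm (a y))\<^sup>2) some_onb" by (rule parseval[OF B])
    have 2: "((\<lambda>e. (norm y)\<^sup>2 * (of_hs x e \<bullet> of_hs x e)) has_sum ((norm y)\<^sup>2 * inner x x)) some_onb"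
      unfolding inner_hs_def
      by (intro has_sum_cmult_right has_sum_infsum) (use hilbert_schmidt_of_hs[of x] in \<open>simp add: hilbert_schmidt_iff\<close>)
    have "(a y \<bullet> e)\<^sup>2 \<le> (norm y)\<^sup>2 * (of_hs x e \<bullet> of_hs x e)" for e
      using Cauchy_Schwarz_ineq[of y "of_hs x e"] by (simp add: a_def adj_inner power2_norm_eq_inner)
    then have "(norm (a y))\<^sup>2 \<le> (norm y)\<^sup>2 * inner x x" using has_sum_mono[OF 1 2] by blast
    also have "\<dots> = (norm x * norm y)\<^sup>2" by (simp add: power2_norm_eq_inner power_mult_distrib)
    finally show ?thesis by (rule power2_le_imp_le) auto
  qed
  then have "norm a \<le> norm x" by (intro norm_blinfun_bound) auto
  then show ?thesis by (simp add: a_def norm_adj)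
qed

lemma bounded_linear_of_hs: "bounded_linear of_hs"
  by (rule bounded_linear_intro[where K = 1])
     (auto simp: plus_hs.rep_eq scaleR_hs.rep_eq norm_of_hs_le)

lemmas of_hs_simps = zero_hs.rep_eq plus_hs.rep_eq minus_hs.rep_eq uminus_hs.rep_eq scaleR_hs.rep_eq

text \<open>
  A Cauchy sequence converges pointwise to a bounded operator, and letting one index tend to infinity
  in the finite partial sums of the Hilbert-Schmidt norm bounds the distance to that limit.
\<close>

instance hs :: ("{real_inner, complete_space}") banach
proof
  fix X :: "nat \<Rightarrow> 'a hs" assume X: "Cauchy X"
  obtain C where C: "\<And>n. norm (X n) \<le> C"
    using Cauchy_Bseq[OF X] by (auto simp: Bseq_def)
  have "convergent (\<lambda>n. of_hs (X n) v)" for v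
  proof (rule Cauchy_convergent)
    have "bounded_linear (\<lambda>x. of_hs x v)"
      by (rule bounded_linear_compose[OF blinfun.bounded_linear_left bounded_linear_of_hs])
    then show "Cauchy (\<lambda>n. of_hs (X n) v)" using X by (rule bounded_linear.Cauchy)
  qed
  then obtain f where f: "\<And>v. (\<lambda>n. of_hs (X n) v) \<longlonglongrightarrow> f v"
    unfolding convergent_def by metis
  have "bounded_linear f"
  proof (rule bounded_linear_intro)
    fix u v :: 'a and r :: real
    have "(\<lambda>n. of_hs (X n) (u + v)) \<longlonglongrightarrow> f u + f v"
      unfolding blinfun.add_right by (intro tendsto_intros f)
    then show "f (u + v) = f u + f v" using f LIMSEQ_unique by blast
    have "(\<lambda>n. of_hs (X n) (r *\<^sub>R v)) \<longlonglongrightarrow> r *\<^sub>R f v"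
      unfolding blinfun.scaleR_right by (intro tendsto_intros f)
    then show "f (r *\<^sub>R v) = r *\<^sub>R f v" using f LIMSEQ_unique by blast
    show "norm (f v) \<le> norm v * C"
    proof (rule LIMSEQ_le_const2[OF tendsto_norm[OF f]])
      have "norm (of_hs (X n) v) \<le> norm v * C" for n
      proof -
        have "norm (of_hs (X n) v) \<le> norm (of_hs (X n)) * norm v" by (rule norm_blinfun)
        also have "\<dots> \<le> C * norm v"
          using norm_of_hs_le[of "X n"] C[of n] by (intro mult_right_mono) auto
        finally show ?thesis by (simp add: mult.commute)
      qed
      then show "\<exists>N. \<forall>n\<ge>N. norm (of_hs (X n) v) \<le> norm v * C" by blast
    qed
  qed
  then obtain a where a: "\<And>v. (\<lambda>n. of_hs (X n) v) \<longlonglongrightarrow> blinfun_apply a v"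
    using f bounded_linear_Blinfun_apply by metis
  have fin: "(\<Sum>e\<in>F. (of_hs (X n) - a) e \<bullet> (of_hs (X n) - a) e) \<le> \<epsilon>\<^sup>2"
    if N: "\<And>m. m \<ge> N \<Longrightarrow> norm (X n - X m) \<le> \<epsilon>" and F: "finite F" "F \<subseteq> some_onb" for N n \<epsilon> F
  proof (rule LIMSEQ_le_const2)
    have "(\<lambda>m. of_hs (X n - X m) e) \<longlonglongrightarrow> (of_hs (X n) - a) e" for e
      unfolding of_hs_simps blinfun.diff_left by (intro tendsto_diff tendsto_const a)
    then show "(\<lambda>m. \<Sum>e\<in>F. of_hs (X n - X m) e \<bullet> of_hs (X n - X m) e)
        \<longlonglongrightarrow> (\<Sum>e\<in>F. (of_hs (X n) - a) e \<bullet> (of_hs (X n) - a) e)"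
      by (intro tendsto_sum tendsto_inner)
    have "(\<Sum>e\<in>F. of_hs (X n - X m) e \<bullet> of_hs (X n - X m) e) \<le> \<epsilon>\<^sup>2" if "m \<ge> N" for m
    proof -
      have "(\<Sum>e\<in>F. of_hs (X n - X m) e \<bullet> of_hs (X n - X m) e) \<le> inner (X n - X m) (X n - X m)"
        unfolding inner_hs_def
        by (rule finite_sum_le_infsum)
           (use F hilbert_schmidt_of_hs[of "X n - X m"] in \<open>auto simp: hilbert_schmidt_iff\<close>)
      also have "\<dots> = (norm (X n - X m))\<^sup>2" by (simp add: power2_norm_eq_inner)
      also have "\<dots> \<le> \<epsilon>\<^sup>2" using N[OF that] by (simp add: power_mono)
      finally show ?thesis .
    qed
    then show "\<exists>N. \<forall>m\<ge>N. (\<Sum>e\<in>F. of_hs (X n - X m) e \<bullet> of_hs (X n - X m) e) \<le> \<epsilon>\<^sup>2" by blast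
  qed
  have hs: "hilbert_schmidt (of_hs (X n) - a) \<and> hs_norm (of_hs (X n) - a) \<le> \<epsilon>"
    if N: "\<And>m. m \<ge> N \<Longrightarrow> norm (X n - X m) \<le> \<epsilon>" and e: "\<epsilon> \<ge> 0" for N n \<epsilon>
  proof -
    have s: "(\<lambda>e. (of_hs (X n) - a) e \<bullet> (of_hs (X n) - a) e) summable_on some_onb"
      by (rule nonneg_bdd_above_summable_on) (auto intro!: bdd_aboveI2 fin N)
    have "(\<Sum>\<^sub>\<infinity>e\<in>some_onb. (of_hs (X n) - a) e \<bullet> (of_hs (X n) - a) e) \<le> \<epsilon>\<^sup>2"
      by (rule infsum_le_finite_sums[OF s]) (auto intro!: fin N)
    then show ?thesis
      using s e real_sqrt_le_mono by (fastforce simp: hilbert_schmidt_iff hs_norm_eq)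
  qed
  have CN: "\<exists>N. \<forall>n\<ge>N. \<forall>m\<ge>N. norm (X n - X m) < \<epsilon>" if "\<epsilon> > 0" for \<epsilon>
    using X that by (metis Cauchy_iff)
  have ha: "hilbert_schmidt a"
  proof -
    obtain N where N: "\<forall>n\<ge>N. \<forall>m\<ge>N. norm (X n - X m) < 1" using CN[of 1] by auto
    then have "hilbert_schmidt (of_hs (X N) - a)" using hs[of N N 1] by (auto intro: less_imp_le)
    then have "hilbert_schmidt (of_hs (X N) - (of_hs (X N) - a))"
      by (rule hilbert_schmidt_diff[OF hilbert_schmidt_of_hs])
    then show ?thesis by simp
  qed
  have "X \<longlonglongrightarrow> Hs a"
  proof (rule LIMSEQ_I)
    fix r :: real assume r: "r > 0"
    obtain N where N: "\<forall>n\<ge>N. \<forall>m\<ge>N. norm (X n - X m) < r/2" using CN[of "r/2"] r by auto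
    have "norm (X n - Hs a) < r" if "n \<ge> N" for n
    proof -
      have "norm (X n - Hs a) = hs_norm (of_hs (X n) - a)"
        by (simp add: norm_hs_eq of_hs_simps of_hs_Hs ha)
      also have "\<dots> \<le> r/2" using hs[of N n "r/2"] N that r by (auto intro: less_imp_le)
      finally show ?thesis using r by simp
    qed
    then show "\<exists>no. \<forall>n\<ge>no. norm (X n - Hs a) < r" by blast
  qed
  then show "convergent X" by (auto simp: convergent_def)
qed

lift_definition hs_left :: "'a::{real_inner, complete_space} bop \<Rightarrow> 'a hs \<Rightarrow> 'a hs" is "\<lambda>b a. b o\<^sub>L a"
  by (rule hilbert_schmidt_compose_left)
lift_definition hs_right :: "'a::{real_inner, complete_space} hs \<Rightarrow> 'a bop \<Rightarrow> 'a hs" is "\<lambda>a b. a o\<^sub>L b"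
  by (rule hilbert_schmidt_compose_right)
lift_definition hs_adj :: "'a::{real_inner, complete_space} hs \<Rightarrow> 'a hs" is adj
  by (rule hilbert_schmidt_adj)

lemma of_hs_eqI: "of_hs x = of_hs y \<Longrightarrow> x = y"
  by (simp add: of_hs_inject)

lemma norm_hs_left_le: "norm (hs_left b x) \<le> norm b * norm x"
  by (simp add: norm_hs_eq hs_left.rep_eq hilbert_schmidt_compose_left)

lemma norm_hs_right_le: "norm (hs_right x b) \<le> norm x * norm b"
  by (simp add: norm_hs_eq hs_right.rep_eq hilbert_schmidt_compose_right)

lemmas blinfun_compose_bilinear =
  bounded_bilinear.add_left[OF bounded_bilinear_blinfun_compose]
  bounded_bilinear.add_right[OF bounded_bilinear_blinfun_compose]
  bounded_bilinear.diff_left[OF bounded_bilinear_blinfun_compose]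
  bounded_bilinear.diff_right[OF bounded_bilinear_blinfun_compose]
  bounded_bilinear.minus_left[OF bounded_bilinear_blinfun_compose]
  bounded_bilinear.minus_right[OF bounded_bilinear_blinfun_compose]
  bounded_bilinear.scaleR_left[OF bounded_bilinear_blinfun_compose]
  bounded_bilinear.scaleR_right[OF bounded_bilinear_blinfun_compose]

lemma bounded_bilinear_hs_left: "bounded_bilinear hs_left"
proof
  show "\<exists>K. \<forall>b x :: 'a hs. norm (hs_left b x) \<le> norm b * norm x * K"
    by (rule exI[of _ 1]) (simp add: norm_hs_left_le)
qed (rule of_hs_eqI; simp add: hs_left.rep_eq of_hs_simps blinfun_compose_bilinear)+

lemma bounded_bilinear_hs_right: "bounded_bilinear hs_right"
proof
  show "\<exists>K. \<forall>(x :: 'a hs) b. norm (hs_right x b) \<le> norm x * norm b * K"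
    by (rule exI[of _ 1]) (simp add: norm_hs_right_le)
qed (rule of_hs_eqI; simp add: hs_right.rep_eq of_hs_simps blinfun_compose_bilinear)+

lemma norm_hs_adj: "norm (hs_adj x) = norm x"
  by (simp add: norm_hs_eq hs_adj.rep_eq hs_norm_adj)

lemma bounded_linear_hs_adj: "bounded_linear hs_adj"
  by (rule bounded_linear_intro[where K = 1])
     (auto intro!: of_hs_eqI simp: hs_adj.rep_eq of_hs_simps adj_add adj_scaleR norm_hs_adj)

lemma bounded_linear_adj: "bounded_linear adj"
  by (rule bounded_linear_intro[where K = 1]) (auto simp: adj_add adj_scaleR norm_adj)

section \<open>Smooth curves in normed spaces\<close>

text \<open>
  One-sided derivatives within \<open>S\<close> are used throughout. Finite differentiability classes are
  defined by recursion so that closure properties follow by induction on the order.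
\<close>

fun Ck :: "nat \<Rightarrow> real set \<Rightarrow> (real \<Rightarrow> 'b::real_normed_vector) \<Rightarrow> bool" where
  "Ck 0 S f \<longleftrightarrow> continuous_on S f"
| "Ck (Suc n) S f \<longleftrightarrow> (\<exists>f'. (\<forall>t\<in>S. (f has_vector_derivative f' t) (at t within S)) \<and> Ck n S f')"

definition csmooth :: "real set \<Rightarrow> (real \<Rightarrow> 'b::real_normed_vector) \<Rightarrow> bool" where
  "csmooth S f \<longleftrightarrow> (\<forall>n. Ck n S f)"

text \<open>The condition under which derivatives within \<open>S\<close> are unique.\<close>

definition no_isolated_point :: "real set \<Rightarrow> bool" where
  "no_isolated_point S \<longleftrightarrow> (\<forall>t\<in>S. at t within S \<noteq> bot)"

lemma has_vector_derivative_iff_difference_quotient: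
  "(f has_vector_derivative v) (at t within S) \<longleftrightarrow>
    ((\<lambda>s. norm ((f s - f t) /\<^sub>R (s - t) - v)) \<longlongrightarrow> 0) (at t within S)"
proof -
  have "norm (f s - f t - (s - t) *\<^sub>R v) / norm (s - t) = norm ((f s - f t) /\<^sub>R (s - t) - v)"
    if "s \<noteq> t" for s
  proof -
    have "(f s - f t) /\<^sub>R (s - t) - v = (f s - f t - (s - t) *\<^sub>R v) /\<^sub>R (s - t)"
      using that by (simp add: scaleR_diff_right)
    then show ?thesis by (simp add: divide_inverse mult.commute)
  qed
  then have "((\<lambda>s. norm (f s - f t - (s - t) *\<^sub>R v) / norm (s - t)) \<longlongrightarrow> 0) (at t within S)
    \<longleftrightarrow> ((\<lambda>s. norm ((f s - f t) /\<^sub>R (s - t) - v)) \<longlongrightarrow> 0) (at t within S)"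
    by (intro filterlim_cong refl) (auto simp: eventually_at_filter)
  then show ?thesis
    by (simp add: has_vector_derivative_def has_derivative_iff_norm bounded_linear_scaleR_left)
qed

lemma has_vector_derivative_iff_tendsto:
  "(f has_vector_derivative v) (at t within S) \<longleftrightarrow>
    ((\<lambda>s. (f s - f t) /\<^sub>R (s - t)) \<longlongrightarrow> v) (at t within S)"
  unfolding has_vector_derivative_iff_difference_quotient
  by (simp add: tendsto_norm_zero_iff LIM_zero_iff)

lemma Ck_SucI:
  "(\<And>t. t \<in> S \<Longrightarrow> (f has_vector_derivative f' t) (at t within S)) \<Longrightarrow> Ck n S f' \<Longrightarrow> Ck (Suc n) S f"
  by auto

lemma Ck_continuous: "Ck n S f \<Longrightarrow> continuous_on S f"
  by (cases n) (auto simp: continuous_on_eq_continuous_within intro: has_vector_derivative_continuous)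

lemma Ck_Suc: "Ck (Suc n) S f \<Longrightarrow> Ck n S f"
proof (induction n arbitrary: f)
  case 0 then show ?case using Ck_continuous[of "Suc 0" S f] by simp
next
  case (Suc n)
  then obtain f' where "\<forall>t\<in>S. (f has_vector_derivative f' t) (at t within S)" "Ck (Suc n) S f'"
    by auto
  then show ?case using Suc.IH[of f'] by auto
qed

lemma Ck_cong:
  assumes "\<And>t. t \<in> S \<Longrightarrow> f t = g t" "Ck n S g"
  shows "Ck n S f"
proof (cases n)
  case 0 then show ?thesis using assms by (simp cong: continuous_on_cong)
next
  case (Suc m)
  then obtain f' where "\<forall>t\<in>S. (g has_vector_derivative f' t) (at t within S)" "Ck m S f'"
    using assms by auto
  then show ?thesis using Suc assms(1) by (auto intro: has_vector_derivative_transform)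
qed

lemma Ck_subset: "Ck n S f \<Longrightarrow> T \<subseteq> S \<Longrightarrow> Ck n T f"
proof (induction n arbitrary: f)
  case 0 then show ?case by (auto intro: continuous_on_subset)
next
  case (Suc n)
  then obtain f' where "\<forall>t\<in>S. (f has_vector_derivative f' t) (at t within S)" "Ck n S f'" by auto
  then show ?case using Suc.IH[of f'] Suc.prems(2) has_vector_derivative_within_subset
    by (metis Ck.simps(2) subset_iff)
qed

lemma Ck_const: "Ck n S (\<lambda>t. c)"
proof (induction n arbitrary: c)
  case (Suc n)
  show ?case by (rule Ck_SucI[where f' = "\<lambda>t. 0"]) (auto intro: Suc)
qed simp

lemma Ck_ident: "Ck n S (\<lambda>t. t)"
proof (cases n)
  case (Suc m)
  show ?thesis unfolding Suc by (rule Ck_SucI[where f' = "\<lambda>t. 1"]) (auto intro: Ck_const)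
qed simp

lemma Ck_add: "Ck n S f \<Longrightarrow> Ck n S g \<Longrightarrow> Ck n S (\<lambda>t. f t + g t)"
proof (induction n arbitrary: f g)
  case 0 then show ?case by (auto intro: continuous_intros)
next
  case (Suc n)
  then obtain f' g' where "\<forall>t\<in>S. (f has_vector_derivative f' t) (at t within S)" "Ck n S f'"
    "\<forall>t\<in>S. (g has_vector_derivative g' t) (at t within S)" "Ck n S g'" by auto
  then show ?case
    by (intro Ck_SucI[where f' = "\<lambda>t. f' t + g' t"] has_vector_derivative_add Suc.IH) auto
qed

lemma Ck_linear:
  assumes "bounded_linear h"
  shows "Ck n S f \<Longrightarrow> Ck n S (\<lambda>t. h (f t))"
proof (induction n arbitrary: f)
  case 0 then show ?case using bounded_linear.continuous_on[OF assms] by simp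
next
  case (Suc n)
  then obtain f' where "\<forall>t\<in>S. (f has_vector_derivative f' t) (at t within S)" "Ck n S f'" by auto
  then show ?case
    by (intro Ck_SucI[where f' = "\<lambda>t. h (f' t)"] bounded_linear.has_vector_derivative[OF assms] Suc.IH) auto
qed

lemma Ck_bilinear:
  assumes "bounded_bilinear h"
  shows "Ck n S f \<Longrightarrow> Ck n S g \<Longrightarrow> Ck n S (\<lambda>t. h (f t) (g t))"
proof (induction n arbitrary: f g)
  case 0 then show ?case using bounded_bilinear.continuous_on[OF assms] by simp
next
  case (Suc n)
  then obtain f' g' where *: "\<forall>t\<in>S. (f has_vector_derivative f' t) (at t within S)" "Ck n S f'"
    "\<forall>t\<in>S. (g has_vector_derivative g' t) (at t within S)" "Ck n S g'" by auto
  have "Ck n S (\<lambda>t. h (f t) (g' t) + h (f' t) (g t))"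
    using * Suc.prems[THEN Ck_Suc] by (intro Ck_add Suc.IH)
  then show ?case using * bounded_bilinear.has_vector_derivative[OF assms]
    by (intro Ck_SucI[where f' = "\<lambda>t. h (f t) (g' t) + h (f' t) (g t)"]) auto
qed

lemma Ck_compose:
  fixes s :: "real \<Rightarrow> real"
  assumes s: "s ` T \<subseteq> S"
  shows "Ck n S f \<Longrightarrow> Ck n T s \<Longrightarrow> Ck n T (\<lambda>t. f (s t))"
proof (induction n arbitrary: f)
  case 0 then show ?case using s by (auto intro: continuous_on_compose2)
next
  case (Suc n)
  then obtain f' s' where *: "\<forall>t\<in>S. (f has_vector_derivative f' t) (at t within S)" "Ck n S f'"
    "\<forall>t\<in>T. (s has_vector_derivative s' t) (at t within T)" "Ck n T s'" by auto
  have "Ck n T (\<lambda>t. s' t *\<^sub>R f' (s t))"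
    using * Suc.prems(2)[THEN Ck_Suc] by (intro Ck_bilinear[OF bounded_bilinear_scaleR] Suc.IH)
  moreover have "((\<lambda>t. f (s t)) has_vector_derivative s' t *\<^sub>R f' (s t)) (at t within T)" if "t \<in> T" for t
  proof -
    have "(f has_vector_derivative f' (s t)) (at (s t) within s ` T)"
      by (rule has_vector_derivative_within_subset[OF _ s]) (use * s that in auto)
    then show ?thesis using vector_diff_chain_within[of s "s' t" t T f] * that by (simp add: o_def)
  qed
  ultimately show ?case by (intro Ck_SucI)
qed

text \<open>
  The derivatives within \<open>S\<close> do not depend on the neighbourhood, so the local derivatives fit
  together to a function on \<open>S\<close>, to which the induction hypothesis applies.
\<close>

lemma Ck_local:
  assumes S: "no_isolated_point S"
  shows "(\<And>t. t \<in> S \<Longrightarrow> \<exists>U. open U \<and> t \<in> U \<and> Ck n (S \<inter> U) f) \<Longrightarrow> Ck n S f"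
proof (induction n arbitrary: f)
  case 0
  show ?case unfolding Ck.simps continuous_on_eq_continuous_within
  proof
    fix t assume "t \<in> S"
    then obtain U where U: "open U" "t \<in> U" "continuous_on (S \<inter> U) f" using 0 by auto
    have "at t within S = at t within (S \<inter> U)" by (rule at_within_nhd[of _ U]) (use U in auto)
    then show "continuous (at t within S) f"
      using U \<open>t \<in> S\<close> by (simp add: continuous_on_eq_continuous_within)
  qed
next
  case (Suc n)
  define f' where "f' t = vector_derivative f (at t within S)" for t
  have loc: "\<exists>U. open U \<and> t \<in> U \<and> (\<forall>s\<in>S \<inter> U. (f has_vector_derivative f' s) (at s within S)) \<and> Ck n (S \<inter> U) f'"
    if t: "t \<in> S" for t
  proof -
    obtain U where U: "open U" "t \<in> U" and "Ck (Suc n) (S \<inter> U) f"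
      using Suc.prems[OF t] by (elim exE conjE)
    then obtain g where g: "Ck n (S \<inter> U) g"
      "\<forall>s\<in>S \<inter> U. (f has_vector_derivative g s) (at s within (S \<inter> U))"
      unfolding Ck.simps by (elim exE conjE)
    have fg: "(f has_vector_derivative g s) (at s within S)" if "s \<in> S \<inter> U" for s
    proof -
      have "at s within S = at s within (S \<inter> U)" by (rule at_within_nhd[of _ U]) (use U that in auto)
      then show ?thesis using g that by simp
    qed
    then have eq: "f' s = g s" if "s \<in> S \<inter> U" for s
      using S that vector_derivative_within unfolding f'_def no_isolated_point_def by blast
    then have "Ck n (S \<inter> U) f'" using g(1) by (rule Ck_cong)
    moreover have "\<forall>s\<in>S \<inter> U. (f has_vector_derivative f' s) (at s within S)" using fg eq by simp
    ultimately show ?thesis using U by blast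
  qed
  then have "Ck n S f'" using Suc.IH by metis
  moreover have "\<forall>t\<in>S. (f has_vector_derivative f' t) (at t within S)" using loc by blast
  ultimately show ?case by auto
qed

text \<open>
  The inverse of a curve of invertible operators is continuous because its norm is locally
  bounded; its derivative \<open>- k G' k\<close> then inherits the differentiability of \<open>k\<close> and \<open>G\<close>.
\<close>

lemma continuous_on_operator_inverse:
  fixes G k :: "real \<Rightarrow> 'b::real_normed_vector \<Rightarrow>\<^sub>L 'b"
  assumes G: "continuous_on S G"
    and inv: "\<And>t. t \<in> S \<Longrightarrow> k t o\<^sub>L G t = id_blinfun" "\<And>t. t \<in> S \<Longrightarrow> G t o\<^sub>L k t = id_blinfun"
  shows "continuous_on S k"
proof -
  have "(k \<longlongrightarrow> k t) (at t within S)" if t: "t \<in> S" for t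
  proof -
    have diff: "k s - k t = k s o\<^sub>L (G t - G s) o\<^sub>L k t" if "s \<in> S" for s
    proof (rule blinfun_eqI)
      fix x
      have "k s (G s (k t x)) = k t x" "G t (k t x) = x"
        using inv t that by (metis blinfun_apply_blinfun_compose blinfun_apply_id_blinfun)+
      then show "(k s - k t) x = (k s o\<^sub>L (G t - G s) o\<^sub>L k t) x" by (simp add: blinfun.bilinear_simps)
    qed
    define d where "d s = norm (G t - G s)" for s
    define M where "M = norm (k t)"
    have "((\<lambda>s. norm (G t - G s)) \<longlongrightarrow> norm (G t - G t)) (at t within S)"
      using G t by (intro tendsto_intros) (auto simp: continuous_on)
    then have d0: "(d \<longlongrightarrow> 0) (at t within S)" by (simp add: d_def[abs_def])
    then have "((\<lambda>s. d s * M) \<longlongrightarrow> 0 * M) (at t within S)" by (intro tendsto_intros)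
    then have "\<forall>\<^sub>F s in at t within S. d s * M < 1/2" by (rule order_tendstoD) simp
    moreover have "\<forall>\<^sub>F s in at t within S. s \<in> S" by (simp add: eventually_at_filter)
    ultimately have "\<forall>\<^sub>F s in at t within S. norm (k s - k t) \<le> 2 * M * M * d s"
    proof eventually_elim
      case (elim s)
      have 1: "norm (k s - k t) \<le> norm (k s) * d s * M"
        unfolding diff[OF elim(2)] d_def M_def
        by (meson mult_right_mono norm_blinfun_compose norm_ge_zero order_trans)
      have "norm (k s) \<le> norm (k t) + norm (k s - k t)" by (metis add.commute diff_add_cancel norm_triangle_ineq)
      also have "\<dots> \<le> M + norm (k s) * (d s * M)" using 1 by (simp add: M_def mult.assoc)
      also have "\<dots> \<le> M + norm (k s) * (1/2)" using elim(1) by (intro add_left_mono mult_left_mono) auto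
      finally have "norm (k s) \<le> 2 * M" by simp
      then have "norm (k s) * d s * M \<le> 2 * M * d s * M"
        by (intro mult_right_mono) (auto simp: d_def M_def)
      then show ?case using 1 by (simp add: mult_ac)
    qed
    moreover have "((\<lambda>s. 2 * M * M * d s) \<longlongrightarrow> 0) (at t within S)" using tendsto_mult_right_zero[OF d0] by blast
    ultimately have "((\<lambda>s. k s - k t) \<longlongrightarrow> 0) (at t within S)" by (rule Lim_null_comparison)
    then show ?thesis by (simp add: LIM_zero_iff)
  qed
  then show ?thesis by (simp add: continuous_on)
qed

lemma Ck_operator_inverse:
  fixes G k :: "real \<Rightarrow> 'b::real_normed_vector \<Rightarrow>\<^sub>L 'b"
  assumes inv: "\<And>t. t \<in> S \<Longrightarrow> k t o\<^sub>L G t = id_blinfun" "\<And>t. t \<in> S \<Longrightarrow> G t o\<^sub>L k t = id_blinfun"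
  shows "Ck n S G \<Longrightarrow> Ck n S k"
proof (induction n)
  case 0 then show ?case using continuous_on_operator_inverse[OF _ inv] by simp
next
  case (Suc n)
  then obtain G' where G': "\<forall>t\<in>S. (G has_vector_derivative G' t) (at t within S)" "Ck n S G'" by auto
  have k: "Ck n S k" using Suc Ck_Suc by blast
  have "Ck n S (\<lambda>t. - (k t o\<^sub>L G' t o\<^sub>L k t))"
    by (intro Ck_linear[OF bounded_linear_minus[OF bounded_linear_ident]]
        Ck_bilinear[OF bounded_bilinear_blinfun_compose] k G')
  moreover have "(k has_vector_derivative - (k t o\<^sub>L G' t o\<^sub>L k t)) (at t within S)" if t: "t \<in> S" for t
  proof -
    have "((\<lambda>s. - (k s o\<^sub>L ((G s - G t) /\<^sub>R (s - t)) o\<^sub>L k t)) \<longlongrightarrow> - (k t o\<^sub>L G' t o\<^sub>L k t)) (at t within S)"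
      using Ck_continuous[OF k] G'(1) t
      by (intro tendsto_minus bounded_bilinear.tendsto[OF bounded_bilinear_blinfun_compose] tendsto_const)
         (auto simp: continuous_on has_vector_derivative_iff_tendsto)
    moreover have "- (k s o\<^sub>L ((G s - G t) /\<^sub>R (s - t)) o\<^sub>L k t) = (k s - k t) /\<^sub>R (s - t)" if "s \<in> S" for s
    proof (rule blinfun_eqI)
      fix x
      have "k s (G s (k t x)) = k t x" "G t (k t x) = x"
        using inv t that by (metis blinfun_apply_blinfun_compose blinfun_apply_id_blinfun)+
      then show "(- (k s o\<^sub>L ((G s - G t) /\<^sub>R (s - t)) o\<^sub>L k t)) x = ((k s - k t) /\<^sub>R (s - t)) x"
        by (simp add: blinfun.bilinear_simps algebra_simps)
    qed
    then have "\<forall>\<^sub>F s in at t within S. - (k s o\<^sub>L ((G s - G t) /\<^sub>R (s - t)) o\<^sub>L k t) = (k s - k t) /\<^sub>R (s - t)"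
      by (simp add: eventually_at_filter)
    ultimately have "((\<lambda>s. (k s - k t) /\<^sub>R (s - t)) \<longlongrightarrow> - (k t o\<^sub>L G' t o\<^sub>L k t)) (at t within S)"
      by (rule Lim_transform_eventually)
    then show ?thesis by (simp add: has_vector_derivative_iff_tendsto)
  qed
  ultimately show ?case by (intro Ck_SucI)
qed

lemma csmooth_continuous: "csmooth S f \<Longrightarrow> continuous_on S f"
  unfolding csmooth_def using Ck_continuous by blast

lemma csmooth_cong: "(\<And>t. t \<in> S \<Longrightarrow> f t = g t) \<Longrightarrow> csmooth S g \<Longrightarrow> csmooth S f"
  unfolding csmooth_def using Ck_cong by blast

lemma csmooth_subset: "csmooth S f \<Longrightarrow> T \<subseteq> S \<Longrightarrow> csmooth T f"
  unfolding csmooth_def using Ck_subset by blast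

lemma csmooth_const: "csmooth S (\<lambda>t. c)"
  by (simp add: csmooth_def Ck_const)

lemma csmooth_ident: "csmooth S (\<lambda>t. t)"
  by (simp add: csmooth_def Ck_ident)

lemma csmooth_add: "csmooth S f \<Longrightarrow> csmooth S g \<Longrightarrow> csmooth S (\<lambda>t. f t + g t)"
  by (simp add: csmooth_def Ck_add)

lemma csmooth_linear: "bounded_linear h \<Longrightarrow> csmooth S f \<Longrightarrow> csmooth S (\<lambda>t. h (f t))"
  by (simp add: csmooth_def Ck_linear)

lemma csmooth_diff: "csmooth S f \<Longrightarrow> csmooth S g \<Longrightarrow> csmooth S (\<lambda>t. f t - g t)"
  using csmooth_add[of S f "\<lambda>t. - g t"] csmooth_linear[OF bounded_linear_minus[OF bounded_linear_ident], of S g]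
  by simp

lemma csmooth_bilinear:
  "bounded_bilinear h \<Longrightarrow> csmooth S f \<Longrightarrow> csmooth S g \<Longrightarrow> csmooth S (\<lambda>t. h (f t) (g t))"
  by (simp add: csmooth_def Ck_bilinear)

lemmas csmooth_scaleR = csmooth_bilinear[OF bounded_bilinear_scaleR]

lemma csmooth_reparametrize:
  "csmooth S f \<Longrightarrow> csmooth T s \<Longrightarrow> s ` T \<subseteq> S \<Longrightarrow> csmooth T (\<lambda>t. f (s t))"
  by (simp add: csmooth_def Ck_compose)

lemma csmooth_local:
  assumes "no_isolated_point S" "\<And>t. t \<in> S \<Longrightarrow> \<exists>U. open U \<and> t \<in> U \<and> csmooth (S \<inter> U) f"
  shows "csmooth S f"
  unfolding csmooth_def
proof
  fix n show "Ck n S f"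
  proof (rule Ck_local[OF assms(1)])
    fix t assume "t \<in> S"
    from assms(2)[OF this] show "\<exists>U. open U \<and> t \<in> U \<and> Ck n (S \<inter> U) f" unfolding csmooth_def by blast
  qed
qed

lemma csmooth_operator_inverse:
  fixes G k :: "real \<Rightarrow> 'b::real_normed_vector \<Rightarrow>\<^sub>L 'b"
  assumes "csmooth S G"
    and "\<And>t. t \<in> S \<Longrightarrow> k t o\<^sub>L G t = id_blinfun" "\<And>t. t \<in> S \<Longrightarrow> G t o\<^sub>L k t = id_blinfun"
  shows "csmooth S k"
  using Ck_operator_inverse[OF assms(2,3)] assms(1) by (simp add: csmooth_def)

lemma csmooth_derivative:
  assumes S: "no_isolated_point S" and f: "csmooth S f"
  defines "f' \<equiv> \<lambda>t. vector_derivative f (at t within S)"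
  shows "\<And>t. t \<in> S \<Longrightarrow> (f has_vector_derivative f' t) (at t within S)" "csmooth S f'"
proof -
  have *: "(\<forall>t\<in>S. (f has_vector_derivative f' t) (at t within S)) \<and> Ck n S f'" for n
  proof -
    obtain g where g: "\<forall>t\<in>S. (f has_vector_derivative g t) (at t within S)" "Ck n S g"
      using f unfolding csmooth_def by (metis Ck.simps(2))
    then have "f' t = g t" if "t \<in> S" for t
      using S that vector_derivative_within unfolding f'_def no_isolated_point_def by blast
    then show ?thesis using g Ck_cong by metis
  qed
  then show "\<And>t. t \<in> S \<Longrightarrow> (f has_vector_derivative f' t) (at t within S)" "csmooth S f'"
    by (auto simp: csmooth_def)
qed

lemma csmooth_if_derivative_sequence:
  assumes "\<And>n t. t \<in> S \<Longrightarrow> (F n has_vector_derivative F (Suc n) t) (at t within S)"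
  shows "csmooth S (F m)"
proof -
  have "Ck n S (F m)" for n
  proof (induction n arbitrary: m)
    case 0 then show ?case using assms
      by (auto simp: continuous_on_eq_continuous_within intro: has_vector_derivative_continuous)
  qed (use assms in auto)
  then show ?thesis by (simp add: csmooth_def)
qed

text \<open>
  Each order of differentiability has its own witnesses; uniqueness of derivatives merges them into
  one sequence.
\<close>

lemma csmooth_iff_derivative_sequence:
  assumes S: "no_isolated_point S"
  shows "csmooth S f \<longleftrightarrow>
    (\<exists>F. F 0 = f \<and> (\<forall>n. \<forall>t\<in>S. (F n has_vector_derivative F (Suc n) t) (at t within S)))"
proof
  assume f: "csmooth S f"
  define D where "D g = (\<lambda>t. vector_derivative g (at t within S))" for g :: "real \<Rightarrow> 'a"
  have "csmooth S ((D ^^ n) f)" for n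
    by (induction n) (use f csmooth_derivative[OF S] in \<open>auto simp: D_def\<close>)
  then have "((D ^^ n) f has_vector_derivative (D ^^ Suc n) f t) (at t within S)" if "t \<in> S" for n t
    using csmooth_derivative(1)[OF S, of "(D ^^ n) f"] that by (simp add: D_def)
  then show "\<exists>F. F 0 = f \<and> (\<forall>n. \<forall>t\<in>S. (F n has_vector_derivative F (Suc n) t) (at t within S))"
    by (intro exI[of _ "\<lambda>n. (D ^^ n) f"]) auto
qed (use csmooth_if_derivative_sequence in blast)

lemma no_isolated_point_Icc: "no_isolated_point {0..1}"
  unfolding no_isolated_point_def by (auto simp: trivial_limit_within islimpt_Icc)

lemma no_isolated_point_openin:
  assumes "openin (top_of_set {0..1}) S"
  shows "no_isolated_point S"
  unfolding no_isolated_point_def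
proof
  fix t assume t: "t \<in> S"
  obtain U where U: "open U" "S = {0..1} \<inter> U" using assms by (auto simp: openin_open)
  have "at t within S = at t within {0..1}" by (rule at_within_nhd[of _ U]) (use U t in auto)
  then show "at t within S \<noteq> bot" using no_isolated_point_Icc t U by (auto simp: no_isolated_point_def)
qed

section \<open>Reparametrization and concatenation of smooth curves\<close>

text \<open>The functions \<open>exp (- 1 / x) / x ^ n\<close>, extended by \<open>0\<close>; derivatives stay in their span.\<close>

definition flat :: "nat \<Rightarrow> real \<Rightarrow> real" where
  "flat n x = (if x > 0 then inverse x ^ n / exp (inverse x) else 0)"

lemma flat_tendsto_0: "(flat n \<longlongrightarrow> 0) (at 0)"
proof (rule filterlim_split_at)
  have "\<forall>\<^sub>F x in at_left 0. flat n x = 0" by (auto simp: eventually_at_filter flat_def)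
  then show "(flat n \<longlongrightarrow> 0) (at_left 0)" using tendsto_cong[of "flat n" "\<lambda>x. 0"] by auto
  have "\<forall>\<^sub>F x in at_top. flat n (inverse x) = x ^ n / exp x"
    using eventually_gt_at_top[of 0] by eventually_elim (auto simp: flat_def)
  then have "((\<lambda>x. flat n (inverse x)) \<longlongrightarrow> 0) at_top"
    using tendsto_power_div_exp_0[of n] by (subst tendsto_cong) auto
  then show "(flat n \<longlongrightarrow> 0) (at_right 0)" by (simp add: filterlim_at_right_to_top)
qed

lemma flat_derivative:
  "(flat n has_real_derivative (flat (n + 2) x - real n * flat (Suc n) x)) (at x)"
proof (cases rule: linorder_cases[of x 0])
  case less
  have "((\<lambda>x. 0) has_real_derivative 0) (at x)" by simp
  then have "(flat n has_real_derivative 0) (at x)"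
    by (rule has_field_derivative_transform_within_open[of _ _ _ "{..<0}"]) (use less in \<open>auto simp: flat_def\<close>)
  then show ?thesis using less by (simp add: flat_def)
next
  case equal
  have "((\<lambda>y. (flat n y - flat n 0) / (y - 0)) \<longlongrightarrow> 0) (at 0)"
  proof -
    have "(flat n y - flat n 0) / (y - 0) = flat (Suc n) y" for y
      by (simp add: flat_def divide_inverse)
    then show ?thesis using flat_tendsto_0[of "Suc n"] by simp
  qed
  then show ?thesis using equal by (simp add: has_field_derivative_iff flat_def)
next
  case greater
  have "((\<lambda>x. inverse x ^ n / exp (inverse x)) has_real_derivative
      (inverse x ^ (n + 2) / exp (inverse x) - real n * (inverse x ^ Suc n / exp (inverse x)))) (at x)"
    using greater
    by (auto intro!: derivative_eq_intros)
       (cases n; simp add: field_simps power2_eq_square)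
  then have "(flat n has_real_derivative
      (inverse x ^ (n + 2) / exp (inverse x) - real n * (inverse x ^ Suc n / exp (inverse x)))) (at x)"
    by (rule has_field_derivative_transform_within_open[of _ _ _ "{0<..}"]) (use greater in \<open>auto simp: flat_def\<close>)
  then show ?thesis using greater by (simp add: flat_def)
qed

lemma csmooth_flat: "csmooth S (flat n)"
proof -
  have "Ck k UNIV (flat n)" for k
  proof (induction k arbitrary: n)
    case 0 show ?case
      using flat_derivative DERIV_continuous by (simp add: continuous_on_eq_continuous_within) blast
  next
    case (Suc k)
    have "Ck k UNIV (\<lambda>x. flat (n + 2) x + - real n * flat (Suc n) x)"
      by (intro Ck_add Ck_bilinear[OF bounded_bilinear_mult] Ck_const Suc)
    then show ?case
      by (rule Ck_SucI[rotated]) (use flat_derivative[of n] in \<open>auto simp: has_real_derivative_iff_has_vector_derivative\<close>)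
  qed
  then show ?thesis using csmooth_subset[of UNIV "flat n" S] by (simp add: csmooth_def)
qed

lemma csmooth_real_inverse:
  fixes f :: "real \<Rightarrow> real"
  assumes "csmooth S f" and nz: "\<And>t. t \<in> S \<Longrightarrow> f t \<noteq> 0"
  shows "csmooth S (\<lambda>t. inverse (f t))"
proof -
  have "Ck n S f \<Longrightarrow> Ck n S (\<lambda>t. inverse (f t))" for n
  proof (induction n)
    case 0 then show ?case using nz by (auto intro: continuous_intros)
  next
    case (Suc n)
    then obtain f' where f': "\<forall>t\<in>S. (f has_vector_derivative f' t) (at t within S)" "Ck n S f'" by auto
    have i: "Ck n S (\<lambda>t. inverse (f t))" using Suc Ck_Suc by blast
    show ?case
    proof (rule Ck_SucI)
      show "Ck n S (\<lambda>t. - (inverse (f t) * f' t * inverse (f t)))"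
        by (intro Ck_linear[OF bounded_linear_minus[OF bounded_linear_ident]]
            Ck_bilinear[OF bounded_bilinear_mult] i f')
      show "((\<lambda>t. inverse (f t)) has_vector_derivative - (inverse (f t) * f' t * inverse (f t)))
          (at t within S)" if "t \<in> S" for t
        using f'(1) nz[OF that] that unfolding has_real_derivative_iff_has_vector_derivative[symmetric]
        by (auto intro!: derivative_eq_intros)
    qed
  qed
  then show ?thesis using assms by (simp add: csmooth_def)
qed

text \<open>
  All derivatives of the step vanish at both ends of its transition, so pasting two curves
  reparametrized by it produces no corner.
\<close>

lemma smooth_step_exists:
  obtains s s' :: "real \<Rightarrow> real" where "csmooth UNIV s"
    "\<And>t. (s has_real_derivative s' t) (at t)" "\<And>t. s' t \<ge> 0"
    "\<And>t. t \<le> 0 \<Longrightarrow> s t = 0" "\<And>t. t \<ge> 1 \<Longrightarrow> s t = 1" "\<And>t. s t \<in> {0..1}"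
proof
  let ?D = "\<lambda>t. flat 0 t + flat 0 (1 - t)"
  let ?s = "\<lambda>t. flat 0 t * inverse (?D t)"
  let ?s' = "\<lambda>t. (flat 2 t * flat 0 (1 - t) + flat 0 t * flat 2 (1 - t)) / (?D t)\<^sup>2"
  have nn: "flat n t \<ge> 0" for n t by (simp add: flat_def)
  have D: "?D t > 0" for t using nn[of 0 t] nn[of 0 "1 - t"] by (cases "t > 0") (auto simp: flat_def add_pos_nonneg add_nonneg_pos)
  have r: "csmooth UNIV (\<lambda>t. flat 0 (1 - t))"
    by (rule csmooth_reparametrize[of UNIV "flat 0" UNIV "\<lambda>t. 1 - t"])
       (auto intro: csmooth_flat csmooth_diff csmooth_const csmooth_ident)
  show "csmooth UNIV ?s"
    using D by (intro csmooth_bilinear[OF bounded_bilinear_mult] csmooth_real_inverse csmooth_add csmooth_flat r)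
      (metis less_irrefl)
  show "(?s has_real_derivative ?s' t) (at t)" for t
  proof -
    have 1: "(flat 0 has_real_derivative flat 2 t) (at t)" using flat_derivative[of 0 t] by (simp add: numeral_2_eq_2)
    have "((\<lambda>t. 1 - t) has_real_derivative - 1) (at t)" by (auto intro!: derivative_eq_intros)
    then have 2: "((\<lambda>t. flat 0 (1 - t)) has_real_derivative - flat 2 (1 - t)) (at t)"
      using DERIV_chain'[of "\<lambda>t. 1 - t" "-1" t UNIV "flat 0" "flat 2 (1 - t)"] flat_derivative[of 0 "1 - t"]
      by (simp add: numeral_2_eq_2)
    have "?D t \<noteq> 0" using D[of t] by simp
    then show ?thesis
      by (auto intro!: derivative_eq_intros 1 2 simp: divide_simps) (simp add: algebra_simps power2_eq_square)
  qed
  show "?s' t \<ge> 0" for t using nn by (intro divide_nonneg_nonneg add_nonneg_nonneg mult_nonneg_nonneg) auto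
  show "?s t = 0" if "t \<le> 0" for t using that by (simp add: flat_def)
  show "?s t = 1" if "t \<ge> 1" for t using that D[of t] by (simp add: flat_def)
  show "?s t \<in> {0..1}" for t using nn[of 0 t] nn[of 0 "1 - t"] D[of t] by (simp add: field_simps)
qed

definition curve_length :: "(real \<Rightarrow> 'b::real_normed_vector) \<Rightarrow> real" where
  "curve_length X = integral {0..1} (\<lambda>t. norm (vector_derivative X (at t within {0..1})))"

lemma vector_derivative_Icc:
  assumes "t \<in> {0..1}" "(X has_vector_derivative v) (at t within {0..1})"
  shows "vector_derivative X (at t within {0..1}) = v"
  using vector_derivative_within no_isolated_point_Icc assms unfolding no_isolated_point_def by blast

lemma continuous_on_speed:
  assumes "csmooth {0..1} X"
  shows "continuous_on {0..1} (\<lambda>t. norm (vector_derivative X (at t within {0..1})))"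
  by (intro continuous_on_norm csmooth_continuous csmooth_derivative(2)[OF no_isolated_point_Icc] assms)

lemma curve_length_le:
  fixes X Y :: "real \<Rightarrow> 'b::real_normed_vector"
  assumes X: "csmooth {0..1} X" and g: "(g has_integral I) {0..1}"
    and X': "\<And>t. t \<in> {0..1} \<Longrightarrow> (X has_vector_derivative X' t) (at t within {0..1})"
    and le: "\<And>t. t \<in> {0..1} \<Longrightarrow> norm (X' t) \<le> g t"
  shows "curve_length X \<le> I"
proof -
  have "curve_length X \<le> integral {0..1} g" unfolding curve_length_def
  proof (rule integral_le)
    show "(\<lambda>t. norm (vector_derivative X (at t within {0..1}))) integrable_on {0..1}"
      by (intro integrable_continuous_real continuous_on_speed X)
    show "g integrable_on {0..1}" using g by blast
    show "norm (vector_derivative X (at t within {0..1})) \<le> g t" if "t \<in> {0..1}" for t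
      using le[OF that] vector_derivative_Icc[OF that X'[OF that]] by simp
  qed
  then show ?thesis using g by (simp add: integral_unique)
qed

lemma curve_length_nonneg: "curve_length X \<ge> 0"
  unfolding curve_length_def
  by (cases "(\<lambda>t. norm (vector_derivative X (at t within {0..1}))) integrable_on {0..1}")
     (auto intro: integral_nonneg simp: not_integrable_integral)

lemma chord_le_curve_length:
  fixes X :: "real \<Rightarrow> 'b::banach"
  assumes X: "csmooth {0..1} X"
  shows "norm (X 1 - X 0) \<le> curve_length X"
proof -
  let ?X' = "\<lambda>t. vector_derivative X (at t within {0..1})"
  have "(?X' has_integral (X 1 - X 0)) {0..1}"
    by (rule fundamental_theorem_of_calculus) (auto intro: csmooth_derivative(1)[OF no_isolated_point_Icc X])
  then have "norm (X 1 - X 0) = norm (integral {0..1} ?X')" by (simp add: integral_unique)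
  also have "\<dots> \<le> curve_length X" unfolding curve_length_def
    by (rule integral_norm_bound_integral)
       (intro integrable_continuous_real continuous_on_speed csmooth_continuous
          csmooth_derivative(2)[OF no_isolated_point_Icc] X | simp)+
  finally show ?thesis .
qed

text \<open>
  The speed of the reparametrized curve is the derivative of the arc length of \<open>X\<close> composed with \<open>s\<close>,
  so its integral is a difference of arc lengths. The sign of \<open>s'\<close> is left open in order to cover
  reversal, for which \<open>s' = - 1\<close>.
\<close>

lemma reparametrized_speed:
  fixes X :: "real \<Rightarrow> 'b::real_normed_vector" and s :: "real \<Rightarrow> real"
  assumes X: "csmooth {0..1} X" and s01: "s ` {0..1} \<subseteq> {0..1}"
    and s': "\<And>t. t \<in> {0..1} \<Longrightarrow> (s has_vector_derivative s' t) (at t within {0..1})"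
  defines "V \<equiv> \<lambda>t. vector_derivative X (at t within {0..1})"
  shows "\<And>t. t \<in> {0..1} \<Longrightarrow> ((\<lambda>t. X (s t)) has_vector_derivative s' t *\<^sub>R V (s t)) (at t within {0..1})"
    and "((\<lambda>t. s' t * norm (V (s t))) has_integral
          (integral {0..s 1} (\<lambda>t. norm (V t)) - integral {0..s 0} (\<lambda>t. norm (V t)))) {0..1}"
proof -
  have chain: "((\<lambda>t. f (s t)) has_vector_derivative s' t *\<^sub>R f' (s t)) (at t within {0..1})"
    if "t \<in> {0..1}" and f': "\<And>u. u \<in> {0..1} \<Longrightarrow> (f has_vector_derivative f' u) (at u within {0..1})"
    for t and f f' :: "real \<Rightarrow> 'c::real_normed_vector"
  proof -
    have "(f has_vector_derivative f' (s t)) (at (s t) within s ` {0..1})"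
      by (rule has_vector_derivative_within_subset[OF f' s01]) (use s01 that(1) in blast)
    from vector_diff_chain_within[OF s'[OF that(1)] this] show ?thesis by (simp add: o_def)
  qed
  show "((\<lambda>t. X (s t)) has_vector_derivative s' t *\<^sub>R V (s t)) (at t within {0..1})" if "t \<in> {0..1}" for t
    unfolding V_def by (rule chain[OF that]) (rule csmooth_derivative(1)[OF no_isolated_point_Icc X])
  have "((\<lambda>u. integral {0..u} (\<lambda>t. norm (V t))) has_vector_derivative norm (V u)) (at u within {0..1})"
    if "u \<in> {0..1}" for u
    using that X unfolding V_def by (intro integral_has_vector_derivative continuous_on_speed)
  from chain[OF _ this] have "((\<lambda>t. integral {0..s t} (\<lambda>t. norm (V t))) has_vector_derivative
      s' t *\<^sub>R norm (V (s t))) (at t within {0..1})" if "t \<in> {0..1}" for t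
    using that by blast
  then show "((\<lambda>t. s' t * norm (V (s t))) has_integral
          (integral {0..s 1} (\<lambda>t. norm (V t)) - integral {0..s 0} (\<lambda>t. norm (V t)))) {0..1}"
    using fundamental_theorem_of_calculus[of 0 1 "\<lambda>t. integral {0..s t} (\<lambda>t. norm (V t))"
        "\<lambda>t. s' t *\<^sub>R norm (V (s t))"] by simp
qed

lemma reversed_curve:
  fixes X :: "real \<Rightarrow> 'b::real_normed_vector"
  assumes X: "csmooth {0..1} X"
  shows "csmooth {0..1} (\<lambda>t. X (1 - t))" "curve_length (\<lambda>t. X (1 - t)) \<le> curve_length X"
proof -
  let ?V = "\<lambda>t. vector_derivative X (at t within {0..1})"
  show smooth: "csmooth {0..1} (\<lambda>t. X (1 - t))"
    by (rule csmooth_reparametrize[OF X]) (auto intro: csmooth_diff csmooth_const csmooth_ident)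
  have s01: "(\<lambda>t. 1 - t) ` {0..1::real} \<subseteq> {0..1}" by auto
  have s': "((\<lambda>t. 1 - t) has_vector_derivative -1) (at t within {0..1})" for t :: real
    by (auto intro!: derivative_eq_intros)
  note r = reparametrized_speed[OF X s01 s']
  have "((\<lambda>t. - (-1 * norm (?V (1 - t)))) has_integral
      - (integral {0..1 - 1} (\<lambda>t. norm (?V t)) - integral {0..1 - 0} (\<lambda>t. norm (?V t)))) {0..1}"
    by (intro has_integral_neg r(2))
  then have "((\<lambda>t. norm (?V (1 - t))) has_integral curve_length X) {0..1}" by (simp add: curve_length_def)
  then show "curve_length (\<lambda>t. X (1 - t)) \<le> curve_length X"
    by (rule curve_length_le[OF smooth _ r(1)]) auto
qed

text \<open>
  Running \<open>X\<close> on the first half and \<open>Y\<close> on the second one, both through the flat step, the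
  concatenation equals the sum \<open>X \<circ> a + Y \<circ> b - X 1\<close> everywhere, since at each time one of the two
  summands is at the junction \<open>X 1 = Y 0\<close>. Smoothness at the junction is thus smoothness of a sum.
\<close>

lemma concatenated_curve:
  fixes X Y :: "real \<Rightarrow> 'b::real_normed_vector"
  assumes X: "csmooth {0..1} X" and Y: "csmooth {0..1} Y" and XY: "X 1 = Y 0"
  obtains a b :: "real \<Rightarrow> real" and Z where "csmooth {0..1} Z"
    "curve_length Z \<le> curve_length X + curve_length Y"
    "\<And>t. a t \<in> {0..1}" "\<And>t. b t \<in> {0..1}" "a 0 = 0" "b 1 = 1"
    "\<And>t. Z t = (if t \<le> 1/2 then X (a t) else Y (b t))"
proof -
  obtain s s' :: "real \<Rightarrow> real" where s: "csmooth UNIV s" "\<And>t. (s has_real_derivative s' t) (at t)"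
    "\<And>t. s' t \<ge> 0" "\<And>t. t \<le> 0 \<Longrightarrow> s t = 0" "\<And>t. t \<ge> 1 \<Longrightarrow> s t = 1" "\<And>t. s t \<in> {0..1}"
    using smooth_step_exists by metis
  define a where "a t = s (2 * t)" for t
  define b where "b t = s (2 * t - 1)" for t
  define Z where "Z t = X (a t) + Y (b t) - X 1" for t
  have ab: "a t \<in> {0..1}" "b t \<in> {0..1}" for t using s(6) by (simp_all only: a_def b_def)
  have d: "((\<lambda>t. 2 * t) has_real_derivative 2) (at t)" "((\<lambda>t. 2 * t - 1) has_real_derivative 2) (at t)" for t :: real
    by (auto intro!: derivative_eq_intros)
  have a': "(a has_vector_derivative (2 * s' (2 * t))) (at t within {0..1})" for t
    unfolding a_def has_real_derivative_iff_has_vector_derivative[symmetric]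
    using DERIV_chain'[OF d(1) s(2)] by (simp add: mult.commute has_field_derivative_at_within)
  have b': "(b has_vector_derivative (2 * s' (2 * t - 1))) (at t within {0..1})" for t
    unfolding b_def has_real_derivative_iff_has_vector_derivative[symmetric]
    using DERIV_chain'[OF d(2) s(2)] by (simp add: mult.commute has_field_derivative_at_within)
  have as: "csmooth {0..1} a" "csmooth {0..1} b" unfolding a_def b_def
    by (auto intro!: csmooth_reparametrize[OF s(1)] csmooth_diff csmooth_const csmooth_ident
        csmooth_bilinear[OF bounded_bilinear_mult])
  have sub: "a ` {0..1} \<subseteq> {0..1}" "b ` {0..1} \<subseteq> {0..1}" using ab by blast+
  have Zs: "csmooth {0..1} Z" unfolding Z_def
    by (intro csmooth_diff csmooth_add csmooth_const csmooth_reparametrize[OF X as(1) sub(1)]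
        csmooth_reparametrize[OF Y as(2) sub(2)])
  note rX = reparametrized_speed[OF X sub(1) a'] and rY = reparametrized_speed[OF Y sub(2) b']
  have ends: "a 0 = 0" "a 1 = 1" "b 0 = 0" "b 1 = 1" by (simp_all add: a_def b_def s)
  have "curve_length Z \<le> (curve_length X - 0) + (curve_length Y - 0)"
  proof (rule curve_length_le[OF Zs])
    show "((\<lambda>t. 2 * s' (2 * t) * norm (vector_derivative X (at (a t) within {0..1}))
        + 2 * s' (2 * t - 1) * norm (vector_derivative Y (at (b t) within {0..1})))
        has_integral (curve_length X - 0) + (curve_length Y - 0)) {0..1}"
      using has_integral_add[OF rX(2) rY(2)] by (simp add: ends curve_length_def)
    fix t :: real assume t: "t \<in> {0..1}"
    let ?v = "(2 * s' (2 * t)) *\<^sub>R vector_derivative X (at (a t) within {0..1})"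
    let ?w = "(2 * s' (2 * t - 1)) *\<^sub>R vector_derivative Y (at (b t) within {0..1})"
    show "(Z has_vector_derivative ?v + ?w - 0) (at t within {0..1})"
      unfolding Z_def using rX(1)[OF t] rY(1)[OF t]
      by (intro has_vector_derivative_diff has_vector_derivative_add has_vector_derivative_const)
    show "norm (?v + ?w - 0) \<le> 2 * s' (2 * t) * norm (vector_derivative X (at (a t) within {0..1}))
        + 2 * s' (2 * t - 1) * norm (vector_derivative Y (at (b t) within {0..1}))"
      using norm_triangle_ineq[of ?v ?w] s(3) by simp
  qed
  moreover have "Z t = (if t \<le> 1/2 then X (a t) else Y (b t))" for t
    by (auto simp: Z_def a_def b_def s XY)
  ultimately show ?thesis using that[of Z a b] Zs ab ends by simp
qed

section \<open>Invertibility of symmetric operators\<close>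

text \<open>
  Uniform boundedness: by Baire, for some \<open>n\<close> the closed set of those \<open>y\<close> whose pairings with \<open>B\<close>
  are bounded by \<open>n\<close> contains a ball, and inside this ball one can move in the direction of any
  member of \<open>B\<close>.
\<close>

lemma weakly_bounded_imp_bounded:
  fixes B :: "'a::{real_inner, complete_space} set"
  assumes weak: "\<And>y. \<exists>M. \<forall>x\<in>B. \<bar>x \<bullet> y\<bar> \<le> M"
  shows "\<exists>M. \<forall>x\<in>B. norm x \<le> M"
proof -
  define F where "F n = (\<Inter>x\<in>B. {y. \<bar>x \<bullet> y\<bar> \<le> real n})" for n
  have closed: "closed (F n)" for n
    unfolding F_def by (intro closed_INT ballI closed_Collect_le continuous_intros)
  have "(\<Union>n. F n) = UNIV"
  proof (intro equalityI subsetI UNIV_I)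
    fix y
    obtain M where "\<And>x. x \<in> B \<Longrightarrow> \<bar>x \<bullet> y\<bar> \<le> M" using weak by blast
    moreover obtain n where "M \<le> real n" using real_arch_simple by blast
    ultimately have "y \<in> F n" by (force simp: F_def)
    then show "y \<in> (\<Union>n. F n)" by blast
  qed
  then have "interior (\<Union>(range F)) \<noteq> {}" by simp
  moreover have "interior (\<Union>(range F)) = {}" if "\<And>n. interior (F n) = {}"
    using Baire_category_alt[OF disjI1[OF completely_metrizable_space_euclidean], of "range F"] that closed
    by auto
  ultimately obtain n y where "y \<in> interior (F n)" by blast
  then obtain r where r: "r > 0" "cball y r \<subseteq> F n" by (auto simp: mem_interior_cball)
  have "norm x \<le> 2 * real n / r" if x: "x \<in> B" for x
  proof (cases "x = 0")
    case False
    define h where "h = (r / norm x) *\<^sub>R x"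
    have "y \<in> F n" "y + h \<in> F n" using r False by (auto simp: h_def dist_norm intro!: subsetD[OF r(2)])
    then have "\<bar>x \<bullet> y\<bar> \<le> n" "\<bar>x \<bullet> (y + h)\<bar> \<le> n" using x by (auto simp: F_def)
    then have "x \<bullet> h \<le> 2 * n" by (simp add: inner_add_right)
    moreover have "x \<bullet> h = r * norm x" using False by (simp add: h_def dot_square_norm power2_eq_square)
    ultimately show ?thesis using r by (simp add: field_simps)
  qed (use r in simp)
  then show ?thesis by blast
qed

text \<open>
  This is the argument of Hellinger and Toeplitz: the vectors that \<open>G\<close> maps into the unit ball are
  weakly bounded because each \<open>y\<close> is of the form \<open>G z\<close> and \<open>x \<bullet> G z = G x \<bullet> z\<close>.
\<close>

lemma symmetric_surj_bounded_below:
  fixes G :: "'a::{real_inner, complete_space} bop"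
  assumes sym: "adj G = G" and surj: "\<And>y. \<exists>x. G x = y"
  obtains c where "c > 0" "\<And>x. c * norm x \<le> norm (G x)"
proof -
  have "\<exists>M. \<forall>x\<in>{x. norm (G x) \<le> 1}. \<bar>x \<bullet> y\<bar> \<le> M" for y
  proof -
    obtain z where z: "G z = y" using surj by blast
    have "\<bar>x \<bullet> y\<bar> \<le> norm z" if "norm (G x) \<le> 1" for x
    proof -
      have "\<bar>x \<bullet> y\<bar> = \<bar>G x \<bullet> z\<bar>" by (metis adj_inner(1) sym z)
      also have "\<dots> \<le> norm (G x) * norm z" by (rule Cauchy_Schwarz_ineq2)
      also have "\<dots> \<le> 1 * norm z" using that by (intro mult_right_mono) auto
      finally show ?thesis by simp
    qed
    then show ?thesis by blast
  qed
  then obtain M where M: "\<And>x. norm (G x) \<le> 1 \<Longrightarrow> norm x \<le> M"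
    using weakly_bounded_imp_bounded[of "{x. norm (G x) \<le> 1}"] by auto
  have M0: "M \<ge> 0" using M[of 0] by simp
  have "norm x \<le> (M + 1) * norm (G x)" for x
  proof (cases "G x = 0")
    case True
    have "x = 0"
    proof (rule ccontr)
      assume "x \<noteq> 0"
      have "norm (((M + 1) / norm x) *\<^sub>R x) \<le> M" by (rule M) (simp add: blinfun.scaleR_right True)
      then show False using \<open>x \<noteq> 0\<close> M0 by simp
    qed
    then show ?thesis by simp
  next
    case False
    have "norm ((1 / norm (G x)) *\<^sub>R x) \<le> M" by (rule M) (use False in \<open>simp add: blinfun.scaleR_right\<close>)
    then have "norm x \<le> M * norm (G x)" using False by (simp add: field_simps)
    also have "\<dots> \<le> (M + 1) * norm (G x)" by (intro mult_right_mono) auto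
    finally show ?thesis .
  qed
  then show ?thesis using that[of "1 / (M + 1)"] M0 by (simp add: field_simps)
qed

text \<open>
  The lower bound makes \<open>G\<close> injective with closed range, and by symmetry the orthogonal complement of
  the range is the kernel.
\<close>

lemma symmetric_bounded_below_invertible:
  fixes G :: "'a::{real_inner, complete_space} bop"
  assumes sym: "adj G = G" and c: "c > 0" and below: "\<And>x. c * norm x \<le> norm (G x)"
  obtains k where "k o\<^sub>L G = id_blinfun" "G o\<^sub>L k = id_blinfun"
proof -
  have inj: "x = y" if "G x = G y" for x y
    using below[of "x - y"] that c by (simp add: blinfun.diff_right mult_le_0_iff)
  have S: "subspace (range G)"
    by (rule linear_subspace_image[of G UNIV, simplified]) (auto intro: bounded_linear.linear blinfun.bounded_linear_right)
  have C: "closed (range G)"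
    by (rule complete_imp_closed, rule complete_isometric_image[OF c])
       (use below in \<open>auto simp: complete_UNIV blinfun.bounded_linear_right\<close>)
  have surj: "\<exists>x. y = G x" for y
  proof -
    define n where "n = y - proj (range G) y"
    have "n \<in> (range G)\<^sup>\<bottom>" using proj_characterization[OF S C] by (simp add: n_def)
    then have "n \<bullet> G (G n) = 0" using orthogonal_compD by blast
    then have "G n \<bullet> G n = 0" by (metis adj_inner(1) sym)
    then have "n = 0" using inj[of n 0] by (simp add: blinfun.zero_right)
    then show ?thesis using proj_characterization(1)[OF S C, of y] by (auto simp: n_def)
  qed
  then obtain h where h: "\<And>y. G (h y) = y" by metis
  have hG: "h (G x) = x" for x using inj h by blast
  have "bounded_linear h"
  proof (rule bounded_linear_intro)
    show "h (x + y) = h x + h y" for x y by (rule inj) (simp add: h blinfun.add_right)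
    show "h (r *\<^sub>R x) = r *\<^sub>R h x" for r x by (rule inj) (simp add: h blinfun.scaleR_right)
    show "norm (h x) \<le> norm x * (1 / c)" for x using below[of "h x"] c by (simp add: h field_simps)
  qed
  then have "blinfun_apply (Blinfun h) = h" by (rule bounded_linear_Blinfun_apply)
  then show ?thesis using that[of "Blinfun h"] h hG by (simp add: blinfun_eqI)
qed

lemma invertible_bounded_below:
  assumes "k o\<^sub>L G = (id_blinfun :: 'b::real_normed_vector \<Rightarrow>\<^sub>L 'b)"
  obtains c where "c > 0" "\<And>x. c * norm x \<le> norm (blinfun_apply G x)"
proof -
  have "norm x \<le> (norm k + 1) * norm (G x)" for x
  proof -
    have "x = k (G x)" by (metis assms blinfun_apply_blinfun_compose blinfun_apply_id_blinfun)
    then have "norm x \<le> norm k * norm (G x)" using norm_blinfun[of k "G x"] by simp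
    also have "\<dots> \<le> (norm k + 1) * norm (G x)" by (intro mult_right_mono) auto
    finally show ?thesis .
  qed
  moreover have "norm k + 1 > 0" by (simp add: add_nonneg_pos)
  ultimately show ?thesis by (intro that[of "1 / (norm k + 1)"]) (auto simp: pos_divide_le_eq mult.commute)
qed

section \<open>Lagrangian subspaces\<close>

locale complex_structure =
  fixes J :: "'a::{real_inner, complete_space} bop"
  assumes norm_J: "norm (J x) = norm x"
    and J_J: "J (J x) = - x"
    and adj_J: "adj J = - J"
begin

lemma J_inner: "J x \<bullet> y = - (x \<bullet> J y)"
  using adj_inner(1)[of x J y] by (simp add: adj_J blinfun.minus_left)

lemma J_inner_J: "J x \<bullet> J y = x \<bullet> y"
  by (simp add: J_inner J_J)

lemma LagrangianD:
  assumes "L \<in> Lagrangians J"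
  shows "subspace L" "closed L" "\<And>x. x \<in> L \<Longrightarrow> J x \<in> L\<^sup>\<bottom>" "\<And>x. x \<in> L\<^sup>\<bottom> \<Longrightarrow> J x \<in> L"
proof -
  show 1: "subspace L" "closed L" and "\<And>x. x \<in> L \<Longrightarrow> J x \<in> L\<^sup>\<bottom>" using assms by (auto simp: Lagrangians_def)
  fix x assume "x \<in> L\<^sup>\<bottom>"
  then have "x \<in> J ` L" using assms by (simp add: Lagrangians_def)
  then obtain y where "y \<in> L" "x = J y" by blast
  then show "J x \<in> L" using 1 by (simp add: J_J subspace_neg)
qed

text \<open>
  \<open>J\<close> exchanges \<open>L\<close> and \<open>L\<^sup>\<bottom>\<close>, so it carries the orthogonal decomposition of \<open>x\<close> to that of \<open>J x\<close> with
  the summands exchanged.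
\<close>

lemma proj_J:
  assumes "L \<in> Lagrangians J"
  shows "proj L (J x) = J x - J (proj L x)"
proof -
  note L = LagrangianD[OF assms]
  note p = proj_characterization[OF L(1,2), of x]
  show ?thesis
  proof (rule proj_unique[OF L(1,2)])
    show "J x - J (proj L x) \<in> L" using L(4)[OF p(2)] by (simp add: blinfun.diff_right)
    show "J x - (J x - J (proj L x)) \<in> L\<^sup>\<bottom>" using L(3)[OF p(1)] by simp
  qed
qed

lemma Lagrangian_if_projection:
  assumes idem: "P o\<^sub>L P = P" and sym: "adj P = P" and PJ: "\<And>x. P (J x) = J x - J (P x)"
  shows "range P \<in> Lagrangians J"
proof -
  note R = range_symmetric_idempotent[OF idem sym]
  have mem: "x \<in> range P \<longleftrightarrow> P x = x" for x using proj_mem_iff[OF R(1,2)] R(3) by simp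
  have mem': "x \<in> (range P)\<^sup>\<bottom> \<longleftrightarrow> P x = 0" for x using proj_zero_iff[OF R(1,2)] R(3) by simp
  have "J ` range P = (range P)\<^sup>\<bottom>"
  proof
    show "J ` range P \<subseteq> (range P)\<^sup>\<bottom>"
    proof
      fix y assume "y \<in> J ` range P"
      then obtain x where "y = J x" "P x = x" using mem by blast
      then show "y \<in> (range P)\<^sup>\<bottom>" by (simp add: mem' PJ)
    qed
    show "(range P)\<^sup>\<bottom> \<subseteq> J ` range P"
    proof
      fix x assume "x \<in> (range P)\<^sup>\<bottom>"
      then have "P (- J x) = - J x" using mem' PJ[of x] by (simp add: blinfun.minus_right blinfun.zero_right)
      then have "- J x \<in> range P" using mem by blast
      moreover have "x = J (- J x)" by (simp add: blinfun.minus_right J_J)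
      ultimately show "x \<in> J ` range P" by blast
    qed
  qed
  then show ?thesis using R by (simp add: Lagrangians_def)
qed

text \<open>
  Complementarity of \<open>W\<close> and \<open>L\<^sup>\<bottom>\<close> is invertibility of \<open>proj W - (1 - proj L)\<close>. Unlike the oblique projection
  along \<open>L\<^sup>\<bottom>\<close>, this operator is symmetric and depends affinely on the projection onto \<open>W\<close>.
\<close>

definition gap_op :: "'a set \<Rightarrow> 'a set \<Rightarrow> 'a bop" where
  "gap_op L W = proj W + proj L - id_blinfun"

lemma gap_op_apply: "gap_op L W x = proj W x - (x - proj L x)"
  by (simp add: gap_op_def blinfun.bilinear_simps)

lemma adj_gap_op:
  assumes "L \<in> Lagrangians J" "W \<in> Lagrangians J"
  shows "adj (gap_op L W) = gap_op L W"
  using LagrangianD[OF assms(1)] LagrangianD[OF assms(2)]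
  by (simp add: gap_op_def adj_add adj_diff adj_proj)

lemma norm_gap_op_le:
  assumes "L \<in> Lagrangians J" "W \<in> Lagrangians J"
  shows "norm (gap_op L W) \<le> 3"
proof -
  have "norm (proj W + proj L - id_blinfun) \<le> norm (proj W) + norm (proj L) + norm (id_blinfun :: 'a bop)"
    by (meson add_mono norm_triangle_ineq norm_triangle_ineq4 order_refl order_trans)
  also have "\<dots> \<le> 1 + 1 + 1"
    using LagrangianD[OF assms(1)] LagrangianD[OF assms(2)]
    by (intro add_mono norm_proj_le norm_blinfun_id_le)
  finally show ?thesis by (simp add: gap_op_def)
qed

text \<open>
  Algebraic complementarity is enough: it makes the gap operator surjective, and boundedness of the
  inverse follows from symmetry.
\<close>

lemma chart_dom_imp_gap_invertible:
  assumes L: "L \<in> Lagrangians J" and W: "W \<in> chart_dom J L"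
  obtains k where "k o\<^sub>L gap_op L W = id_blinfun" "gap_op L W o\<^sub>L k = id_blinfun"
proof -
  have WL: "W \<in> Lagrangians J" and dec: "\<And>x. \<exists>w\<in>W. \<exists>u\<in>L\<^sup>\<bottom>. x = w + u"
    using W by (auto simp: chart_dom_def)
  note L' = LagrangianD[OF L] and W' = LagrangianD[OF WL]
  have "\<exists>x. gap_op L W x = y" for y
  proof -
    obtain w u where y: "w \<in> W" "u \<in> L\<^sup>\<bottom>" "y = w + u" using dec by blast
    \<comment> \<open>Applying \<open>J\<close> to a decomposition along \<open>W\<close> and \<open>L\<^sup>\<bottom>\<close> gives one along \<open>W\<^sup>\<bottom>\<close> and \<open>L\<close>.\<close>
    obtain a b where ab: "a \<in> W" "b \<in> L\<^sup>\<bottom>" "J y = a + b" using dec by blast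
    define x where "x = w + J a"
    have "y = - J (J y)" by (simp add: J_J)
    then have "y = - J a - J b" using ab by (simp add: blinfun.add_right)
    then have "w + u = - J a - J b" using y by simp
    moreover have "x = (w + u) - u + J a" by (simp add: x_def)
    ultimately have x2: "x = - u - J b" by simp
    have "proj W x = w"
      by (rule proj_unique[OF W'(1,2)]) (use y ab W' in \<open>auto simp: x_def\<close>)
    moreover have "proj L x = - J b"
    proof (rule proj_unique[OF L'(1,2)])
      show "- J b \<in> L" using L' ab by (simp add: subspace_neg)
      show "x - - J b \<in> L\<^sup>\<bottom>" using y subspace_orthogonal_comp subspace_neg by (fastforce simp: x2)
    qed
    ultimately have "gap_op L W x = y" using y x2 by (simp add: gap_op_apply)
    then show ?thesis by blast
  qed
  then obtain c where "c > 0" "\<And>x. c * norm x \<le> norm (gap_op L W x)"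
    using symmetric_surj_bounded_below[OF adj_gap_op[OF L WL]] by blast
  then show ?thesis using symmetric_bounded_below_invertible[OF adj_gap_op[OF L WL]] that by blast
qed

context
  fixes L W :: "'a set" and k :: "'a bop"
  assumes L: "L \<in> Lagrangians J" and W: "W \<in> Lagrangians J"
    and k: "k o\<^sub>L gap_op L W = id_blinfun" "gap_op L W o\<^sub>L k = id_blinfun"
begin

lemma gap_inverse_apply: "k (gap_op L W x) = x" "gap_op L W (k x) = x"
  using k by (metis blinfun_apply_blinfun_compose blinfun_apply_id_blinfun)+

lemma gap_invertible_imp_trivial_Int: "x \<in> W \<Longrightarrow> x \<in> L\<^sup>\<bottom> \<Longrightarrow> x = 0"
proof -
  assume "x \<in> W" "x \<in> L\<^sup>\<bottom>"
  then have "gap_op L W x = 0"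
    using proj_mem_iff[of W x] proj_zero_iff[of L x] LagrangianD[OF W] LagrangianD[OF L]
    by (simp add: gap_op_apply)
  then show "x = 0" using gap_inverse_apply(1)[of x] by (simp add: blinfun.zero_right)
qed

lemma gap_decomposition: "x = proj W (k x) - (k x - proj L (k x))"
  using gap_inverse_apply(2)[of x] by (simp add: gap_op_apply)

lemma gap_invertible_imp_chart_dom: "W \<in> chart_dom J L"
proof -
  note L' = LagrangianD[OF L] and W' = LagrangianD[OF W]
  have "\<exists>w\<in>W. \<exists>u\<in>L\<^sup>\<bottom>. x = w + u" for x
  proof (intro bexI)
    show "x = proj W (k x) + - (k x - proj L (k x))" using gap_decomposition[of x] by (simp only: diff_conv_add_uminus)
    show "- (k x - proj L (k x)) \<in> L\<^sup>\<bottom>"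
      using proj_characterization(2)[OF L'(1,2)] subspace_orthogonal_comp subspace_neg by blast
    show "proj W (k x) \<in> W" by (rule proj_characterization(1)[OF W'(1,2)])
  qed
  moreover have "W \<inter> L\<^sup>\<bottom> = {0}"
    using gap_invertible_imp_trivial_Int subspace_0[OF W'(1)] subspace_0[OF subspace_orthogonal_comp] by blast
  ultimately show ?thesis using W by (simp add: chart_dom_def)
qed

text \<open>
  \<open>G (k x) = x\<close> is a decomposition of \<open>x\<close> along \<open>W\<close> and \<open>L\<^sup>\<bottom>\<close>, and there is only one.
\<close>

lemma oblique_projection: "w \<in> W \<Longrightarrow> u \<in> L\<^sup>\<bottom> \<Longrightarrow> proj W (k (w + u)) = w"
proof -
  assume wu: "w \<in> W" "u \<in> L\<^sup>\<bottom>"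
  note L' = LagrangianD[OF L] and W' = LagrangianD[OF W]
  let ?x = "w + u"
  have "proj W (k ?x) - w = u + (k ?x - proj L (k ?x))" using gap_decomposition[of ?x] by (simp add: algebra_simps)
  moreover have "\<dots> \<in> L\<^sup>\<bottom>"
    using proj_characterization(2)[OF L'(1,2)] subspace_orthogonal_comp subspace_add wu by blast
  moreover have "proj W (k ?x) - w \<in> W" using proj_characterization(1)[OF W'(1,2)] subspace_diff W'(1) wu by blast
  ultimately have "proj W (k ?x) - w = 0" using gap_invertible_imp_trivial_Int by metis
  then show "proj W (k ?x) = w" by simp
qed

lemma oblique_minus_orthogonal:
  defines "T \<equiv> (proj W o\<^sub>L k) - proj L"
  shows "x \<in> L\<^sup>\<bottom> \<Longrightarrow> T x = 0" "T x \<in> L\<^sup>\<bottom>" "x \<in> L \<Longrightarrow> x + T x = proj W (k x)"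
    "W = {v + T v |v. v \<in> L}"
proof -
  note L' = LagrangianD[OF L] and W' = LagrangianD[OF W]
  note pL = proj_characterization[OF L'(1,2)] and pW = proj_characterization[OF W'(1,2)]
  show zero: "T x = 0" if "x \<in> L\<^sup>\<bottom>" for x
    using oblique_projection[OF subspace_0[OF W'(1)] that] proj_zero_iff[OF L'(1,2), of x] that
    by (simp add: blinfun.diff_left T_def)
  show onL: "x + T x = proj W (k x)" if "x \<in> L" for x
    using that proj_mem_iff[OF L'(1,2), of x] by (simp add: blinfun.diff_left T_def)
  have "T x = T (proj L x)" for x using zero[OF pL(2)[of x]] by (simp add: blinfun.diff_right)
  moreover have "T v = k v - proj L (k v)" if "v \<in> L" for v
    using onL[OF that] gap_decomposition[of v] by (metis add_diff_cancel_left' diff_eq_eq add.commute)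
  ultimately show "T x \<in> L\<^sup>\<bottom>" for x using pL by metis
  show "W = {v + T v |v. v \<in> L}"
  proof
    show "{v + T v |v. v \<in> L} \<subseteq> W" using onL pW(1) by auto
    show "W \<subseteq> {v + T v |v. v \<in> L}"
    proof
      fix w assume w: "w \<in> W"
      have "proj L w - w \<in> L\<^sup>\<bottom>" using pL(2)[of w] subspace_neg[OF subspace_orthogonal_comp] by fastforce
      from oblique_projection[OF w this] have "proj W (k (proj L w)) = w" by simp
      then have "w = proj L w + T (proj L w)" using onL[OF pL(1)] by simp
      then show "w \<in> {v + T v |v. v \<in> L}" using pL(1) by blast
    qed
  qed
qed

lemma graph_op_unique:
  assumes T': "\<And>x. x \<in> L\<^sup>\<bottom> \<Longrightarrow> blinfun_apply T' x = 0" "\<And>x. x \<in> L \<Longrightarrow> T' x \<in> L\<^sup>\<bottom>"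
    "\<And>x. x \<in> L \<Longrightarrow> x + T' x \<in> W"
  shows "T' = (proj W o\<^sub>L k) - proj L"
proof (rule blinfun_eqI)
  note pL = proj_characterization[OF LagrangianD(1,2)[OF L]]
  let ?T = "(proj W o\<^sub>L k) - proj L"
  note T = oblique_minus_orthogonal
  fix x
  let ?v = "proj L x"
  have v: "?v \<in> L" "x - ?v \<in> L\<^sup>\<bottom>" using pL by auto
  have "- T' ?v \<in> L\<^sup>\<bottom>" using T' v subspace_neg[OF subspace_orthogonal_comp] by blast
  with T'(3)[OF v(1)] have "proj W (k ((?v + T' ?v) + - T' ?v)) = ?v + T' ?v" by (rule oblique_projection)
  then have "T' ?v = ?T ?v" using T(3)[OF v(1)] by simp
  moreover have "T' (x - ?v) = ?T (x - ?v)" using T'(1) T(1) v by simp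
  ultimately show "T' x = ?T x" by (metis blinfun.diff_right diff_add_cancel)
qed

lemma graph_op_eq: "graph_op L W = (proj W o\<^sub>L k) - proj L"
  unfolding graph_op_def
proof (rule the_equality)
  let ?T = "(proj W o\<^sub>L k) - proj L"
  show "(\<forall>x\<in>L\<^sup>\<bottom>. ?T x = 0) \<and> (\<forall>x\<in>L. ?T x \<in> L\<^sup>\<bottom>) \<and> W = {v + ?T v |v. v \<in> L}"
    using oblique_minus_orthogonal by blast
  fix T' :: "'a bop"
  assume T': "(\<forall>x\<in>L\<^sup>\<bottom>. T' x = 0) \<and> (\<forall>x\<in>L. T' x \<in> L\<^sup>\<bottom>) \<and> W = {v + T' v |v. v \<in> L}"
  then have "x + T' x \<in> W" if "x \<in> L" for x using that by blast
  with T' show "T' = ?T" by (intro graph_op_unique) blast+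
qed

lemmas graph_op_properties = oblique_minus_orthogonal[folded graph_op_eq]

text \<open>
  Symmetry of the chart coordinate says that \<open>J x \<bullet> y\<close> vanishes for \<open>x\<close> and \<open>y\<close> in the graph \<open>W\<close>.
\<close>

lemma graph_op_sym: "J (graph_op L W x) \<bullet> y = x \<bullet> J (graph_op L W y)"
proof -
  let ?T = "graph_op L W"
  note L' = LagrangianD[OF L] and W' = LagrangianD[OF W]
  note pL = proj_characterization[OF L'(1,2)]
  have inW: "v + ?T v \<in> W" if "v \<in> L" for v using graph_op_properties(4) that by blast
  have TE: "?T z = ?T (proj L z)" for z
    using graph_op_properties(1)[OF pL(2)[of z]] by (simp add: blinfun.diff_right)
  have onL: "J (?T v) \<bullet> w = v \<bullet> J (?T w)" if "v \<in> L" "w \<in> L" for v w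
  proof -
    have "J (v + ?T v) \<bullet> (w + ?T w) = 0" using W'(3)[OF inW[OF that(1)]] inW[OF that(2)] orthogonal_compD by blast
    moreover have "J v \<bullet> w = 0" using L'(3)[OF that(1)] that(2) orthogonal_compD by blast
    moreover have "J (?T v) \<bullet> ?T w = 0"
      using L'(4)[OF graph_op_properties(2)[of v]] graph_op_properties(2)[of w] orthogonal_compD inner_commute by metis
    moreover have "J v \<bullet> ?T w = - (v \<bullet> J (?T w))" by (rule J_inner)
    ultimately show ?thesis by (simp add: blinfun.add_right inner_add_left inner_add_right)
  qed
  have inL: "J (?T z) \<in> L" for z using L'(4) graph_op_properties(2) by blast
  have "J (?T x) \<bullet> y = J (?T x) \<bullet> proj L y"
    using orthogonal_compD[OF pL(2)[of y] inL[of x]] by (simp add: inner_diff_left inner_commute)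
  also have "\<dots> = proj L x \<bullet> J (?T y)" using onL[OF pL(1) pL(1), of x y] TE by metis
  also have "\<dots> = x \<bullet> J (?T y)"
    using orthogonal_compD[OF pL(2)[of x] inL[of y]] by (simp add: inner_diff_left)
  finally show ?thesis .
qed

lemma adj_gap_inverse: "adj k = k"
proof -
  have "gap_op L W o\<^sub>L adj k = id_blinfun"
    using arg_cong[OF k(1), of adj] by (simp add: adj_compose adj_gap_op[OF L W])
  then have "adj k x = k x" for x
    by (metis gap_inverse_apply(1) blinfun_apply_blinfun_compose blinfun_apply_id_blinfun)
  then show ?thesis by (rule blinfun_eqI)
qed

text \<open>
  The inverse of the gap operator is affine in the graph coordinate. This is what makes the passage
  between the charts and the projections smooth in both directions.
\<close>

lemma gap_inverse_eq: "k = 2 *\<^sub>R proj L - id_blinfun + graph_op L W + adj (graph_op L W)"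
proof (rule blinfun_eqI)
  fix x
  let ?P = "proj W" and ?E = "proj L" and ?G = "gap_op L W"
  note idem = proj_idem[OF LagrangianD(1,2)[OF W]] proj_idem[OF LagrangianD(1,2)[OF L]]
  obtain z where z: "x = ?G z" using gap_inverse_apply(2) by metis
  have "?G (?P (k x) + k (?P x)) = ?G (?P z) + ?P (?G z)"
    by (simp add: blinfun.add_right gap_inverse_apply z)
  also have "\<dots> = ?G z + ?G (?G z)"
    by (simp add: gap_op_apply blinfun.bilinear_simps idem algebra_simps)
  also have "\<dots> = ?G (k x + x)" by (simp add: blinfun.add_right gap_inverse_apply z)
  finally have 1: "?P (k x) + k (?P x) = k x + x" using gap_inverse_apply(1) by metis
  have 2: "adj (graph_op L W) x = k (?P x) - ?E x"
    by (simp add: graph_op_eq adj_diff adj_compose adj_gap_inverse adj_proj LagrangianD[OF W] LagrangianD[OF L]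
        blinfun.diff_left)
  have 3: "graph_op L W x = ?P (k x) - ?E x" by (simp add: graph_op_eq blinfun.diff_left)
  have "(2 *\<^sub>R proj L - id_blinfun + graph_op L W + adj (graph_op L W)) x
      = 2 *\<^sub>R ?E x - x + (?P (k x) - ?E x) + (k (?P x) - ?E x)"
    by (simp add: blinfun.add_left blinfun.diff_left blinfun.scaleR_left 2 3)
  also have "\<dots> = (?P (k x) + k (?P x)) - x" by (simp add: scaleR_2 algebra_simps)
  finally show "k x = (2 *\<^sub>R proj L - id_blinfun + graph_op L W + adj (graph_op L W)) x" by (simp add: 1)
qed

lemma graph_op_from_proj_diff: "graph_op L W = (id_blinfun - proj L) o\<^sub>L (proj W - proj L) o\<^sub>L k"
proof (rule blinfun_eqI)
  fix x
  note idem = proj_idem[OF LagrangianD(1,2)[OF L]]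
  have "proj L x = proj L (proj W (k x) - (k x - proj L (k x)))" using gap_decomposition[of x] by simp
  then show "graph_op L W x = ((id_blinfun - proj L) o\<^sub>L (proj W - proj L) o\<^sub>L k) x"
    by (simp add: graph_op_eq blinfun.bilinear_simps idem)
qed

lemma proj_diff_from_graph_op:
  "proj W - proj L =
    - (gap_op L W o\<^sub>L (graph_op L W + adj (graph_op L W)) o\<^sub>L (2 *\<^sub>R proj L - id_blinfun))"
proof (rule blinfun_eqI)
  fix x
  define R where "R = 2 *\<^sub>R proj L - id_blinfun"
  note idem = proj_idem[OF LagrangianD(1,2)[OF L]]
  have RR: "R (R y) = y" for y by (simp add: R_def blinfun.bilinear_simps idem scaleR_2)
  have "k - R = graph_op L W + adj (graph_op L W)" by (subst gap_inverse_eq) (simp add: R_def)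
  then have "graph_op L W + adj (graph_op L W) = k - R" by simp
  then have "(gap_op L W o\<^sub>L (graph_op L W + adj (graph_op L W)) o\<^sub>L R) x = R x - gap_op L W x"
    by (simp add: blinfun.diff_left blinfun.diff_right gap_inverse_apply RR)
  also have "\<dots> = - ((proj W - proj L) x)" by (simp add: R_def gap_op_apply blinfun.bilinear_simps scaleR_2)
  finally show "(proj W - proj L) x = (- (gap_op L W o\<^sub>L (graph_op L W + adj (graph_op L W)) o\<^sub>L (2 *\<^sub>R proj L - id_blinfun))) x"
    by (simp add: blinfun.minus_left R_def)
qed

end

end

context complex_structure
begin

section \<open>The orbit of the restricted symplectic group\<close>

lemma Sp_apply:
  assumes "g \<in> Sp J"
  shows "J (g x) \<bullet> g y = J x \<bullet> y"
proof -
  have "adj g (J (g x)) = J x" using assms unfolding Sp_def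
    by (metis (mono_tags, lifting) blinfun_apply_blinfun_compose mem_Collect_eq)
  then show ?thesis by (metis adj_inner(2))
qed

lemma Sp_inverse:
  assumes "g \<in> Sp J"
  obtains h :: "'a bop" where "\<And>x. g (h x) = x" "\<And>x. h (g x) = x"
proof -
  obtain h where h: "g o\<^sub>L h = id_blinfun" "h o\<^sub>L g = id_blinfun"
    using assms by (auto simp: Sp_def bop_invertible_def)
  have "g (h x) = x" "h (g x) = x" for x
    using h by (metis blinfun_apply_blinfun_compose blinfun_apply_id_blinfun)+
  then show ?thesis using that by blast
qed

lemma Sp_image_Lagrangian:
  assumes g: "g \<in> Sp J" and L: "L \<in> Lagrangians J"
  shows "g ` L \<in> Lagrangians J"
proof -
  obtain h :: "'a bop" where gh: "\<And>x. g (h x) = x" and hg: "\<And>x. h (g x) = x"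
    using Sp_inverse[OF g] by blast
  note L' = LagrangianD[OF L]
  have "subspace (g ` L)"
    by (rule linear_subspace_image[OF _ L'(1)]) (auto intro: bounded_linear.linear blinfun.bounded_linear_right)
  moreover have "closed (g ` L)"
  proof -
    have "g ` L = h -` L" using gh hg by (auto simp: image_iff) metis
    then show ?thesis by (auto intro!: continuous_closed_vimage[OF L'(2)] continuous_intros)
  qed
  moreover have "J ` g ` L = (g ` L)\<^sup>\<bottom>"
  proof
    show "J ` g ` L \<subseteq> (g ` L)\<^sup>\<bottom>"
      by (auto intro!: orthogonal_compI simp: Sp_apply[OF g]) (meson L'(3) orthogonal_compD)
    show "(g ` L)\<^sup>\<bottom> \<subseteq> J ` g ` L"
    proof
      fix z assume z: "z \<in> (g ` L)\<^sup>\<bottom>"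
      define w where "w = h (- J z)"
      have gw: "g w = - J z" by (simp add: w_def gh)
      have Jgw: "J (g w) = z" by (simp add: gw blinfun.minus_right J_J)
      have "J w \<in> L\<^sup>\<bottom>"
      proof (rule orthogonal_compI)
        fix y assume "y \<in> L"
        then show "J w \<bullet> y = 0" using orthogonal_compD[OF z, of "g y"] Sp_apply[OF g, of w y] Jgw by simp
      qed
      then have "J (J w) \<in> L" using L'(4) by blast
      then have "w \<in> L" using L'(1) subspace_neg by (fastforce simp: J_J)
      then show "z \<in> J ` g ` L" using Jgw by (metis imageI)
    qed
  qed
  ultimately show ?thesis by (simp add: Lagrangians_def)
qed

text \<open>
  Write \<open>P\<close> and \<open>E\<close> for the projections onto \<open>g L\<close> and \<open>L\<close>. Then
  \<open>P - E = P (1 - E) - (1 - P) E\<close>. Since \<open>1 - P\<close> annihilates \<open>g L\<close>, the operator \<open>(1 - P) E\<close> does not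
  change up to sign when \<open>E\<close> is replaced by \<open>(g - 1) E\<close>; the other summand is treated in the same way
  with the inverse of \<open>g\<close>, after passing to adjoints.
\<close>

lemma Sp2_proj_diff_hilbert_schmidt:
  assumes g: "g \<in> Sp2 J" and L: "L \<in> Lagrangians J"
  shows "hilbert_schmidt (proj (g ` L) - proj L)"
proof -
  have gS: "g \<in> Sp J" and A: "hilbert_schmidt (g - id_blinfun)" using g by (auto simp: Sp2_def)
  obtain h :: "'a bop" where "\<And>x. g (h x) = x" and hg: "\<And>x. h (g x) = x"
    using Sp_inverse[OF gS] by blast
  let ?W = "g ` L" and ?A = "g - id_blinfun"
  let ?P = "proj ?W" and ?E = "proj L"
  note L' = LagrangianD[OF L] and W' = LagrangianD[OF Sp_image_Lagrangian[OF gS L]]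
  let ?B = "(id_blinfun - ?P) o\<^sub>L ?A o\<^sub>L ?E"
  have B: "?B x = ?P (?E x) - ?E x" for x
  proof -
    have "?P (g (?E x)) = g (?E x)"
      using proj_mem_iff[OF W'(1,2), of "g (?E x)"] proj_characterization(1)[OF L'(1,2)] by blast
    then show ?thesis by (simp add: blinfun.bilinear_simps)
  qed
  let ?C = "(id_blinfun - ?E) o\<^sub>L (h o\<^sub>L ?A) o\<^sub>L ?P"
  have C: "?C x = ?P x - ?E (?P x)" for x
  proof -
    obtain y where y: "y \<in> L" "?P x = g y" using proj_characterization(1)[OF W'(1,2)] by blast
    then have "?E y = y" using proj_mem_iff[OF L'(1,2)] by blast
    then show ?thesis by (simp add: blinfun.bilinear_simps hg y)
  qed
  have "?P - ?E = adj ?C + ?B"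
  proof -
    have "?C = ?P - (?E o\<^sub>L ?P)" by (rule blinfun_eqI, subst C) (simp add: blinfun.diff_left)
    then have "adj ?C = ?P - (?P o\<^sub>L ?E)" by (simp add: adj_diff adj_compose adj_proj L' W')
    moreover have "?B = (?P o\<^sub>L ?E) - ?E" by (rule blinfun_eqI, subst B) (simp add: blinfun.diff_left)
    ultimately show ?thesis by simp
  qed
  then show ?thesis
    by (simp add: hilbert_schmidt_add hilbert_schmidt_adj hilbert_schmidt_compose_left hilbert_schmidt_compose_right A)
qed

lemma Sp2_compose:
  assumes "g \<in> Sp2 J" "f \<in> Sp2 J"
  shows "g o\<^sub>L f \<in> Sp2 J"
proof -
  have inv: "bop_invertible (g o\<^sub>L f)"
  proof -
    obtain g' f' where *: "g o\<^sub>L g' = id_blinfun" "g' o\<^sub>L g = id_blinfun" "f o\<^sub>L f' = id_blinfun" "f' o\<^sub>L f = id_blinfun"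
      using assms by (auto simp: Sp2_def Sp_def bop_invertible_def)
    have "\<And>x. g (g' x) = x" "\<And>x. g' (g x) = x" "\<And>x. f (f' x) = x" "\<And>x. f' (f x) = x"
      using * by (metis blinfun_apply_blinfun_compose blinfun_apply_id_blinfun)+
    then show ?thesis unfolding bop_invertible_def
      by (intro exI[of _ "f' o\<^sub>L g'"] conjI blinfun_eqI) auto
  qed
  have sp: "adj (g o\<^sub>L f) o\<^sub>L J o\<^sub>L (g o\<^sub>L f) = J"
  proof (rule blinfun_eqI)
    fix x
    have g: "adj g (J (g y)) = J y" for y using assms(1) unfolding Sp2_def Sp_def
      by (metis (mono_tags, lifting) blinfun_apply_blinfun_compose mem_Collect_eq)
    have f: "adj f (J (f y)) = J y" for y using assms(2) unfolding Sp2_def Sp_def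
      by (metis (mono_tags, lifting) blinfun_apply_blinfun_compose mem_Collect_eq)
    show "(adj (g o\<^sub>L f) o\<^sub>L J o\<^sub>L (g o\<^sub>L f)) x = J x" by (simp add: adj_compose f g)
  qed
  have eq: "(g o\<^sub>L f) - id_blinfun = ((g - id_blinfun) o\<^sub>L f) + (f - id_blinfun)"
    by (rule blinfun_eqI) (simp add: blinfun.bilinear_simps)
  have "hilbert_schmidt ((g o\<^sub>L f) - id_blinfun)" unfolding eq
    using assms by (intro hilbert_schmidt_add hilbert_schmidt_compose_right) (auto simp: Sp2_def)
  then show ?thesis using inv sp by (simp add: Sp2_def Sp_def)
qed

text \<open>
  Shears \<open>1 + T\<close> along \<open>L\<^sup>\<bottom>\<close> suffice to produce all the curves that are needed: the graphs of
  \<open>t T\<close> form a curve in the orbit.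
\<close>

definition shear_generator :: "'a set \<Rightarrow> 'a bop \<Rightarrow> bool" where
  "shear_generator L T \<longleftrightarrow> hilbert_schmidt T \<and> (\<forall>x\<in>L\<^sup>\<bottom>. T x = 0) \<and> (\<forall>x. T x \<in> L\<^sup>\<bottom>)
     \<and> (\<forall>x y. J (T x) \<bullet> y = x \<bullet> J (T y))"

definition graph_of :: "'a set \<Rightarrow> 'a bop \<Rightarrow> 'a set" where
  "graph_of L T = {v + T v |v. v \<in> L}"

lemma shear_generator_scaleR: "shear_generator L T \<Longrightarrow> shear_generator L (r *\<^sub>R T)"
  using subspace_scale[OF subspace_orthogonal_comp[of L]]
  unfolding shear_generator_def blinfun.scaleR_left blinfun.scaleR_right
  by (auto simp: hilbert_schmidt_scaleR)

text \<open>
  As \<open>T\<close> maps into its own kernel, \<open>T\<^sup>2 = 0\<close> and the inverse is \<open>1 - T\<close>; the symplectic condition is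
  the symmetry of \<open>J T\<close>, because \<open>J T\<close> and \<open>T\<close> have orthogonal ranges.
\<close>

lemma shear_Sp2:
  assumes L: "L \<in> Lagrangians J" and T: "shear_generator L T"
  shows "id_blinfun + T \<in> Sp2 J"
proof -
  note T' = T[unfolded shear_generator_def]
  have TT: "T (T x) = 0" for x using T' by blast
  have "bop_invertible (id_blinfun + T)" unfolding bop_invertible_def
    by (rule exI[of _ "id_blinfun - T"]) (auto intro!: blinfun_eqI simp: blinfun.bilinear_simps TT)
  moreover have "adj (id_blinfun + T) o\<^sub>L J o\<^sub>L (id_blinfun + T) = J"
  proof (rule blinfun_eqI, rule vector_eq_rdot[THEN iffD1, rule_format])
    fix x y
    have "J (T x) \<bullet> T y = 0" using T' LagrangianD(4)[OF L] orthogonal_compD inner_commute by metis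
    moreover have "J (T x) \<bullet> y = - (J x \<bullet> T y)" using T' J_inner[of x "T y"] by auto
    ultimately have "J (x + T x) \<bullet> (y + T y) = J x \<bullet> y"
      by (simp add: blinfun.add_right inner_add_left inner_add_right)
    then show "(adj (id_blinfun + T) o\<^sub>L J o\<^sub>L (id_blinfun + T)) x \<bullet> y = J x \<bullet> y"
      by (simp add: adj_inner blinfun.add_left)
  qed
  moreover have "hilbert_schmidt (id_blinfun + T - id_blinfun)" using T' by simp
  ultimately show ?thesis by (simp add: Sp2_def Sp_def)
qed

lemma graph_of_chart:
  assumes L: "L \<in> Lagrangians J" and T: "shear_generator L T"
  shows "graph_of L T \<in> Lagrangians J" "graph_of L T \<in> chart_dom J L" "graph_op L (graph_of L T) = T"
proof -
  note T' = T[unfolded shear_generator_def] and L' = LagrangianD[OF L]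
  note pL = proj_characterization[OF L'(1,2)]
  have eq: "graph_of L T = (id_blinfun + T) ` L" by (auto simp: graph_of_def blinfun.add_left)
  show W: "graph_of L T \<in> Lagrangians J"
    unfolding eq using shear_Sp2[OF L T] by (intro Sp_image_Lagrangian L) (simp add: Sp2_def)
  have "graph_of L T \<inter> L\<^sup>\<bottom> = {0}"
  proof -
    have "v + T v = 0" if "v \<in> L" "v + T v \<in> L\<^sup>\<bottom>" for v
    proof -
      have "(v + T v) - T v \<in> L\<^sup>\<bottom>" using that T' subspace_diff[OF subspace_orthogonal_comp] by blast
      then have "v = 0" using subspace_Int_orthogonal_comp that by simp
      then show ?thesis by (simp add: blinfun.zero_right)
    qed
    moreover have "0 \<in> graph_of L T" "0 \<in> L\<^sup>\<bottom>"
      using subspace_0 LagrangianD(1)[OF W] subspace_orthogonal_comp by blast+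
    ultimately show ?thesis by (auto simp: graph_of_def)
  qed
  moreover have "\<exists>w\<in>graph_of L T. \<exists>u\<in>L\<^sup>\<bottom>. x = w + u" for x
  proof (intro bexI)
    show "x = (proj L x + T (proj L x)) + ((x - proj L x) - T (proj L x))" by simp
    show "(x - proj L x) - T (proj L x) \<in> L\<^sup>\<bottom>" using pL T' subspace_diff[OF subspace_orthogonal_comp] by blast
    show "proj L x + T (proj L x) \<in> graph_of L T" using pL by (auto simp: graph_of_def)
  qed
  ultimately show cd: "graph_of L T \<in> chart_dom J L" using W by (simp add: chart_dom_def)
  obtain k where k: "k o\<^sub>L gap_op L (graph_of L T) = id_blinfun" "gap_op L (graph_of L T) o\<^sub>L k = id_blinfun"
    using chart_dom_imp_gap_invertible[OF L cd] by blast
  have "T = (proj (graph_of L T) o\<^sub>L k) - proj L"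
    using T' by (intro graph_op_unique[OF L W k]) (auto simp: graph_of_def)
  then show "graph_op L (graph_of L T) = T" using graph_op_eq[OF L W k] by simp
qed

end

locale lagrangian_orbit = complex_structure +
  fixes L0 :: "'a set"
  assumes L0: "L0 \<in> Lagrangians J"
begin

lemma orbit_Lagrangian: "W \<in> Lorbit J L0 \<Longrightarrow> W \<in> Lagrangians J"
  using Sp_image_Lagrangian L0 by (auto simp: Lorbit_def Sp2_def)

lemma orbit_proj_diff:
  assumes "W \<in> Lorbit J L0" "L \<in> Lorbit J L0"
  shows "hilbert_schmidt (proj W - proj L)"
proof -
  have "hilbert_schmidt (proj V - proj L0)" if "V \<in> Lorbit J L0" for V
    using that Sp2_proj_diff_hilbert_schmidt L0 by (auto simp: Lorbit_def)
  from hilbert_schmidt_diff[OF this[OF assms(1)] this[OF assms(2)]] show ?thesis by simp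
qed

lemma graph_of_orbit:
  assumes L: "L \<in> Lorbit J L0" and T: "shear_generator L T"
  shows "graph_of L T \<in> Lorbit J L0"
proof -
  obtain g where g: "g \<in> Sp2 J" "L = g ` L0" using L by (auto simp: Lorbit_def)
  have "graph_of L T = ((id_blinfun + T) o\<^sub>L g) ` L0"
    by (auto simp: graph_of_def g blinfun.add_left)
  moreover have "(id_blinfun + T) o\<^sub>L g \<in> Sp2 J"
    by (rule Sp2_compose[OF shear_Sp2[OF orbit_Lagrangian[OF L] T] g(1)])
  ultimately show ?thesis unfolding Lorbit_def by blast
qed

text \<open>
  A single projection need not be Hilbert-Schmidt, so an element of the orbit is represented in the
  Hilbert space relative to a base point.
\<close>

definition pdiff :: "'a set \<Rightarrow> 'a set \<Rightarrow> 'a hs" where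
  "pdiff L W = Hs (proj W - proj L)"

lemma of_hs_pdiff:
  "W \<in> Lorbit J L0 \<Longrightarrow> L \<in> Lorbit J L0 \<Longrightarrow> of_hs (pdiff L W) = proj W - proj L"
  unfolding pdiff_def by (intro of_hs_Hs orbit_proj_diff)

lemma L0_orbit: "L0 \<in> Lorbit J L0"
proof -
  have "shear_generator L0 0"
    by (auto simp: shear_generator_def hilbert_schmidt_zero subspace_0[OF subspace_orthogonal_comp] blinfun.zero_right)
  from shear_Sp2[OF L0 this] have "id_blinfun \<in> Sp2 J" by simp
  then show ?thesis unfolding Lorbit_def by (intro CollectI exI[of _ id_blinfun]) auto
qed

lemma pdiff_change_base:
  assumes "W \<in> Lorbit J L0" "L \<in> Lorbit J L0" "M \<in> Lorbit J L0"
  shows "pdiff L W = pdiff M W + pdiff L M"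
  using assms by (intro of_hs_eqI) (simp add: of_hs_simps of_hs_pdiff)

end

section \<open>Smooth curves in the orbit are smooth curves of projections\<close>

lemma has_hs_derivative_iff:
  assumes "t \<in> S"
  shows "has_hs_derivative f v t S \<longleftrightarrow> hilbert_schmidt v \<and> (\<forall>s\<in>S. hilbert_schmidt (f s)) \<and>
    ((\<lambda>s. Hs (f s)) has_vector_derivative Hs v) (at t within S)"
proof (cases "hilbert_schmidt v \<and> (\<forall>s\<in>S. hilbert_schmidt (f s))")
  case True
  have "hs_norm ((f s - f t) /\<^sub>R (s - t) - v) = norm ((Hs (f s) - Hs (f t)) /\<^sub>R (s - t) - Hs v)"
    if "s \<in> S" for s
    using True that assms by (simp add: norm_hs_eq of_hs_simps of_hs_Hs)
  then have "((\<lambda>s. hs_norm ((f s - f t) /\<^sub>R (s - t) - v)) \<longlongrightarrow> 0) (at t within S) \<longleftrightarrow>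
      ((\<lambda>s. norm ((Hs (f s) - Hs (f t)) /\<^sub>R (s - t) - Hs v)) \<longlongrightarrow> 0) (at t within S)"
    by (intro filterlim_cong refl) (auto simp: eventually_at_filter)
  then show ?thesis
    using True by (simp add: has_hs_derivative_def has_vector_derivative_iff_difference_quotient)
qed (auto simp: has_hs_derivative_def)

lemma hs_smooth_on_iff:
  assumes S: "no_isolated_point S"
  shows "hs_smooth_on S f \<longleftrightarrow> (\<forall>t\<in>S. hilbert_schmidt (f t)) \<and> csmooth S (\<lambda>t. Hs (f t))"
proof
  assume "hs_smooth_on S f"
  then obtain F where F: "F 0 = f" "\<And>n t. t \<in> S \<Longrightarrow> has_hs_derivative (F n) (F (Suc n) t) t S"
    by (auto simp: hs_smooth_on_def)
  have "csmooth S (\<lambda>t. Hs (F 0 t))"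
    by (rule csmooth_if_derivative_sequence[where F = "\<lambda>n t. Hs (F n t)"])
       (use F(2) in \<open>auto simp: has_hs_derivative_iff\<close>)
  then show "(\<forall>t\<in>S. hilbert_schmidt (f t)) \<and> csmooth S (\<lambda>t. Hs (f t))"
    using F(2)[of _ 0] by (auto simp: F(1) has_hs_derivative_iff)
next
  assume f: "(\<forall>t\<in>S. hilbert_schmidt (f t)) \<and> csmooth S (\<lambda>t. Hs (f t))"
  then obtain G where G: "G 0 = (\<lambda>t. Hs (f t))"
    "\<And>n t. t \<in> S \<Longrightarrow> (G n has_vector_derivative G (Suc n) t) (at t within S)"
    using csmooth_iff_derivative_sequence[OF S] by (metis (no_types, lifting))
  define F where "F n = (if n = 0 then f else (\<lambda>t. of_hs (G n t)))" for n :: nat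
  have "has_hs_derivative (F n) (F (Suc n) t) t S" if t: "t \<in> S" for n t
  proof -
    have "(\<lambda>s. Hs (F n s)) = G n" using G(1) by (cases n) (auto simp: F_def of_hs_inverse)
    then show ?thesis using G(2)[OF t, of n] f
      by (simp add: has_hs_derivative_iff[OF t]) (simp add: F_def of_hs_inverse)
  qed
  then show "hs_smooth_on S f" unfolding hs_smooth_on_def by (intro exI[of _ F]) (simp add: F_def)
qed

context lagrangian_orbit
begin

definition projection_curve :: "(real \<Rightarrow> 'a set) \<Rightarrow> real \<Rightarrow> 'a hs" where
  "projection_curve \<gamma> t = pdiff L0 (\<gamma> t)"

lemma projection_curve_rebase:
  assumes "\<gamma> t \<in> Lorbit J L0" "L \<in> Lorbit J L0"
  shows "projection_curve \<gamma> t = pdiff L (\<gamma> t) + pdiff L0 L"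
  unfolding projection_curve_def by (intro pdiff_change_base assms L0_orbit)

lemma self_chart:
  assumes L: "L \<in> Lagrangians J"
  defines "R \<equiv> 2 *\<^sub>R proj L - id_blinfun"
  shows "gap_op L L = R" "R o\<^sub>L R = id_blinfun" "L \<in> chart_dom J L"
proof -
  show 1: "gap_op L L = R" by (simp add: gap_op_def R_def scaleR_2)
  show 2: "R o\<^sub>L R = id_blinfun"
    by (rule blinfun_eqI) (simp add: R_def blinfun.bilinear_simps proj_idem LagrangianD[OF L] scaleR_2)
  show "L \<in> chart_dom J L"
    by (rule gap_invertible_imp_chart_dom[OF L L, where k = R]) (simp_all add: 1 2)
qed

text \<open>
  In the direction from charts to projections, the graph operator is smooth by assumption, hence
  so are the inverse of the gap operator (affine in it), the gap operator, and the projection.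
\<close>

lemma smooth_projection_if_smooth_chart:
  assumes \<gamma>: "\<And>t. t \<in> S \<Longrightarrow> \<gamma> t \<in> Lorbit J L0" and L: "L \<in> Lorbit J L0"
    and dom: "\<And>t. t \<in> S \<Longrightarrow> \<gamma> t \<in> chart_dom J L"
    and T: "csmooth S T" and T_graph: "\<And>t. t \<in> S \<Longrightarrow> of_hs (T t) = graph_op L (\<gamma> t)"
  shows "csmooth S (\<lambda>t. gap_op L (\<gamma> t))" "csmooth S (\<lambda>t. pdiff L (\<gamma> t))"
proof -
  define R where "R = 2 *\<^sub>R proj L - id_blinfun"
  define Y where "Y t = T t + hs_adj (T t)" for t
  define K where "K t = R + of_hs (Y t)" for t
  have Y: "csmooth S Y" unfolding Y_def by (intro csmooth_add T csmooth_linear[OF bounded_linear_hs_adj])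
  have K: "csmooth S K" unfolding K_def
    by (intro csmooth_add csmooth_const csmooth_linear[OF bounded_linear_of_hs] Y)
  have inv: "K t o\<^sub>L gap_op L (\<gamma> t) = id_blinfun \<and> gap_op L (\<gamma> t) o\<^sub>L K t = id_blinfun" if t: "t \<in> S" for t
  proof -
    obtain k where k: "k o\<^sub>L gap_op L (\<gamma> t) = id_blinfun" "gap_op L (\<gamma> t) o\<^sub>L k = id_blinfun"
      using chart_dom_imp_gap_invertible[OF orbit_Lagrangian[OF L] dom[OF t]] by blast
    have "k = K t"
      using gap_inverse_eq[OF orbit_Lagrangian[OF L] orbit_Lagrangian[OF \<gamma>[OF t]] k]
      by (simp add: K_def Y_def R_def of_hs_simps hs_adj.rep_eq T_graph[OF t])
    then show ?thesis using k by simp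
  qed
  show G: "csmooth S (\<lambda>t. gap_op L (\<gamma> t))"
    by (rule csmooth_operator_inverse[OF K]) (use inv in auto)
  have "csmooth S (\<lambda>t. - hs_right (hs_left (gap_op L (\<gamma> t)) (Y t)) R)"
    by (intro csmooth_linear[OF bounded_linear_minus[OF bounded_linear_ident]]
        csmooth_bilinear[OF bounded_bilinear_hs_right] csmooth_bilinear[OF bounded_bilinear_hs_left]
        csmooth_const G Y)
  moreover have "pdiff L (\<gamma> t) = - hs_right (hs_left (gap_op L (\<gamma> t)) (Y t)) R" if t: "t \<in> S" for t
  proof (rule of_hs_eqI)
    show "of_hs (pdiff L (\<gamma> t)) = of_hs (- hs_right (hs_left (gap_op L (\<gamma> t)) (Y t)) R)"
      using proj_diff_from_graph_op[OF orbit_Lagrangian[OF L] orbit_Lagrangian[OF \<gamma>[OF t]]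
          conjunct1[OF inv[OF t]] conjunct2[OF inv[OF t]]]
      by (simp add: of_hs_pdiff[OF \<gamma>[OF t] L] of_hs_simps hs_right.rep_eq hs_left.rep_eq Y_def R_def
          hs_adj.rep_eq T_graph[OF t])
  qed
  ultimately show "csmooth S (\<lambda>t. pdiff L (\<gamma> t))" by (rule csmooth_cong[rotated])
qed

lemma gap_op_projection_curve:
  assumes "\<gamma> t \<in> Lorbit J L0"
  shows "gap_op L (\<gamma> t) = of_hs (projection_curve \<gamma> t) + (proj L0 + proj L - id_blinfun)"
  using assms by (simp add: gap_op_def projection_curve_def of_hs_pdiff L0_orbit algebra_simps)

text \<open>
  Here the gap operator is smooth, being affine in the projection. Where it is invertible, its
  inverse is smooth, and the graph operator is a product of such factors, one of which is
  Hilbert-Schmidt. The chart domain is open since a lower bound for a symmetric operator persists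
  under small perturbations.
\<close>

lemma smooth_chart_if_smooth_projection:
  assumes \<gamma>: "\<And>t. t \<in> {0..1} \<Longrightarrow> \<gamma> t \<in> Lorbit J L0" and L: "L \<in> Lorbit J L0"
    and X: "csmooth {0..1} (projection_curve \<gamma>)"
  defines "D \<equiv> {t\<in>{0..1}. \<gamma> t \<in> chart_dom J L}"
  obtains k where "openin (top_of_set {0..1}) D" "csmooth D k"
    "\<And>t. t \<in> D \<Longrightarrow> k t o\<^sub>L gap_op L (\<gamma> t) = id_blinfun"
    "\<And>t. t \<in> D \<Longrightarrow> gap_op L (\<gamma> t) o\<^sub>L k t = id_blinfun"
    "\<And>t. t \<in> D \<Longrightarrow> chart J L (\<gamma> t) =
       of_hs (hs_left (J o\<^sub>L (id_blinfun - proj L)) (hs_right (pdiff L (\<gamma> t)) (k t)))"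
proof -
  note LL = orbit_Lagrangian[OF L]
  have G: "csmooth {0..1} (\<lambda>t. gap_op L (\<gamma> t))"
    by (rule csmooth_cong[where g = "\<lambda>t. of_hs (projection_curve \<gamma> t) + (proj L0 + proj L - id_blinfun)"])
       (auto simp: gap_op_projection_curve \<gamma> intro!: csmooth_add csmooth_const X csmooth_linear[OF bounded_linear_of_hs])
  have op: "openin (top_of_set {0..1}) D"
    unfolding openin_euclidean_subtopology_iff
  proof (intro conjI ballI)
    show "D \<subseteq> {0..1}" by (auto simp: D_def)
    fix t assume t: "t \<in> D"
    then have t01: "t \<in> {0..1}" and tc: "\<gamma> t \<in> chart_dom J L" by (auto simp: D_def)
    obtain k where k: "k o\<^sub>L gap_op L (\<gamma> t) = id_blinfun"
      using chart_dom_imp_gap_invertible[OF LL tc] by blast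
    obtain c where c: "c > 0" "\<And>x. c * norm x \<le> norm (gap_op L (\<gamma> t) x)"
      using invertible_bounded_below[OF k] by blast
    obtain \<delta> where \<delta>: "\<delta> > 0" "\<And>s. s \<in> {0..1} \<Longrightarrow> dist s t < \<delta> \<Longrightarrow> dist (gap_op L (\<gamma> s)) (gap_op L (\<gamma> t)) < c / 2"
      using csmooth_continuous[OF G] t01 c(1) unfolding continuous_on_iff by (meson half_gt_zero)
    have "s \<in> D" if s: "s \<in> {0..1}" "dist s t < \<delta>" for s
    proof -
      note WL = orbit_Lagrangian[OF \<gamma>[OF s(1)]]
      have "(c / 2) * norm x \<le> norm (gap_op L (\<gamma> s) x)" for x
      proof -
        let ?d = "gap_op L (\<gamma> s) - gap_op L (\<gamma> t)"
        have "norm (?d x) \<le> norm ?d * norm x" by (rule norm_blinfun)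
        also have "\<dots> \<le> c / 2 * norm x" using \<delta>(2)[OF s] by (intro mult_right_mono) (auto simp: dist_norm)
        finally have "norm (?d x) \<le> c / 2 * norm x" .
        moreover have "norm (gap_op L (\<gamma> t) x) \<le> norm (gap_op L (\<gamma> s) x) + norm (?d x)"
          using norm_triangle_ineq4[of "gap_op L (\<gamma> s) x" "?d x"] by (simp add: blinfun.diff_left)
        ultimately show ?thesis using c(2)[of x] by simp
      qed
      then obtain k' where "k' o\<^sub>L gap_op L (\<gamma> s) = id_blinfun" "gap_op L (\<gamma> s) o\<^sub>L k' = id_blinfun"
        using symmetric_bounded_below_invertible[OF adj_gap_op[OF LL WL], of "c / 2"] c(1) by auto
      then show ?thesis using gap_invertible_imp_chart_dom[OF LL WL] s(1) by (auto simp: D_def)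
    qed
    then show "\<exists>e>0. \<forall>x'\<in>{0..1}. dist x' t < e \<longrightarrow> x' \<in> D" using \<delta>(1) by blast
  qed
  have "\<exists>k. k o\<^sub>L gap_op L (\<gamma> t) = id_blinfun \<and> gap_op L (\<gamma> t) o\<^sub>L k = id_blinfun" if "t \<in> D" for t
    using chart_dom_imp_gap_invertible[OF LL] that unfolding D_def by blast
  then obtain k where k: "\<And>t. t \<in> D \<Longrightarrow> k t o\<^sub>L gap_op L (\<gamma> t) = id_blinfun"
    "\<And>t. t \<in> D \<Longrightarrow> gap_op L (\<gamma> t) o\<^sub>L k t = id_blinfun" by metis
  have ks: "csmooth D k"
    by (rule csmooth_operator_inverse[OF csmooth_subset[OF G]]) (use k in \<open>auto simp: D_def\<close>)
  have "chart J L (\<gamma> t) = of_hs (hs_left (J o\<^sub>L (id_blinfun - proj L)) (hs_right (pdiff L (\<gamma> t)) (k t)))"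
    if t: "t \<in> D" for t
  proof -
    have W: "\<gamma> t \<in> Lorbit J L0" using t \<gamma> by (auto simp: D_def)
    from graph_op_from_proj_diff[OF LL orbit_Lagrangian[OF W] k[OF t]] show ?thesis
      by (intro blinfun_eqI) (simp add: chart_def hs_left.rep_eq hs_right.rep_eq of_hs_pdiff[OF W L])
  qed
  with op ks k show ?thesis using that by blast
qed

lemma smooth_curve_iff:
  "smooth_curve J L0 \<gamma> \<longleftrightarrow>
    (\<forall>t\<in>{0..1}. \<gamma> t \<in> Lorbit J L0) \<and> csmooth {0..1} (projection_curve \<gamma>)"
proof
  assume sm: "smooth_curve J L0 \<gamma>"
  then have \<gamma>: "\<gamma> t \<in> Lorbit J L0" if "t \<in> {0..1}" for t using that by (auto simp: smooth_curve_def)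
  have "csmooth {0..1} (projection_curve \<gamma>)"
  proof (rule csmooth_local[OF no_isolated_point_Icc])
    fix t :: real assume t: "t \<in> {0..1}"
    define L where "L = \<gamma> t"
    define D where "D = {t\<in>{0..1}. \<gamma> t \<in> chart_dom J L}"
    have L: "L \<in> Lorbit J L0" using \<gamma> t by (simp add: L_def)
    have op: "openin (top_of_set {0..1}) D" and hs: "hs_smooth_on D (\<lambda>t. chart J L (\<gamma> t))"
      using sm L by (auto simp: smooth_curve_def D_def)
    obtain U where U: "open U" "D = {0..1} \<inter> U" using op by (auto simp: openin_open)
    have tD: "t \<in> D" using t self_chart(3)[OF orbit_Lagrangian[OF L]] by (simp add: D_def L_def)
    have ch: "hilbert_schmidt (chart J L (\<gamma> s))" if "s \<in> D" for s
      using hs that by (simp add: hs_smooth_on_iff[OF no_isolated_point_openin[OF op]])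
    have cs: "csmooth D (\<lambda>t. Hs (chart J L (\<gamma> t)))"
      using hs by (simp add: hs_smooth_on_iff[OF no_isolated_point_openin[OF op]])
    have "csmooth D (\<lambda>s. pdiff L (\<gamma> s))"
    proof (rule smooth_projection_if_smooth_chart(2)[OF _ L])
      show "\<gamma> s \<in> Lorbit J L0" "\<gamma> s \<in> chart_dom J L" if "s \<in> D" for s using that \<gamma> by (auto simp: D_def)
      show "csmooth D (\<lambda>s. - hs_left J (Hs (chart J L (\<gamma> s))))"
        by (intro csmooth_linear[OF bounded_linear_minus[OF bounded_linear_ident]]
            csmooth_bilinear[OF bounded_bilinear_hs_left] csmooth_const cs)
      show "of_hs (- hs_left J (Hs (chart J L (\<gamma> s)))) = graph_op L (\<gamma> s)" if "s \<in> D" for s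
        by (rule blinfun_eqI)
           (simp add: of_hs_simps hs_left.rep_eq of_hs_Hs ch[OF that] blinfun.minus_left, simp add: chart_def J_J)
    qed
    then have "csmooth D (\<lambda>s. pdiff L (\<gamma> s) + pdiff L0 L)" by (intro csmooth_add csmooth_const)
    then have "csmooth D (projection_curve \<gamma>)"
      by (rule csmooth_cong[rotated]) (auto simp: D_def intro!: projection_curve_rebase \<gamma> L)
    then show "\<exists>U. open U \<and> t \<in> U \<and> csmooth ({0..1} \<inter> U) (projection_curve \<gamma>)"
      using U tD by auto
  qed
  with \<gamma> show "(\<forall>t\<in>{0..1}. \<gamma> t \<in> Lorbit J L0) \<and> csmooth {0..1} (projection_curve \<gamma>)" by blast
next
  assume *: "(\<forall>t\<in>{0..1}. \<gamma> t \<in> Lorbit J L0) \<and> csmooth {0..1} (projection_curve \<gamma>)"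
  then have \<gamma>: "\<And>t. t \<in> {0..1} \<Longrightarrow> \<gamma> t \<in> Lorbit J L0" and X: "csmooth {0..1} (projection_curve \<gamma>)" by auto
  have "openin (top_of_set {0..1}) D \<and> hs_smooth_on D (\<lambda>t. chart J L (\<gamma> t))"
    if L: "L \<in> Lorbit J L0" and D: "D = {t\<in>{0..1}. \<gamma> t \<in> chart_dom J L}" for L D
  proof -
    obtain k where k: "openin (top_of_set {0..1}) D" "csmooth D k"
      "\<And>t. t \<in> D \<Longrightarrow> chart J L (\<gamma> t) =
         of_hs (hs_left (J o\<^sub>L (id_blinfun - proj L)) (hs_right (pdiff L (\<gamma> t)) (k t)))"
      by (rule smooth_chart_if_smooth_projection[OF \<gamma> L X, folded D]) blast+
    have sub: "D \<subseteq> {0..1}" by (auto simp: D)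
    have "csmooth D (\<lambda>t. projection_curve \<gamma> t - pdiff L0 L)"
      by (intro csmooth_diff csmooth_const csmooth_subset[OF X sub])
    then have "csmooth D (\<lambda>t. pdiff L (\<gamma> t))"
      by (rule csmooth_cong[rotated]) (use sub \<gamma> L in \<open>auto simp: projection_curve_rebase subset_iff\<close>)
    then have "csmooth D (\<lambda>t. hs_left (J o\<^sub>L (id_blinfun - proj L)) (hs_right (pdiff L (\<gamma> t)) (k t)))"
      by (intro csmooth_bilinear[OF bounded_bilinear_hs_right] csmooth_bilinear[OF bounded_bilinear_hs_left]
          csmooth_const k(2))
    then have "csmooth D (\<lambda>t. Hs (chart J L (\<gamma> t)))"
      by (rule csmooth_cong[rotated]) (simp add: k(3) of_hs_inverse)
    then show ?thesis using k(1,3) by (simp add: hs_smooth_on_iff[OF no_isolated_point_openin[OF k(1)]])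
  qed
  then show "smooth_curve J L0 \<gamma>" using \<gamma> by (simp add: smooth_curve_def)
qed

end

context lagrangian_orbit
begin

section \<open>The ambient length as a length in the Hilbert space\<close>

lemma vector_derivative_unique_Icc:
  "t \<in> {0..1} \<Longrightarrow> (f has_vector_derivative v) (at t within {0..1}) \<Longrightarrow>
    (f has_vector_derivative w) (at t within {0..1}) \<Longrightarrow> v = w"
  using vector_derivative_Icc by blast

text \<open>
  Differentiate the three identities \<open>P\<^sup>* = P\<close>, \<open>P P = P\<close> and \<open>P J = J - J P\<close>.
\<close>

lemma projection_derivative:
  assumes \<gamma>: "\<And>s. s \<in> {0..1} \<Longrightarrow> \<gamma> s \<in> Lorbit J L0" and t: "t \<in> {0..1}"
    and X': "(projection_curve \<gamma> has_vector_derivative X') (at t within {0..1})"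
  defines "E \<equiv> proj (\<gamma> t)" and "Y \<equiv> of_hs X'"
  shows "adj Y = Y" "Y x = E (Y x) + Y (E x)" "Y (J x) = - J (Y x)"
proof -
  have "((\<lambda>s. of_hs (projection_curve \<gamma> s) + proj L0) has_vector_derivative Y + 0) (at t within {0..1})"
    unfolding Y_def
    by (intro has_vector_derivative_add bounded_linear.has_vector_derivative[OF bounded_linear_of_hs X'] has_vector_derivative_const)
  then have "((\<lambda>s. of_hs (projection_curve \<gamma> s) + proj L0) has_vector_derivative Y) (at t within {0..1})"
    by simp
  then have dP: "((\<lambda>s. proj (\<gamma> s)) has_vector_derivative Y) (at t within {0..1})"
    by (rule has_vector_derivative_transform[OF t, rotated])
       (simp add: projection_curve_def of_hs_pdiff \<gamma> L0_orbit)
  note LD = LagrangianD[OF orbit_Lagrangian[OF \<gamma>]]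
  show "adj Y = Y"
  proof (rule vector_derivative_unique_Icc[OF t _ dP])
    show "((\<lambda>s. proj (\<gamma> s)) has_vector_derivative adj Y) (at t within {0..1})"
      by (rule has_vector_derivative_transform[OF t _ bounded_linear.has_vector_derivative[OF bounded_linear_adj dP]])
         (simp add: adj_proj LD)
  qed
  have "(E o\<^sub>L Y) + (Y o\<^sub>L E) = Y"
  proof (rule vector_derivative_unique_Icc[OF t _ dP])
    show "((\<lambda>s. proj (\<gamma> s)) has_vector_derivative (E o\<^sub>L Y) + (Y o\<^sub>L E)) (at t within {0..1})"
      unfolding E_def
      by (rule has_vector_derivative_transform[OF t _
            bounded_bilinear.has_vector_derivative[OF bounded_bilinear_blinfun_compose dP dP]])
         (rule blinfun_eqI, simp add: proj_idem LD)
  qed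
  then show "Y x = E (Y x) + Y (E x)" by (metis blinfun.add_left blinfun_apply_blinfun_compose)
  have "(proj (\<gamma> t) o\<^sub>L 0) + (Y o\<^sub>L J) = 0 - ((J o\<^sub>L Y) + (0 o\<^sub>L proj (\<gamma> t)))"
  proof (rule vector_derivative_unique_Icc[OF t])
    show "((\<lambda>s. proj (\<gamma> s) o\<^sub>L J) has_vector_derivative (proj (\<gamma> t) o\<^sub>L 0) + (Y o\<^sub>L J)) (at t within {0..1})"
      by (rule bounded_bilinear.has_vector_derivative[OF bounded_bilinear_blinfun_compose dP has_vector_derivative_const])
    have "((\<lambda>s. J - (J o\<^sub>L proj (\<gamma> s))) has_vector_derivative 0 - ((J o\<^sub>L Y) + (0 o\<^sub>L proj (\<gamma> t)))) (at t within {0..1})"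
      by (intro has_vector_derivative_diff has_vector_derivative_const
          bounded_bilinear.has_vector_derivative[OF bounded_bilinear_blinfun_compose _ dP])
    then show "((\<lambda>s. proj (\<gamma> s) o\<^sub>L J) has_vector_derivative 0 - ((J o\<^sub>L Y) + (0 o\<^sub>L proj (\<gamma> t)))) (at t within {0..1})"
      by (rule has_vector_derivative_transform[OF t, rotated])
         (rule blinfun_eqI, simp add: proj_J orbit_Lagrangian \<gamma> blinfun.diff_left)
  qed
  then have "Y o\<^sub>L J = - (J o\<^sub>L Y)" by simp
  then show "Y (J x) = - J (Y x)" by (metis blinfun.minus_left blinfun_apply_blinfun_compose)
qed

text \<open>
  With \<open>Y\<close> the derivative of the projections at \<open>L\<close> and \<open>E = proj L\<close>, the velocity in the chart
  centred at \<open>L\<close> is \<open>J Y E\<close>. As \<open>Y = Y E + E Y\<close> is an orthogonal sum of mutually adjoint operators,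
  the ambient norm is \<open>1 / sqrt 2\<close> times the Hilbert-Schmidt norm of \<open>Y\<close>.
\<close>

lemma ambient_speed:
  assumes sm: "smooth_curve J L0 \<gamma>" and t: "t \<in> {0..1}"
  shows "ambient_metric (\<gamma> t) (velocity J \<gamma> t) =
    norm (vector_derivative (projection_curve \<gamma>) (at t within {0..1})) / sqrt 2"
proof -
  have \<gamma>: "\<gamma> s \<in> Lorbit J L0" if "s \<in> {0..1}" for s using sm that by (simp add: smooth_curve_iff)
  have X: "csmooth {0..1} (projection_curve \<gamma>)" using sm by (simp add: smooth_curve_iff)
  define X' where "X' = vector_derivative (projection_curve \<gamma>) (at t within {0..1})"
  have dX: "(projection_curve \<gamma> has_vector_derivative X') (at t within {0..1})"
    unfolding X'_def by (rule csmooth_derivative(1)[OF no_isolated_point_Icc X t])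
  define L where "L = \<gamma> t"
  have L: "L \<in> Lorbit J L0" using \<gamma> t by (simp add: L_def)
  note LL = orbit_Lagrangian[OF L] and L' = LagrangianD[OF orbit_Lagrangian[OF L]]
  define E where "E = proj L"
  define Y where "Y = of_hs X'"
  have Y: "adj Y = Y" "\<And>x. Y x = E (Y x) + Y (E x)" "\<And>x. Y (J x) = - J (Y x)"
    unfolding Y_def E_def L_def by (rule projection_derivative[OF \<gamma> t dX]; assumption)+
  have EE: "E (E x) = E x" for x by (simp add: E_def proj_idem L')
  have adjE: "adj E = E" by (simp add: E_def adj_proj L')
  have EYE: "E (Y (E x)) = 0" for x using Y(2)[of "E x"] by (simp add: EE)
  define D where "D = {s\<in>{0..1}. \<gamma> s \<in> chart_dom J L}"
  obtain k where D: "openin (top_of_set {0..1}) D" and k: "csmooth D k"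
    "\<And>s. s \<in> D \<Longrightarrow> k s o\<^sub>L gap_op L (\<gamma> s) = id_blinfun"
    "\<And>s. s \<in> D \<Longrightarrow> gap_op L (\<gamma> s) o\<^sub>L k s = id_blinfun"
    "\<And>s. s \<in> D \<Longrightarrow> chart J L (\<gamma> s) =
       of_hs (hs_left (J o\<^sub>L (id_blinfun - proj L)) (hs_right (pdiff L (\<gamma> s)) (k s)))"
    using smooth_chart_if_smooth_projection[OF \<gamma> L X] unfolding D_def by blast
  have nD: "no_isolated_point D" by (rule no_isolated_point_openin[OF D])
  have tD: "t \<in> D" using t self_chart(3)[OF LL] by (simp add: D_def L_def)
  have sub: "D \<subseteq> {0..1}" by (auto simp: D_def)
  define Z where "Z = hs_right X' E"
  have ofZ: "of_hs Z = Y o\<^sub>L E" by (simp add: Z_def hs_right.rep_eq Y_def)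
  define v where "v = hs_left J Z"
  have ofv: "of_hs v x = J (Y (E x))" for x by (simp add: v_def hs_left.rep_eq ofZ)
  have kt: "k t o\<^sub>L gap_op L L = id_blinfun" using k(2)[OF tD] by (simp add: L_def)
  have "E (k t x) = E x" for x
  proof -
    define R where "R = 2 *\<^sub>R proj L - id_blinfun"
    have "k t (R (R x)) = R x" using kt self_chart(1)[OF LL]
      by (metis R_def blinfun_apply_blinfun_compose blinfun_apply_id_blinfun)
    moreover have "R (R x) = x" using self_chart(2)[OF LL]
      by (metis R_def blinfun_apply_blinfun_compose blinfun_apply_id_blinfun)
    ultimately show ?thesis by (simp add: R_def E_def blinfun.bilinear_simps proj_idem L' scaleR_2)
  qed
  \<comment> \<open>At the centre of the chart, the factor \<open>k\<close> of the graph operator is the reflection \<open>2 E - 1\<close>,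
     which disappears because \<open>(1 - E) Y = (1 - E) Y E\<close>.\<close>
  then have v_eq: "hs_left (J o\<^sub>L (id_blinfun - proj L)) (hs_right X' (k t)) = v"
    by (intro of_hs_eqI blinfun_eqI)
       (simp add: hs_left.rep_eq hs_right.rep_eq ofv blinfun.bilinear_simps Y_def[symmetric] E_def[symmetric],
        metis Y(2) add_diff_cancel_left' blinfun.diff_right)
  have dv: "((\<lambda>s. Hs (chart J L (\<gamma> s))) has_vector_derivative v) (at t within D)"
  proof -
    have "((\<lambda>s. projection_curve \<gamma> s - pdiff L0 L) has_vector_derivative X' - 0) (at t within D)"
      by (intro has_vector_derivative_diff has_vector_derivative_const has_vector_derivative_within_subset[OF dX sub])
    then have "((\<lambda>s. projection_curve \<gamma> s - pdiff L0 L) has_vector_derivative X') (at t within D)" by simp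
    then have "((\<lambda>s. pdiff L (\<gamma> s)) has_vector_derivative X') (at t within D)"
      by (rule has_vector_derivative_transform[OF tD, rotated])
         (use sub \<gamma> L in \<open>auto simp: projection_curve_rebase subset_iff\<close>)
    moreover obtain k' where "(k has_vector_derivative k') (at t within D)"
      using csmooth_derivative(1)[OF nD k(1) tD] by blast
    ultimately have "((\<lambda>s. hs_left (J o\<^sub>L (id_blinfun - proj L)) (hs_right (pdiff L (\<gamma> s)) (k s))) has_vector_derivative
        hs_left (J o\<^sub>L (id_blinfun - proj L)) (hs_right (pdiff L (\<gamma> t)) k' + hs_right X' (k t))) (at t within D)"
      by (intro bounded_linear.has_vector_derivative[OF bounded_bilinear.bounded_linear_right[OF bounded_bilinear_hs_left]]
          bounded_bilinear.has_vector_derivative[OF bounded_bilinear_hs_right])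
    also have "pdiff L (\<gamma> t) = 0" by (simp add: pdiff_def L_def zero_hs_def)
    also have "hs_left (J o\<^sub>L (id_blinfun - proj L)) (hs_right 0 k' + hs_right X' (k t)) = v"
      by (simp add: bounded_bilinear.zero_left[OF bounded_bilinear_hs_right] v_eq)
    finally show ?thesis
      by (rule has_vector_derivative_transform[OF tD, rotated]) (simp add: k(4) of_hs_inverse)
  qed
  have "velocity J \<gamma> t = of_hs v"
    unfolding velocity_def L_def[symmetric] D_def[symmetric]
  proof (rule the_equality, intro conjI)
    have "proj L o\<^sub>L of_hs v o\<^sub>L proj L = of_hs v"
      by (rule blinfun_eqI)
         (simp add: ofv E_def[symmetric] EE, simp add: E_def proj_J[OF LL], simp add: E_def[symmetric] EYE blinfun.zero_right)
    moreover have "adj (of_hs v) = of_hs v"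
    proof (rule adj_eqI)
      fix x y
      have "of_hs v x \<bullet> y = - (Y (E x) \<bullet> J y)" by (simp add: ofv J_inner)
      also have "Y (E x) \<bullet> J y = x \<bullet> E (Y (J y))" by (metis adj_inner(2) Y(1) adjE inner_commute)
      also have "- (x \<bullet> E (Y (J y))) = x \<bullet> (J (Y y) - J (E (Y y)))"
        by (simp add: Y(3) blinfun.minus_right E_def proj_J[OF LL] inner_diff_right)
      also have "J (Y y) - J (E (Y y)) = J (Y (E y))"
        by (metis Y(2) add_diff_cancel_left' blinfun.diff_right)
      finally show "of_hs v x \<bullet> y = x \<bullet> of_hs v y" by (simp add: ofv)
    qed
    ultimately show "of_hs v \<in> sym_hs L" by (simp add: sym_hs_def)
    show "has_hs_derivative (\<lambda>s. chart J L (\<gamma> s)) (of_hs v) t D"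
      using dv k(4) by (simp add: has_hs_derivative_iff[OF tD] of_hs_inverse)
    fix w assume "w \<in> sym_hs L \<and> has_hs_derivative (\<lambda>s. chart J L (\<gamma> s)) w t D"
    then have "hilbert_schmidt w" "((\<lambda>s. Hs (chart J L (\<gamma> s))) has_vector_derivative Hs w) (at t within D)"
      by (auto simp: has_hs_derivative_iff[OF tD])
    then have "Hs w = v" using dv tD nD vector_derivative_within unfolding no_isolated_point_def by metis
    then show "w = of_hs v" using \<open>hilbert_schmidt w\<close> by (auto simp: of_hs_Hs)
  qed
  moreover have "of_hs v o\<^sub>L proj L = of_hs v"
    by (rule blinfun_eqI) (simp add: ofv E_def[symmetric] EE)
  ultimately have 1: "ambient_metric (\<gamma> t) (velocity J \<gamma> t) = norm v"
    by (simp add: ambient_metric_def L_def[symmetric] norm_hs_eq)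
  have 2: "norm v = norm Z"
    by (simp add: norm_eq_sqrt_inner inner_hs_def v_def hs_left.rep_eq J_inner_J)
  have of_adjZ: "of_hs (hs_adj Z) = E o\<^sub>L Y" by (simp add: hs_adj.rep_eq ofZ adj_compose adjE Y(1))
  have "X' = Z + hs_adj Z"
    by (rule of_hs_eqI, rule blinfun_eqI)
       (simp add: of_hs_simps of_adjZ, simp add: ofZ blinfun.add_left Y_def[symmetric], metis Y(2) add.commute)
  moreover have "inner Z (hs_adj Z) = 0"
  proof -
    have "of_hs Z e \<bullet> of_hs (hs_adj Z) e = 0" for e
      using adj_inner(1)[of "Y (E e)" E "Y e"] by (simp add: ofZ of_adjZ adjE EYE)
    then show ?thesis by (simp add: inner_hs_def)
  qed
  ultimately have "(norm X')\<^sup>2 = (norm Z)\<^sup>2 + (norm (hs_adj Z))\<^sup>2"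
    by (simp add: power2_norm_eq_inner inner_add_left inner_add_right inner_commute)
  then have "(norm X')\<^sup>2 = (sqrt 2 * norm Z)\<^sup>2" by (simp add: norm_hs_adj power_mult_distrib)
  then have "norm X' = sqrt 2 * norm Z" by (metis abs_of_nonneg mult_nonneg_nonneg norm_ge_zero power2_eq_iff_nonneg real_sqrt_ge_zero zero_le_numeral)
  then show ?thesis using 1 2 by (simp add: X'_def)
qed

lemma ambient_length_eq:
  assumes "smooth_curve J L0 \<gamma>"
  shows "ambient_length J \<gamma> = curve_length (projection_curve \<gamma>) / sqrt 2"
  unfolding ambient_length_def curve_length_def integral_divide[symmetric]
  by (rule integral_cong) (rule ambient_speed[OF assms])

end

context lagrangian_orbit
begin

lemma ambient_length_nonneg: "smooth_curve J L0 \<gamma> \<Longrightarrow> ambient_length J \<gamma> \<ge> 0"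
  by (simp add: ambient_length_eq curve_length_nonneg)

lemma ambient_length_le: "smooth_curve J L0 \<gamma> \<Longrightarrow> ambient_length J \<gamma> \<le> curve_length (projection_curve \<gamma>)"
proof -
  assume "smooth_curve J L0 \<gamma>"
  moreover have "curve_length (projection_curve \<gamma>) / sqrt 2 \<le> curve_length (projection_curve \<gamma>) / 1"
    by (intro divide_left_mono curve_length_nonneg) auto
  ultimately show ?thesis by (simp add: ambient_length_eq)
qed

lemma projection_chord_le_ambient_length:
  assumes sm: "smooth_curve J L0 \<gamma>"
  shows "norm (pdiff (\<gamma> 0) (\<gamma> 1)) \<le> sqrt 2 * ambient_length J \<gamma>"
proof -
  have \<gamma>: "\<gamma> 0 \<in> Lorbit J L0" "\<gamma> 1 \<in> Lorbit J L0" and X: "csmooth {0..1} (projection_curve \<gamma>)"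
    using sm by (auto simp: smooth_curve_iff)
  have "pdiff (\<gamma> 0) (\<gamma> 1) = projection_curve \<gamma> 1 - projection_curve \<gamma> 0"
    using \<gamma> L0_orbit by (intro of_hs_eqI) (simp add: of_hs_simps of_hs_pdiff projection_curve_def)
  then have "norm (pdiff (\<gamma> 0) (\<gamma> 1)) \<le> curve_length (projection_curve \<gamma>)"
    using chord_le_curve_length[OF X] by simp
  then show ?thesis using ambient_length_eq[OF sm] by simp
qed

text \<open>
  Stating reversal and concatenation for bounds on lengths, instead of infima, keeps them meaningful
  before it is known that any two points of the orbit are joined by a curve.
\<close>

definition joined :: "'a set \<Rightarrow> 'a set \<Rightarrow> real \<Rightarrow> bool" where
  "joined S T l \<longleftrightarrow> (\<exists>\<gamma>. smooth_curve J L0 \<gamma> \<and> \<gamma> 0 = S \<and> \<gamma> 1 = T \<and> ambient_length J \<gamma> \<le> l)"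

lemma joined_mono: "joined S T l \<Longrightarrow> l \<le> m \<Longrightarrow> joined S T m"
  unfolding joined_def by (blast intro: order_trans)

lemma joined_refl:
  assumes "S \<in> Lorbit J L0"
  shows "joined S S 0"
proof -
  have s: "csmooth {0..1} (projection_curve (\<lambda>t. S))" by (simp add: projection_curve_def[abs_def] csmooth_const)
  then have sm: "smooth_curve J L0 (\<lambda>t. S)" using assms by (simp add: smooth_curve_iff)
  have "curve_length (projection_curve (\<lambda>t. S)) \<le> 0"
    by (rule curve_length_le[OF s, where g = "\<lambda>t. 0" and X' = "\<lambda>t. 0"])
       (auto simp: projection_curve_def[abs_def])
  then have "ambient_length J (\<lambda>t. S) \<le> 0" using ambient_length_le[OF sm] by simp
  then show ?thesis using sm unfolding joined_def by blast
qed

lemma joined_sym: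
  assumes "joined S T l"
  shows "joined T S l"
proof -
  obtain \<gamma> where sm: "smooth_curve J L0 \<gamma>" and e: "\<gamma> 0 = S" "\<gamma> 1 = T" "ambient_length J \<gamma> \<le> l"
    using assms by (auto simp: joined_def)
  have X: "csmooth {0..1} (projection_curve \<gamma>)" using sm by (simp add: smooth_curve_iff)
  define \<delta> where "\<delta> t = \<gamma> (1 - t)" for t
  have eq: "projection_curve \<delta> = (\<lambda>t. projection_curve \<gamma> (1 - t))"
    by (simp add: projection_curve_def[abs_def] \<delta>_def)
  have sm': "smooth_curve J L0 \<delta>"
    using sm reversed_curve(1)[OF X] by (simp add: smooth_curve_iff eq) (simp add: \<delta>_def)
  have "ambient_length J \<delta> \<le> ambient_length J \<gamma>"
    using reversed_curve(2)[OF X] by (simp add: ambient_length_eq sm sm' eq divide_right_mono)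
  then show ?thesis using sm' e unfolding joined_def by (intro exI[of _ \<delta>]) (simp add: \<delta>_def)
qed

lemma joined_trans:
  assumes "joined S T l" "joined T U m"
  shows "joined S U (l + m)"
proof -
  obtain \<gamma> where \<gamma>: "smooth_curve J L0 \<gamma>" "\<gamma> 0 = S" "\<gamma> 1 = T" "ambient_length J \<gamma> \<le> l"
    using assms by (auto simp: joined_def)
  obtain \<delta> where \<delta>: "smooth_curve J L0 \<delta>" "\<delta> 0 = T" "\<delta> 1 = U" "ambient_length J \<delta> \<le> m"
    using assms by (auto simp: joined_def)
  have X: "csmooth {0..1} (projection_curve \<gamma>)" and Y: "csmooth {0..1} (projection_curve \<delta>)"
    using \<gamma>(1) \<delta>(1) by (auto simp: smooth_curve_iff)
  have "projection_curve \<gamma> 1 = projection_curve \<delta> 0" by (simp add: projection_curve_def \<gamma> \<delta>)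
  from concatenated_curve[OF X Y this] obtain a b :: "real \<Rightarrow> real" and Z where Z: "csmooth {0..1} Z"
    "curve_length Z \<le> curve_length (projection_curve \<gamma>) + curve_length (projection_curve \<delta>)"
    "\<And>t. a t \<in> {0..1}" "\<And>t. b t \<in> {0..1}" "a 0 = 0" "b 1 = 1"
    "\<And>t. Z t = (if t \<le> 1/2 then projection_curve \<gamma> (a t) else projection_curve \<delta> (b t))"
    by metis
  define \<epsilon> where "\<epsilon> t = (if t \<le> 1/2 then \<gamma> (a t) else \<delta> (b t))" for t
  have eq: "projection_curve \<epsilon> = Z" by (rule ext) (simp add: Z(7) projection_curve_def \<epsilon>_def)
  have "\<epsilon> t \<in> Lorbit J L0" for t using \<gamma>(1) \<delta>(1) Z(3,4) by (simp only: smooth_curve_iff \<epsilon>_def split: if_split) blast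
  then have sm: "smooth_curve J L0 \<epsilon>" using Z(1) by (simp add: smooth_curve_iff eq)
  have "ambient_length J \<epsilon> \<le> ambient_length J \<gamma> + ambient_length J \<delta>"
    using Z(2) by (simp add: ambient_length_eq sm \<gamma> \<delta> eq divide_right_mono flip: add_divide_distrib)
  moreover have "\<epsilon> 0 = S" "\<epsilon> 1 = U" by (simp_all add: \<epsilon>_def \<gamma> \<delta> Z)
  ultimately show ?thesis using sm \<gamma>(4) \<delta>(4) unfolding joined_def by (intro exI[of _ \<epsilon>]) auto
qed

section \<open>Joining nearby points by shears\<close>

text \<open>
  Along \<open>t \<mapsto> graph_of L (t T)\<close> the inverse of the gap operator is affine in \<open>t\<close> with slope \<open>T + T\<^sup>*\<close>,
  and the gap operators have norm at most \<open>3\<close>; hence the bound on the speed.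
\<close>

lemma joined_by_shear:
  assumes L: "L \<in> Lorbit J L0" and T: "shear_generator L T"
  shows "joined L (graph_of L T) (18 * hs_norm T)"
proof -
  note LL = orbit_Lagrangian[OF L]
  define \<gamma> where "\<gamma> t = graph_of L (t *\<^sub>R T)" for t
  have sg: "shear_generator L (t *\<^sub>R T)" for t by (rule shear_generator_scaleR[OF T])
  have \<gamma>: "\<gamma> t \<in> Lorbit J L0" "\<gamma> t \<in> chart_dom J L" "graph_op L (\<gamma> t) = t *\<^sub>R T" for t
    unfolding \<gamma>_def using graph_of_orbit[OF L sg] graph_of_chart[OF LL sg] by auto
  have hT: "hilbert_schmidt T" using T by (simp add: shear_generator_def)
  have smT: "csmooth {0..1} (\<lambda>t. t *\<^sub>R Hs T)" by (intro csmooth_scaleR csmooth_ident csmooth_const)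
  have graph: "of_hs (t *\<^sub>R Hs T) = graph_op L (\<gamma> t)" for t by (simp add: of_hs_simps of_hs_Hs hT \<gamma>)
  have G: "csmooth {0..1} (\<lambda>t. gap_op L (\<gamma> t))" and P: "csmooth {0..1} (\<lambda>t. pdiff L (\<gamma> t))"
    using smooth_projection_if_smooth_chart[OF \<gamma>(1) L \<gamma>(2) smT graph] by auto
  have pc: "projection_curve \<gamma> t = pdiff L (\<gamma> t) + pdiff L0 L" for t by (rule projection_curve_rebase[OF \<gamma>(1) L])
  have X: "csmooth {0..1} (projection_curve \<gamma>)"
    by (rule csmooth_cong[OF pc]) (intro csmooth_add csmooth_const P)
  have sm: "smooth_curve J L0 \<gamma>" using X \<gamma> by (simp add: smooth_curve_iff)
  define Y where "Y = Hs T + hs_adj (Hs T)"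
  define X' where "X' t = - hs_left (gap_op L (\<gamma> t)) (hs_right Y (gap_op L (\<gamma> t)))" for t
  \<comment> \<open>Resolvent identity for the gap operators at times \<open>s\<close> and \<open>t\<close>.\<close>
  have diff: "projection_curve \<gamma> s - projection_curve \<gamma> t =
      (s - t) *\<^sub>R (- hs_left (gap_op L (\<gamma> s)) (hs_right Y (gap_op L (\<gamma> t))))" for s t
  proof (rule of_hs_eqI, rule blinfun_eqI)
    fix x
    let ?G = "\<lambda>t. gap_op L (\<gamma> t)"
    define K where "K t = 2 *\<^sub>R proj L - id_blinfun + t *\<^sub>R (T + adj T)" for t
    have inv: "K u (?G u y) = y" "?G u (K u y) = y" for u y
    proof -
      obtain k where k: "k o\<^sub>L ?G u = id_blinfun" "?G u o\<^sub>L k = id_blinfun"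
        using chart_dom_imp_gap_invertible[OF LL \<gamma>(2)] by blast
      have "k = K u" using gap_inverse_eq[OF LL orbit_Lagrangian[OF \<gamma>(1)] k]
        by (simp add: K_def \<gamma>(3) adj_scaleR scaleR_add_right)
      then show "K u (?G u y) = y" "?G u (K u y) = y"
        using gap_inverse_apply[OF LL orbit_Lagrangian[OF \<gamma>(1)] k] by auto
    qed
    have "?G s x - ?G t x = ?G s (K t (?G t x)) - ?G s (K s (?G t x))" by (simp add: inv)
    also have "\<dots> = ?G s ((K t - K s) (?G t x))" by (simp add: blinfun.diff_right blinfun.diff_left)
    also have "K t - K s = (t - s) *\<^sub>R (T + adj T)" by (simp add: K_def scaleR_diff_left)
    finally have 1: "?G s x - ?G t x = (t - s) *\<^sub>R ?G s ((T + adj T) (?G t x))"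
      by (simp add: blinfun.scaleR_left blinfun.scaleR_right)
    have 2: "of_hs (projection_curve \<gamma> s - projection_curve \<gamma> t) x = ?G s x - ?G t x"
      by (simp add: of_hs_simps projection_curve_def of_hs_pdiff \<gamma> L0_orbit gap_op_apply blinfun.diff_left)
    have 3: "of_hs Y = T + adj T" by (simp add: Y_def of_hs_simps hs_adj.rep_eq of_hs_Hs hT)
    have "of_hs ((s - t) *\<^sub>R (- hs_left (?G s) (hs_right Y (?G t)))) x
        = - ((s - t) *\<^sub>R ?G s ((T + adj T) (?G t x)))"
      by (simp add: of_hs_simps hs_left.rep_eq hs_right.rep_eq 3 blinfun.scaleR_left blinfun.minus_left)
    also have "\<dots> = (t - s) *\<^sub>R ?G s ((T + adj T) (?G t x))" by (simp flip: scaleR_minus_left)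
    finally show "of_hs (projection_curve \<gamma> s - projection_curve \<gamma> t) x
        = of_hs ((s - t) *\<^sub>R (- hs_left (?G s) (hs_right Y (?G t)))) x" unfolding 2 1 by simp
  qed
  have "curve_length (projection_curve \<gamma>) \<le> 18 * hs_norm T"
  proof (rule curve_length_le[OF X, where X' = X' and g = "\<lambda>t. 18 * hs_norm T"])
    show "((\<lambda>t::real. 18 * hs_norm T) has_integral 18 * hs_norm T) {0..1}"
      using has_integral_const_real[of "18 * hs_norm T" 0 1] by simp
    fix t :: real assume t: "t \<in> {0..1}"
    show "(projection_curve \<gamma> has_vector_derivative X' t) (at t within {0..1})"
      unfolding has_vector_derivative_iff_tendsto
    proof (rule Lim_transform_eventually)
      show "((\<lambda>s. - hs_left (gap_op L (\<gamma> s)) (hs_right Y (gap_op L (\<gamma> t)))) \<longlongrightarrow> X' t) (at t within {0..1})"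
        unfolding X'_def using csmooth_continuous[OF G] t
        by (intro tendsto_minus bounded_bilinear.tendsto[OF bounded_bilinear_hs_left] tendsto_const)
           (auto simp: continuous_on)
      show "\<forall>\<^sub>F s in at t within {0..1}. - hs_left (gap_op L (\<gamma> s)) (hs_right Y (gap_op L (\<gamma> t)))
          = (projection_curve \<gamma> s - projection_curve \<gamma> t) /\<^sub>R (s - t)"
        unfolding diff by (simp add: eventually_at_filter)
    qed
    let ?g = "gap_op L (\<gamma> t)"
    have g3: "norm ?g \<le> 3" by (rule norm_gap_op_le[OF LL orbit_Lagrangian[OF \<gamma>(1)]])
    have "norm Y \<le> norm (Hs T) + norm (hs_adj (Hs T))" unfolding Y_def by (rule norm_triangle_ineq)
    then have Y2: "norm Y \<le> 2 * hs_norm T" by (simp add: norm_hs_adj hs_norm_eq_norm_Hs hT)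
    have "norm (X' t) \<le> norm ?g * (norm Y * norm ?g)"
      unfolding X'_def norm_minus_cancel
      by (intro order_trans[OF norm_hs_left_le] mult_left_mono norm_hs_right_le norm_ge_zero)
    also have "\<dots> \<le> 3 * ((2 * hs_norm T) * 3)" using g3 Y2 by (intro mult_mono) (auto simp: hs_norm_eq_norm_Hs hT)
    finally show "norm (X' t) \<le> 18 * hs_norm T" by simp
  qed
  then have "ambient_length J \<gamma> \<le> 18 * hs_norm T" using ambient_length_le[OF sm] by simp
  moreover have "\<gamma> 0 = L" by (simp add: \<gamma>_def graph_of_def)
  ultimately show ?thesis using sm unfolding joined_def by (intro exI[of _ \<gamma>]) (simp add: \<gamma>_def)
qed

text \<open>
  The graph operator of \<open>W\<close> over \<open>L\<close> is the product of \<open>1 - proj L\<close>, the difference of the projections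
  and the inverse of the gap operator, so the lower bound \<open>c\<close> controls its Hilbert-Schmidt norm. That
  \<open>W\<close> belongs to the orbit is a conclusion, for use with limits of sequences in the orbit.
\<close>

lemma gap_bounded_below_joined:
  assumes L: "L \<in> Lorbit J L0" and W: "W \<in> Lagrangians J" and hs: "hilbert_schmidt (proj W - proj L)"
    and c: "c > 0" "\<And>x. c * norm x \<le> norm (gap_op L W x)"
  shows "W \<in> Lorbit J L0" "joined L W ((36 / c) * hs_norm (proj W - proj L))"
proof -
  note LL = orbit_Lagrangian[OF L]
  let ?A = "proj W - proj L"
  obtain k where k: "k o\<^sub>L gap_op L W = id_blinfun" "gap_op L W o\<^sub>L k = id_blinfun"
    using symmetric_bounded_below_invertible[OF adj_gap_op[OF LL W] c] by blast
  let ?T = "graph_op L W"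
  have eq: "?T = (id_blinfun - proj L) o\<^sub>L ?A o\<^sub>L k" by (rule graph_op_from_proj_diff[OF LL W k])
  note gp = graph_op_properties[OF LL W k]
  have "hilbert_schmidt ?T" unfolding eq
    by (rule hilbert_schmidt_compose_right(1)[OF hilbert_schmidt_compose_left(1)[OF hs]])
  then have sg: "shear_generator L ?T"
    unfolding shear_generator_def using gp graph_op_sym[OF LL W k] by blast
  have gW: "graph_of L ?T = W" using gp(4) by (simp add: graph_of_def)
  show "W \<in> Lorbit J L0" using graph_of_orbit[OF L sg] gW by simp
  have "norm k \<le> 1 / c"
    by (rule norm_blinfun_bound) (use c(1) c(2)[of "k _"] gap_inverse_apply(2)[OF LL W k] in \<open>auto simp: field_simps\<close>)
  moreover have "norm (id_blinfun - proj L) \<le> 1 + 1"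
    using norm_triangle_ineq4[of id_blinfun "proj L"] norm_proj_le(2)[OF LagrangianD(1,2)[OF LL]]
      norm_blinfun_id_le[where 'a = 'a] by linarith
  moreover have "hs_norm ?T \<le> (norm (id_blinfun - proj L) * hs_norm ?A) * norm k"
    unfolding eq
    by (meson hilbert_schmidt_compose_left hilbert_schmidt_compose_right hs mult_right_mono norm_ge_zero order_trans)
  moreover have "hs_norm ?A \<ge> 0" by (simp add: hs_norm_eq_norm_Hs hs)
  ultimately have "hs_norm ?T \<le> ((1 + 1) * hs_norm ?A) * (1 / c)"
    by (smt (verit, best) c(1) divide_nonneg_nonneg mult_mono mult_nonneg_nonneg norm_ge_zero)
  from mult_left_mono[OF this, of 18] have "18 * hs_norm ?T \<le> (36 / c) * hs_norm ?A" by (simp add: mult_ac)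
  moreover have "joined L W (18 * hs_norm ?T)" using joined_by_shear[OF L sg] gW by simp
  ultimately show "joined L W ((36 / c) * hs_norm ?A)" by (rule joined_mono[rotated])
qed

text \<open>
  The gap operator is the reflection \<open>2 * proj L - 1\<close>, an isometry, perturbed by the difference of the
  projections.
\<close>

lemma gap_bounded_below:
  assumes L: "L \<in> Lagrangians J" and A: "\<And>x. norm ((proj W - proj L) x) \<le> r * norm x"
  shows "(1 - r) * norm x \<le> norm (gap_op L W x)"
proof -
  define R where "R = 2 *\<^sub>R proj L - id_blinfun"
  note idem = proj_idem[OF LagrangianD(1,2)[OF L]]
  have "R x \<bullet> R x = x \<bullet> x"
  proof -
    have "proj L x \<bullet> proj L x = proj L x \<bullet> x" using proj_sym[OF LagrangianD(1,2)[OF L], of x "proj L x"]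
      by (simp add: idem inner_commute)
    then show ?thesis
      by (simp add: R_def blinfun.bilinear_simps inner_diff_left inner_diff_right inner_commute)
  qed
  then have "norm (R x) = norm x" by (simp add: norm_eq_sqrt_inner)
  moreover have "gap_op L W x = R x + (proj W - proj L) x"
    by (simp add: gap_op_apply R_def blinfun.bilinear_simps scaleR_2)
  moreover have "norm (R x) \<le> norm (R x + (proj W - proj L) x) + norm ((proj W - proj L) x)"
    using norm_triangle_ineq4[of "R x + (proj W - proj L) x" "(proj W - proj L) x"] by simp
  ultimately show ?thesis using A[of x] by (simp add: algebra_simps)
qed

lemma nearby_joined:
  assumes L: "L \<in> Lorbit J L0" and W: "W \<in> Lagrangians J" and hs: "hilbert_schmidt (proj W - proj L)"
    and near: "hs_norm (proj W - proj L) \<le> 1 / 2"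
  shows "W \<in> Lorbit J L0" "joined L W (72 * hs_norm (proj W - proj L))"
proof -
  have "norm ((proj W - proj L) x) \<le> (1/2) * norm x" for x
  proof -
    have "norm (proj W - proj L) \<le> 1 / 2"
      using norm_of_hs_le[of "Hs (proj W - proj L)"] near by (simp add: of_hs_Hs hs hs_norm_eq_norm_Hs)
    then show ?thesis by (meson mult_right_mono norm_blinfun norm_ge_zero order_trans)
  qed
  from gap_bounded_below[OF orbit_Lagrangian[OF L] this]
  have "\<And>x. (1/2) * norm x \<le> norm (gap_op L W x)" by simp
  from gap_bounded_below_joined[OF L W hs _ this]
  show "W \<in> Lorbit J L0" "joined L W (72 * hs_norm (proj W - proj L))" by simp_all
qed

end

section \<open>The orbit is connected\<close>

definition tensor :: "'a::real_inner \<Rightarrow> 'a \<Rightarrow> 'a bop" where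
  "tensor x y = blinfun_scaleR_left x o\<^sub>L blinfun_inner_right y"

lemma tensor_apply: "tensor x y z = (y \<bullet> z) *\<^sub>R x"
  by (simp add: tensor_def blinfun_inner_right.rep_eq)

lemma hilbert_schmidt_tensor: "hilbert_schmidt (tensor x y)"
proof -
  have "(\<lambda>e. (x \<bullet> x) * (y \<bullet> e)\<^sup>2) summable_on some_onb"
    using parseval[OF orthonormal_basis_some_onb, of y]
    by (intro summable_on_cmult_right) (auto simp: summable_on_def)
  then show ?thesis by (simp add: hilbert_schmidt_iff tensor_apply power2_eq_square mult_ac)
qed

lemma inner_tensor: "inner X (Hs (tensor x y)) = of_hs X y \<bullet> x"
proof -
  have "((\<lambda>e. (y \<bullet> e) * (adj (of_hs X) x \<bullet> e)) has_sum (y \<bullet> adj (of_hs X) x)) some_onb"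
    by (rule parseval_inner[OF orthonormal_basis_some_onb])
  then have "((\<lambda>e. of_hs X e \<bullet> tensor x y e) has_sum (of_hs X y \<bullet> x)) some_onb"
    by (simp add: tensor_apply adj_inner inner_commute)
  then show ?thesis by (simp add: inner_hs_def of_hs_Hs hilbert_schmidt_tensor infsumI)
qed

context lagrangian_orbit
begin

text \<open>
  If \<open>x \<in> W\<close> is almost orthogonal to \<open>L\<close>, in the sense that \<open>(norm (proj L x))\<^sup>2 \<le> 1/4\<close>, shear \<open>W\<close> so
  that \<open>x\<close> is replaced by \<open>x \<plusminus> J x\<close>, turning it by \<open>\<pi>/4\<close> towards the line of \<open>J x\<close>, which is almost
  contained in \<open>L\<close>. For the right sign this lowers the squared Hilbert-Schmidt distance of the
  projections by a fixed amount.
\<close>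

lemma shear_towards:
  assumes L: "L \<in> Lorbit J L0" and W: "W \<in> Lorbit J L0"
    and x: "x \<in> W" "norm x = 1" and far: "(proj W - proj L) x \<bullet> x \<ge> 3/4"
  obtains V l where "V \<in> Lorbit J L0" "joined W V l"
    "(norm (pdiff L V))\<^sup>2 \<le> (norm (pdiff L W))\<^sup>2 - 1/2"
proof -
  note LL = orbit_Lagrangian[OF L] and WW = orbit_Lagrangian[OF W]
  note W' = LagrangianD[OF WW]
  define A where "A = proj W - proj L"
  have Jx: "J x \<in> W\<^sup>\<bottom>" using W'(3) x by blast
  have xx: "x \<bullet> x = 1" using x by (simp add: norm_eq_1)
  have JxJx: "J x \<bullet> J x = 1" by (simp add: J_inner_J xx)
  have xJx: "x \<bullet> J x = 0" "J x \<bullet> x = 0" using orthogonal_compD[OF Jx x(1)] by (auto simp: inner_commute)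
  \<comment> \<open>The sign makes the mixed term \<open>A x \<bullet> J x\<close> contribute a decrease.\<close>
  define c :: real where "c = (if A x \<bullet> J x \<le> 0 then 1 else - 1)"
  have cc: "c * c = 1" and cneg: "c * (A x \<bullet> J x) \<le> 0" by (auto simp: c_def)
  define T where "T = tensor (c *\<^sub>R J x) x"
  have T_apply: "T z = (c * (x \<bullet> z)) *\<^sub>R J x" for z by (simp add: T_def tensor_apply mult.commute)
  have T: "shear_generator W T"
    unfolding shear_generator_def
  proof (intro conjI ballI allI)
    show "hilbert_schmidt T" unfolding T_def by (rule hilbert_schmidt_tensor)
    show "T z = 0" if "z \<in> W\<^sup>\<bottom>" for z using orthogonal_compD[OF that x(1)] by (simp add: T_apply inner_commute)
    show "T z \<in> W\<^sup>\<bottom>" for z unfolding T_apply by (rule subspace_scale[OF subspace_orthogonal_comp Jx])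
    show "J (T y) \<bullet> z = y \<bullet> J (T z)" for y z
      by (simp add: T_apply blinfun.scaleR_right J_J inner_commute)
  qed
  define V where "V = graph_of W T"
  have V: "V \<in> Lorbit J L0" unfolding V_def by (rule graph_of_orbit[OF W T])
  note V' = LagrangianD[OF orbit_Lagrangian[OF V]]
  \<comment> \<open>\<open>V\<close> arises from \<open>W\<close> by exchanging \<open>x\<close> for \<open>u\<close>, a vector of squared norm \<open>2\<close>.\<close>
  define u where "u = x + c *\<^sub>R J x"
  have proj_V: "proj V z = proj W z - (x \<bullet> z) *\<^sub>R x + (1/2 * (u \<bullet> z)) *\<^sub>R u" for z
  proof (rule proj_unique[OF V'(1,2)])
    let ?q = "proj W z - (x \<bullet> z) *\<^sub>R x + (1/2 * (u \<bullet> z)) *\<^sub>R u"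
    note pW = proj_characterization[OF W'(1,2), of z]
    have xPz: "x \<bullet> proj W z = x \<bullet> z"
      using orthogonal_compD[OF pW(2) x(1)] by (simp add: inner_diff_left inner_diff_right inner_commute)
    define v where "v = proj W z - (x \<bullet> z) *\<^sub>R x + (1/2 * (u \<bullet> z)) *\<^sub>R x"
    have "v \<in> W" unfolding v_def by (intro subspace_add subspace_diff subspace_scale W'(1) pW(1) x(1))
    moreover have "x \<bullet> v = 1/2 * (u \<bullet> z)" by (simp add: v_def inner_add_right inner_diff_right xPz xx)
    then have "?q = v + T v" by (simp add: T_apply v_def u_def algebra_simps)
    ultimately show "?q \<in> V" unfolding V_def graph_of_def by blast
    show "z - ?q \<in> V\<^sup>\<bottom>"
    proof (rule orthogonal_compI)
      fix y assume "y \<in> V"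
      then obtain w where w: "w \<in> W" "y = w + (c * (x \<bullet> w)) *\<^sub>R J x"
        unfolding V_def graph_of_def T_apply by blast
      have Jw: "J x \<bullet> w = 0" using orthogonal_compD[OF Jx w(1)] .
      have JPz: "proj W z \<bullet> J x = 0" using orthogonal_compD[OF Jx pW(1)] by (simp add: inner_commute)
      have Pzw: "proj W z \<bullet> w = z \<bullet> w" using orthogonal_compD[OF pW(2) w(1)] by (simp add: inner_diff_left)
      define \<beta> where "\<beta> = x \<bullet> z"
      define \<delta> where "\<delta> = J x \<bullet> z"
      define m where "m = x \<bullet> w"
      have uz: "u \<bullet> z = \<beta> + c * \<delta>" by (simp add: u_def inner_add_left \<beta>_def \<delta>_def)
      have uw: "u \<bullet> w = m" "u \<bullet> J x = c" by (simp_all add: u_def inner_add_left Jw m_def xJx JxJx)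
      have "(z - ?q) \<bullet> w = \<beta> * m - 1/2 * (\<beta> + c * \<delta>) * m"
        by (simp add: inner_diff_left inner_add_left Pzw uz uw) (simp add: \<beta>_def m_def)
      moreover have "(z - ?q) \<bullet> J x = \<delta> - 1/2 * (\<beta> + c * \<delta>) * c"
        by (simp add: inner_diff_left inner_add_left JPz uz uw xJx) (simp add: \<delta>_def inner_commute)
      ultimately have "(z - ?q) \<bullet> y = \<beta> * m - 1/2 * (\<beta> + c * \<delta>) * m + (c * m) * (\<delta> - 1/2 * (\<beta> + c * \<delta>) * c)"
        by (simp only: w(2) inner_add_right inner_scaleR_right m_def)
      also have "\<dots> = m * (\<beta> + c * \<delta>) - 1/2 * m * (\<beta> + c * \<delta>) - 1/2 * m * (\<beta> + c * \<delta>) * (c * c)"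
        by (simp add: algebra_simps)
      also have "\<dots> = 0" by (simp add: cc)
      finally show "(z - ?q) \<bullet> y = 0" .
    qed
  qed
  define B where "B = (1/2) *\<^sub>R Hs (tensor u u) - Hs (tensor x x)"
  have ofB: "of_hs B z = (1/2 * (u \<bullet> z)) *\<^sub>R u - (x \<bullet> z) *\<^sub>R x" for z
    by (simp add: B_def of_hs_simps of_hs_Hs hilbert_schmidt_tensor blinfun.bilinear_simps tensor_apply)
  have pV: "pdiff L V = pdiff L W + B"
    by (intro of_hs_eqI blinfun_eqI)
       (simp add: of_hs_simps of_hs_pdiff V W L blinfun.diff_left blinfun.add_left proj_V ofB)
  have ux: "u \<bullet> x = 1" "x \<bullet> u = 1" and uu: "u \<bullet> u = 2"
    by (simp_all add: u_def inner_add_left inner_add_right xx xJx JxJx cc)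
  have BB: "inner B B = 1"
    by (subst (2) B_def) (simp add: inner_diff_right inner_tensor ofB inner_diff_left ux uu xx)
  have AJ: "A (J x) = - J (A x)"
    by (simp add: A_def blinfun.diff_left blinfun.diff_right proj_J[OF LL] proj_J[OF WW])
  have adjA: "adj A = A" using W' LagrangianD[OF LL] by (simp add: A_def adj_diff adj_proj)
  have AJJ: "A (J x) \<bullet> J x = - (A x \<bullet> x)" by (simp add: AJ J_inner_J)
  have AJx: "A (J x) \<bullet> x = A x \<bullet> J x" using adj_inner(1)[of "J x" A x] adjA by (simp add: inner_commute)
  have "A u \<bullet> u = 2 * (c * (A x \<bullet> J x)) + (A x \<bullet> x) - c * c * (A x \<bullet> x)"
    by (simp add: u_def blinfun.add_right blinfun.scaleR_right inner_add_left inner_add_right AJJ AJx algebra_simps)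
  then have Auu: "A u \<bullet> u = 2 * (c * (A x \<bullet> J x))" by (simp add: cc)
  have "inner (pdiff L W) B = c * (A x \<bullet> J x) - A x \<bullet> x"
    using Auu by (simp add: B_def inner_diff_right inner_tensor of_hs_pdiff W L A_def)
  then have "inner (pdiff L W) B \<le> - 3/4" using cneg far by (simp add: A_def)
  moreover have "(norm (pdiff L V))\<^sup>2 = (norm (pdiff L W))\<^sup>2 + 2 * inner (pdiff L W) B + inner B B"
    by (simp add: pV power2_norm_eq_inner inner_add_left inner_add_right inner_commute)
  ultimately have "(norm (pdiff L V))\<^sup>2 \<le> (norm (pdiff L W))\<^sup>2 - 1/2" using BB by simp
  moreover have "joined W V (18 * hs_norm T)" unfolding V_def by (rule joined_by_shear[OF W T])
  ultimately show ?thesis using that V by blast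
qed

text \<open>
  Symmetry under \<open>J\<close> transfers the hypothesis from \<open>W\<close> and \<open>L\<close> to \<open>W\<^sup>\<bottom>\<close> and \<open>L\<^sup>\<bottom>\<close>. The difference of the
  projections maps \<open>W\<close> into \<open>L\<^sup>\<bottom>\<close> and \<open>W\<^sup>\<bottom>\<close> into \<open>L\<close>, so the bounds on the two parts add up.
\<close>

lemma proj_diff_contraction:
  assumes L: "L \<in> Lagrangians J" and W: "W \<in> Lagrangians J"
    and near: "\<And>x. x \<in> W \<Longrightarrow> norm x = 1 \<Longrightarrow> (proj W - proj L) x \<bullet> x \<le> 3/4"
  shows "norm ((proj W - proj L) z) \<le> (7/8) * norm z"
proof -
  note L' = LagrangianD[OF L] and W' = LagrangianD[OF W]
  define A where "A = proj W - proj L"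
  have onW: "(norm (A w))\<^sup>2 \<le> 3/4 * (norm w)\<^sup>2" if w: "w \<in> W" for w
  proof (cases "w = 0")
    case False
    have "A (w /\<^sub>R norm w) \<bullet> (w /\<^sub>R norm w) \<le> 3/4" unfolding A_def
      by (rule near) (use False w W'(1) in \<open>auto intro: subspace_scale\<close>)
    then have "A w \<bullet> w \<le> 3/4 * (norm w)\<^sup>2"
      using False by (simp add: blinfun.scaleR_right power2_eq_square field_simps)
    moreover have "proj W w = w" using proj_mem_iff[OF W'(1,2)] w by blast
    then have "A w = w - proj L w" by (simp add: A_def blinfun.diff_left)
    moreover have "(w - proj L w) \<bullet> proj L w = 0"
      using proj_characterization[OF L'(1,2)] orthogonal_compD by blast
    ultimately show ?thesis
      by (simp add: power2_norm_eq_inner inner_diff_right)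
  qed (simp add: blinfun.zero_right)
  have AJ: "A (J y) = - J (A y)" for y
    by (simp add: A_def blinfun.diff_left blinfun.diff_right proj_J[OF L] proj_J[OF W])
  define w where "w = proj W z"
  define v where "v = z - w"
  have w: "w \<in> W" and v: "v \<in> W\<^sup>\<bottom>" using proj_characterization[OF W'(1,2)] by (auto simp: w_def v_def)
  have "(norm (A v))\<^sup>2 \<le> 3/4 * (norm v)\<^sup>2"
    using onW[OF W'(4)[OF v]] by (simp add: AJ norm_J)
  moreover have "A w \<bullet> A v = 0"
  proof -
    have "proj W w = w" "proj W v = 0" using proj_mem_iff[OF W'(1,2)] proj_zero_iff[OF W'(1,2)] w v by auto
    then have "A w \<bullet> A v = - ((w - proj L w) \<bullet> proj L v)" by (simp add: A_def blinfun.diff_left)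
    also have "\<dots> = 0" using proj_characterization[OF L'(1,2)] orthogonal_compD by (metis neg_equal_0_iff_equal)
    finally show ?thesis .
  qed
  moreover have "w \<bullet> v = 0" using orthogonal_compD[OF v w] by (simp add: inner_commute)
  moreover have "z = w + v" by (simp add: v_def)
  ultimately have "(norm (A z))\<^sup>2 \<le> 3/4 * (norm z)\<^sup>2"
    using onW[OF w] by (simp add: blinfun.add_right power2_norm_eq_inner inner_add_left inner_add_right inner_commute)
  \<comment> \<open>\<open>7/8\<close> is a rational number below \<open>1\<close> whose square is at least \<open>3/4\<close>.\<close>
  also have "\<dots> \<le> ((7/8) * norm z)\<^sup>2" by (simp add: power_mult_distrib power2_eq_square)
  finally show ?thesis unfolding A_def by (rule power2_le_imp_le) auto
qed

text \<open>
  Each application of \<open>shear_towards\<close> lowers the squared distance of the projections by \<open>1/2\<close>, so twice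
  this squared distance bounds the number of applications before \<open>proj_diff_contraction\<close> takes over.
\<close>

lemma orbit_connected:
  assumes L: "L \<in> Lorbit J L0" and W: "W \<in> Lorbit J L0"
  shows "\<exists>l. joined L W l"
proof -
  obtain n :: nat where "2 * (norm (pdiff L W))\<^sup>2 \<le> n" using real_arch_simple by blast
  then show ?thesis using W
  proof (induction n arbitrary: W)
    case (0 W)
    then have "pdiff L W = 0" by simp
    then have "of_hs (pdiff L W) = 0" by (simp add: of_hs_simps)
    then have "proj W = proj L" using 0 L by (simp add: of_hs_pdiff)
    then have "W = L" using proj_inject LagrangianD(1,2) orbit_Lagrangian 0 L by metis
    then show ?case using joined_refl[OF L] by blast
  next
    case (Suc n W)
    note LL = orbit_Lagrangian[OF L] and WW = orbit_Lagrangian[OF Suc.prems(2)]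
    show ?case
    proof (cases "\<exists>x\<in>W. norm x = 1 \<and> (proj W - proj L) x \<bullet> x \<ge> 3/4")
      case True
      then obtain V l where V: "V \<in> Lorbit J L0" "joined W V l"
        "(norm (pdiff L V))\<^sup>2 \<le> (norm (pdiff L W))\<^sup>2 - 1/2"
        using shear_towards[OF L Suc.prems(2)] by metis
      then have "2 * (norm (pdiff L V))\<^sup>2 \<le> n" using Suc.prems(1) by simp
      then obtain m where "joined L V m" using Suc.IH V(1) by blast
      then show ?thesis using joined_trans joined_sym[OF V(2)] by blast
    next
      case False
      then have "norm ((proj W - proj L) z) \<le> (7/8) * norm z" for z
        by (intro proj_diff_contraction[OF LL WW]) (meson less_imp_le not_le)
      from gap_bounded_below[OF LL this] have "\<And>x. (1/8) * norm x \<le> norm (gap_op L W x)" by simp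
      from gap_bounded_below_joined(2)[OF L WW orbit_proj_diff[OF Suc.prems(2) L] _ this] show ?thesis by auto
    qed
  qed
qed

section \<open>The ambient distance\<close>

lemma joined_orbit: "joined S T l \<Longrightarrow> S \<in> Lorbit J L0 \<and> T \<in> Lorbit J L0"
  unfolding joined_def smooth_curve_iff by force

lemma joined_nonneg: "joined S T l \<Longrightarrow> l \<ge> 0"
  unfolding joined_def using ambient_length_nonneg order_trans by blast

lemma ambient_dist_le:
  assumes "joined S T l"
  shows "ambient_dist J L0 S T \<le> l"
proof -
  obtain \<gamma> where \<gamma>: "smooth_curve J L0 \<gamma>" "\<gamma> 0 = S" "\<gamma> 1 = T" "ambient_length J \<gamma> \<le> l"
    using assms by (auto simp: joined_def)
  have "Inf {ambient_length J \<gamma> | \<gamma>. smooth_curve J L0 \<gamma> \<and> \<gamma> 0 = S \<and> \<gamma> 1 = T} \<le> ambient_length J \<gamma>"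
    by (rule cInf_lower) (use \<gamma> ambient_length_nonneg in \<open>auto intro!: bdd_belowI[of _ 0]\<close>)
  then show ?thesis using joined_orbit[OF assms] \<gamma>(4) by (simp add: ambient_dist_def)
qed

lemma joined_if_ambient_dist_less:
  assumes "S \<in> Lorbit J L0" "T \<in> Lorbit J L0" "ambient_dist J L0 S T < l"
  shows "joined S T l"
proof -
  let ?A = "{ambient_length J \<gamma> | \<gamma>. smooth_curve J L0 \<gamma> \<and> \<gamma> 0 = S \<and> \<gamma> 1 = T}"
  have "?A \<noteq> {}" using orbit_connected[OF assms(1,2)] by (auto simp: joined_def)
  moreover have "Inf ?A < l" using assms by (simp add: ambient_dist_def)
  ultimately have "\<exists>a\<in>?A. a < l" by (rule cInf_lessD)
  then show ?thesis unfolding joined_def by (auto intro: less_imp_le)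
qed

lemma ambient_dist_nonneg: "ambient_dist J L0 S T \<ge> 0"
proof (rule ccontr)
  assume "\<not> ambient_dist J L0 S T \<ge> 0"
  then have "S \<in> Lorbit J L0" "T \<in> Lorbit J L0" "ambient_dist J L0 S T < 0"
    by (auto simp: ambient_dist_def split: if_splits)
  then have "joined S T (ambient_dist J L0 S T / 2)" by (intro joined_if_ambient_dist_less) auto
  then show False using joined_nonneg \<open>ambient_dist J L0 S T < 0\<close> by fastforce
qed

lemma projection_distance_le_ambient_dist:
  assumes "S \<in> Lorbit J L0" "T \<in> Lorbit J L0"
  shows "norm (pdiff S T) \<le> sqrt 2 * ambient_dist J L0 S T"
proof (rule field_le_epsilon)
  fix \<epsilon> :: real assume e: "\<epsilon> > 0"
  have "joined S T (ambient_dist J L0 S T + \<epsilon> / sqrt 2)"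
    using e by (intro joined_if_ambient_dist_less assms) simp
  then obtain \<gamma> where \<gamma>: "smooth_curve J L0 \<gamma>" "\<gamma> 0 = S" "\<gamma> 1 = T"
    "ambient_length J \<gamma> \<le> ambient_dist J L0 S T + \<epsilon> / sqrt 2"
    by (auto simp: joined_def)
  have "norm (pdiff S T) \<le> sqrt 2 * ambient_length J \<gamma>"
    using projection_chord_le_ambient_length[OF \<gamma>(1)] \<gamma>(2,3) by simp
  also have "\<dots> \<le> sqrt 2 * (ambient_dist J L0 S T + \<epsilon> / sqrt 2)" by (intro mult_left_mono \<gamma>(4)) simp
  finally show "norm (pdiff S T) \<le> sqrt 2 * ambient_dist J L0 S T + \<epsilon>" by (simp add: distrib_left)
qed

lemma ambient_dist_metric: "Metric_space (Lorbit J L0) (ambient_dist J L0)"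
proof
  let ?d = "ambient_dist J L0"
  show "0 \<le> ?d S T" for S T by (rule ambient_dist_nonneg)
  have le: "?d T S \<le> ?d S T" if "S \<in> Lorbit J L0" "T \<in> Lorbit J L0" for S T
    by (rule field_le_epsilon, rule ambient_dist_le, rule joined_sym, rule joined_if_ambient_dist_less)
       (use that in auto)
  show "?d S T = ?d T S" for S T
  proof (cases "S \<in> Lorbit J L0 \<and> T \<in> Lorbit J L0")
    case True then show ?thesis using le[of S T] le[of T S] by auto
  qed (auto simp: ambient_dist_def)
  fix S T U assume S: "S \<in> Lorbit J L0" and T: "T \<in> Lorbit J L0"
  show "?d S T = 0 \<longleftrightarrow> S = T"
  proof
    assume "?d S T = 0"
    then have "pdiff S T = 0" using projection_distance_le_ambient_dist[OF S T] by simp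
    then have "of_hs (pdiff S T) = 0" by (simp add: of_hs_simps)
    then have "proj T = proj S" using S T by (simp add: of_hs_pdiff)
    then show "S = T" using proj_inject LagrangianD(1,2) orbit_Lagrangian S T by metis
  next
    assume "S = T"
    then show "?d S T = 0" using ambient_dist_le[OF joined_refl[OF S]] ambient_dist_nonneg[of S S] by simp
  qed
  assume U: "U \<in> Lorbit J L0"
  show "?d S U \<le> ?d S T + ?d T U"
  proof (rule field_le_epsilon)
    fix \<epsilon> :: real assume "\<epsilon> > 0"
    then have "joined S T (?d S T + \<epsilon> / 2)" "joined T U (?d T U + \<epsilon> / 2)"
      by (intro joined_if_ambient_dist_less S T U; simp)+
    then have "joined S U ((?d S T + \<epsilon> / 2) + (?d T U + \<epsilon> / 2))" by (rule joined_trans)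
    from ambient_dist_le[OF this] show "?d S U \<le> ?d S T + ?d T U + \<epsilon>" by simp
  qed
qed

text \<open>
  Projections commuting suitably with \<open>J\<close> form a closed set, so the limit of the projections along a
  Cauchy sequence belongs to a Lagrangian, and nearby Lagrangians are joined by short shears.
\<close>

lemma ambient_dist_complete: "Metric_space.mcomplete (Lorbit J L0) (ambient_dist J L0)"
proof -
  interpret M: Metric_space "Lorbit J L0" "ambient_dist J L0" by (rule ambient_dist_metric)
  have "\<exists>W. limitin M.mtopology \<sigma> W sequentially" if C: "M.MCauchy \<sigma>" for \<sigma>
  proof -
    have \<sigma>: "\<sigma> n \<in> Lorbit J L0" for n using C by (auto simp: M.MCauchy_def)
    define X where "X n = pdiff L0 (\<sigma> n)" for n
    have dX: "X n - X m = pdiff (\<sigma> m) (\<sigma> n)" for m n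
      using pdiff_change_base[OF \<sigma> L0_orbit \<sigma>, of n m] by (simp add: X_def)
    have "Cauchy X"
    proof (rule metric_CauchyI)
      fix e :: real assume "e > 0"
      then have "e / sqrt 2 > 0" by simp
      then obtain N where N: "\<And>m n. N \<le> m \<Longrightarrow> N \<le> n \<Longrightarrow> ambient_dist J L0 (\<sigma> m) (\<sigma> n) < e / sqrt 2"
        using C unfolding M.MCauchy_def by meson
      have "dist (X m) (X n) < e" if "m \<ge> N" "n \<ge> N" for m n
      proof -
        have "dist (X m) (X n) \<le> sqrt 2 * ambient_dist J L0 (\<sigma> n) (\<sigma> m)"
          unfolding dist_norm dX by (rule projection_distance_le_ambient_dist[OF \<sigma> \<sigma>])
        also have "\<dots> < sqrt 2 * (e / sqrt 2)" by (intro mult_strict_left_mono N that) simp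
        finally show ?thesis by simp
      qed
      then show "\<exists>M. \<forall>m\<ge>M. \<forall>n\<ge>M. dist (X m) (X n) < e" by blast
    qed
    then obtain Y where Y: "X \<longlonglongrightarrow> Y" by (auto dest!: Cauchy_convergent simp: convergent_def)
    define P where "P = of_hs Y + proj L0"
    have "(\<lambda>n. of_hs (X n) + proj L0) \<longlonglongrightarrow> P"
      unfolding P_def by (intro tendsto_intros bounded_linear.tendsto[OF bounded_linear_of_hs Y])
    then have P: "(\<lambda>n. proj (\<sigma> n)) \<longlonglongrightarrow> P" by (simp add: X_def of_hs_pdiff \<sigma> L0_orbit)
    note LD = LagrangianD[OF orbit_Lagrangian[OF \<sigma>]]
    have idem: "P o\<^sub>L P = P"
    proof (rule LIMSEQ_unique[OF _ P])
      have "(\<lambda>n. (proj (\<sigma> n) o\<^sub>L proj (\<sigma> n))) \<longlonglongrightarrow> (P o\<^sub>L P)"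
        by (rule bounded_bilinear.tendsto[OF bounded_bilinear_blinfun_compose P P])
      moreover have "proj (\<sigma> n) o\<^sub>L proj (\<sigma> n) = proj (\<sigma> n)" for n
        by (rule blinfun_eqI) (simp add: proj_idem LD)
      ultimately show "(\<lambda>n. proj (\<sigma> n)) \<longlonglongrightarrow> (P o\<^sub>L P)" by simp
    qed
    have sym: "adj P = P"
      using bounded_linear.tendsto[OF bounded_linear_adj P] P
      by (intro LIMSEQ_unique[OF _ P]) (simp add: adj_proj LD)
    have PJ: "P (J x) = J x - J (P x)" for x
    proof (rule LIMSEQ_unique)
      show "(\<lambda>n. proj (\<sigma> n) (J x)) \<longlonglongrightarrow> P (J x)" by (intro tendsto_intros P)
      show "(\<lambda>n. proj (\<sigma> n) (J x)) \<longlonglongrightarrow> J x - J (P x)"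
        unfolding proj_J[OF orbit_Lagrangian[OF \<sigma>]] by (intro tendsto_intros P)
    qed
    define W where "W = range P"
    have W: "W \<in> Lagrangians J" and pW: "proj W = P"
      unfolding W_def using Lagrangian_if_projection[OF idem sym PJ] range_symmetric_idempotent[OF idem sym] by auto
    have diff: "proj W - proj (\<sigma> n) = of_hs (Y - X n)" for n
      by (simp add: pW P_def of_hs_simps X_def of_hs_pdiff \<sigma> L0_orbit)
    have hs: "hilbert_schmidt (proj W - proj (\<sigma> n))" for n by (simp add: diff)
    have near: "W \<in> Lorbit J L0 \<and> ambient_dist J L0 (\<sigma> n) W \<le> 72 * norm (Y - X n)"
      if "norm (Y - X n) \<le> 1/2" for n
    proof -
      have "hs_norm (proj W - proj (\<sigma> n)) = norm (Y - X n)" by (simp add: diff norm_hs_eq)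
      then show ?thesis using nearby_joined[OF \<sigma> W hs] that ambient_dist_le by metis
    qed
    have small: "\<exists>N. \<forall>n\<ge>N. norm (Y - X n) < r" if "r > 0" for r
      using LIMSEQ_D[OF Y that] by (simp add: norm_minus_commute)
    obtain N where "\<forall>n\<ge>N. norm (Y - X n) < 1/2" using small[of "1/2"] by auto
    then have WO: "W \<in> Lorbit J L0" using near[of N] by (simp add: less_imp_le)
    have "\<exists>N. \<forall>n\<ge>N. \<sigma> n \<in> Lorbit J L0 \<and> ambient_dist J L0 (\<sigma> n) W < \<epsilon>" if e: "\<epsilon> > 0" for \<epsilon>
    proof -
      obtain N where N: "\<forall>n\<ge>N. norm (Y - X n) < min (1/2) (\<epsilon> / 72)"
        using small[of "min (1/2) (\<epsilon> / 72)"] e by auto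
      have "ambient_dist J L0 (\<sigma> n) W < \<epsilon>" if "n \<ge> N" for n
      proof -
        have "norm (Y - X n) < 1/2" "norm (Y - X n) < \<epsilon> / 72" using N that by auto
        then show ?thesis using near[of n] by simp
      qed
      then show ?thesis using \<sigma> by blast
    qed
    then have "limitin M.mtopology \<sigma> W sequentially" using WO by (simp add: M.limit_metric_sequentially)
    then show ?thesis by blast
  qed
  then show ?thesis by (simp add: M.mcomplete_def)
qed

end

theorem theorem4p5:
  fixes J :: "'a::{real_inner, complete_space} \<Rightarrow>\<^sub>L 'a" and L0 :: "'a set"
  assumes infinite_dim: "\<not> (\<exists>B::'a set. finite B \<and> span B = UNIV)"
    and J_isometry: "\<forall>x. norm (J x) = norm x"
    and J_square: "J o\<^sub>L J = - id_blinfun"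
    and J_adj: "adj J = - J"
    and L0: "L0 \<in> Lagrangians J"
  shows "Metric_space (Lorbit J L0) (ambient_dist J L0) \<and>
         Metric_space.mcomplete (Lorbit J L0) (ambient_dist J L0)"
proof -
  interpret lagrangian_orbit J L0
  proof
    show "norm (J x) = norm x" for x using J_isometry by blast
    show "J (J x) = - x" for x
      using arg_cong[OF J_square, of "\<lambda>b. blinfun_apply b x"] by (simp add: blinfun.minus_left)
  qed (use J_adj L0 in auto)
  show ?thesis using ambient_dist_metric ambient_dist_complete by blast
qed

end
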